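(* Let $P$ be a Hilbert space of dimension $p$ over the quaternion field $\mathbb{H}$ with $p\geq 2$, and let $C=\{w\in\mathcal{L}(P): w^*=-w\}$ be a type $III_{2p}^{\mathbb{H}}$ real Cartan factor. Let $I$ be a weak$^*$-closed subtriple of $C$ which is weak$^*$-Hahn--Banach smooth in $C$ and has rank $\geq 2$. Then $I$ is an inner ideal of $C$.
   Context: $\mathcal{L}(P)$ is the real Banach space of bounded $\mathbb{H}$-linear operators on $P$ with the operator norm and the triple product $\{a,b,c\}=\frac12(ab^*c+cb^*a)$; $C$ is a weak$^*$-closed subtriple of it and hence a real JBW$^*$-triple, i.e. a real JB$^*$-triple (a norm-closed real subtriple of a complex JB$^*$-triple) which is a dual Banach space, with a unique isometric predual $C_*$ and separately weak$^*$-continuous triple product. A subtriple is a (real) linear subspace closed under the triple product. A weak$^*$-closed subspace $Z$ of a dual Banach space $X$ with predual $X_*$ is weak$^*$-Hahn--Banach smooth if every weak$^*$-continuous functional on $Z$ admits a unique norm-preserving extension to a functional in $X_*$ (a weak$^*$-continuous functional on $X$). Elements $x,y$ are orthogonal if $\{x,y,z\}=0$ for all $z$ (equivalently $\{x,x,y\}=0$). A subset $S$ of a real JB$^*$-triple is orthogonal if $0\notin S$ and any two distinct elements of $S$ are orthogonal; the rank of a real JB$^*$-triple is the minimal cardinal $m$ such that $\mathrm{card}(S)\le m$ for every orthogonal subset $S$. An inner ideal of $C$ is a closed subtriple $I$ with $\{I,C,I\}\subseteq I$. *)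

theory Defs
  imports "HOL-Analysis.Analysis"
begin

unbundle cardinal_syntax

section \<open>The quaternions\<close>

datatype quat = Quat (qRe: real) (qIm1: real) (qIm2: real) (qIm3: real)

lemma quat_eq_iff:
  "x = y \<longleftrightarrow> qRe x = qRe y \<and> qIm1 x = qIm1 y \<and> qIm2 x = qIm2 y \<and> qIm3 x = qIm3 y"
  by (cases x; cases y) auto

definition qcnj :: "quat \<Rightarrow> quat" where
  "qcnj x = Quat (qRe x) (- qIm1 x) (- qIm2 x) (- qIm3 x)"

instantiation quat :: real_div_algebra
begin

definition "0 = Quat 0 0 0 0"
definition "1 = Quat 1 0 0 0"
definition "x + y = Quat (qRe x + qRe y) (qIm1 x + qIm1 y) (qIm2 x + qIm2 y) (qIm3 x + qIm3 y)"
definition "- x = Quat (- qRe x) (- qIm1 x) (- qIm2 x) (- qIm3 x)"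
definition "x - y = Quat (qRe x - qRe y) (qIm1 x - qIm1 y) (qIm2 x - qIm2 y) (qIm3 x - qIm3 y)"
definition "r *\<^sub>R x = Quat (r * qRe x) (r * qIm1 x) (r * qIm2 x) (r * qIm3 x)"
definition
  "x * y = Quat
     (qRe x * qRe y - qIm1 x * qIm1 y - qIm2 x * qIm2 y - qIm3 x * qIm3 y)
     (qRe x * qIm1 y + qIm1 x * qRe y + qIm2 x * qIm3 y - qIm3 x * qIm2 y)
     (qRe x * qIm2 y - qIm1 x * qIm3 y + qIm2 x * qRe y + qIm3 x * qIm1 y)
     (qRe x * qIm3 y + qIm1 x * qIm2 y - qIm2 x * qIm1 y + qIm3 x * qRe y)"
definition
  "inverse x = (1 / ((qRe x)\<^sup>2 + (qIm1 x)\<^sup>2 + (qIm2 x)\<^sup>2 + (qIm3 x)\<^sup>2)) *\<^sub>R qcnj x"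
definition "x div (y :: quat) = x * inverse y"

lemmas quat_ops_defs =
  zero_quat_def one_quat_def plus_quat_def uminus_quat_def minus_quat_def
  scaleR_quat_def times_quat_def inverse_quat_def divide_quat_def qcnj_def

instance
proof
  fix x y z :: quat and r s :: real
  have pos: "(qRe x)\<^sup>2 + (qIm1 x)\<^sup>2 + (qIm2 x)\<^sup>2 + (qIm3 x)\<^sup>2 \<noteq> 0" if "x \<noteq> 0"
    using that by (auto simp: quat_eq_iff zero_quat_def add_nonneg_eq_0_iff)
  have *: "x * qcnj x = ((qRe x)\<^sup>2 + (qIm1 x)\<^sup>2 + (qIm2 x)\<^sup>2 + (qIm3 x)\<^sup>2) *\<^sub>R 1"
    "qcnj x * x = ((qRe x)\<^sup>2 + (qIm1 x)\<^sup>2 + (qIm2 x)\<^sup>2 + (qIm3 x)\<^sup>2) *\<^sub>R 1"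
    by (auto simp: quat_eq_iff quat_ops_defs power2_eq_square)
  have s1: "(r *\<^sub>R a) * b = r *\<^sub>R (a * b)" "a * (r *\<^sub>R b) = r *\<^sub>R (a * b)" for a b :: quat and r
    by (auto simp: quat_eq_iff quat_ops_defs algebra_simps)
  have s2: "r *\<^sub>R s *\<^sub>R a = (r * s) *\<^sub>R a" "1 *\<^sub>R a = a" for a :: quat and r s
    by (auto simp: quat_eq_iff scaleR_quat_def)
  show "inverse x * x = 1" if "x \<noteq> 0"
    using pos[OF that] by (simp add: inverse_quat_def s1 * s2)
  show "x * inverse x = 1" if "x \<noteq> 0"
    using pos[OF that] by (simp add: inverse_quat_def s1 * s2)
  show "x div y = x * inverse y" by (simp add: divide_quat_def)
  show "inverse (0::quat) = 0" by (simp add: quat_ops_defs)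
qed (auto simp: quat_eq_iff quat_ops_defs algebra_simps)

end

section \<open>Quaternionic Hilbert spaces\<close>

text \<open>Left vector spaces over the quaternions with a quaternion-valued inner product that is
  linear in the first argument. The underlying real inner product is the real part of it, so
  that the norm is \<open>sqrt (qRe (qinner x x))\<close>.\<close>

class quat_inner = real_inner +
  fixes scaleQ :: "quat \<Rightarrow> 'a \<Rightarrow> 'a" (infixr "*\<^sub>Q" 75)
    and qinner :: "'a \<Rightarrow> 'a \<Rightarrow> quat"
  assumes scaleQ_add_right: "a *\<^sub>Q (x + y) = a *\<^sub>Q x + a *\<^sub>Q y"
    and scaleQ_add_left: "(a + b) *\<^sub>Q x = a *\<^sub>Q x + b *\<^sub>Q x"
    and scaleQ_scaleQ: "a *\<^sub>Q b *\<^sub>Q x = (a * b) *\<^sub>Q x"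
    and scaleR_scaleQ: "r *\<^sub>R x = of_real r *\<^sub>Q x"
    and qinner_add_left: "qinner (x + y) z = qinner x z + qinner y z"
    and qinner_scaleQ_left: "qinner (a *\<^sub>Q x) y = a * qinner x y"
    and qinner_commute: "qinner x y = qcnj (qinner y x)"
    and inner_eq_qRe: "inner x y = qRe (qinner x y)"

class quat_hilbert = quat_inner + complete_space
begin

subclass banach ..

end

definition quat_span :: "'a::quat_inner set \<Rightarrow> 'a set" where
  "quat_span B = {\<Sum>b\<in>F. c b *\<^sub>Q b | F c. finite F \<and> F \<subseteq> B}"

definition quat_orthonormal_basis :: "'a::quat_inner set \<Rightarrow> bool" where
  "quat_orthonormal_basis B \<longleftrightarrow>
     (\<forall>x\<in>B. \<forall>y\<in>B. qinner x y = (if x = y then 1 else 0)) \<and> closure (quat_span B) = UNIV"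

definition has_quat_hilbert_dim :: "'a::quat_hilbert itself \<Rightarrow> 'k rel \<Rightarrow> bool" where
  "has_quat_hilbert_dim _ p \<longleftrightarrow>
     Card_order p \<and> (\<exists>B :: 'a set. quat_orthonormal_basis B \<and> |B| =o p)"

section \<open>Operators and the triple product\<close>

text \<open>The bounded quaternion-linear operators form a closed real subspace of the space
  \<open>'a \<Rightarrow>\<^sub>L 'a\<close> of bounded real-linear ones, with the same operator norm.\<close>

definition quat_operators :: "('a::quat_hilbert \<Rightarrow>\<^sub>L 'a) set" where
  "quat_operators = {w. \<forall>q x. blinfun_apply w (q *\<^sub>Q x) = q *\<^sub>Q blinfun_apply w x}"

definition quat_adj :: "('a::quat_hilbert \<Rightarrow>\<^sub>L 'a) \<Rightarrow> ('a \<Rightarrow>\<^sub>L 'a)" where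
  "quat_adj w = (THE v. v \<in> quat_operators \<and>
     (\<forall>x y. qinner (blinfun_apply w x) y = qinner x (blinfun_apply v y)))"

definition triple_product ::
  "('a::quat_hilbert \<Rightarrow>\<^sub>L 'a) \<Rightarrow> ('a \<Rightarrow>\<^sub>L 'a) \<Rightarrow> ('a \<Rightarrow>\<^sub>L 'a) \<Rightarrow> ('a \<Rightarrow>\<^sub>L 'a)" where
  "triple_product a b c =
     (1/2) *\<^sub>R ((a o\<^sub>L quat_adj b o\<^sub>L c) + (c o\<^sub>L quat_adj b o\<^sub>L a))"

definition cartan_factor_III_H :: "('a::quat_hilbert \<Rightarrow>\<^sub>L 'a) set" where
  "cartan_factor_III_H = {w \<in> quat_operators. quat_adj w = - w}"

definition subtriple :: "('a::quat_hilbert \<Rightarrow>\<^sub>L 'a) set \<Rightarrow> bool" where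
  "subtriple T \<longleftrightarrow> T \<subseteq> quat_operators \<and> subspace T \<and>
     (\<forall>a\<in>T. \<forall>b\<in>T. \<forall>c\<in>T. triple_product a b c \<in> T)"

definition inner_ideal_of ::
  "('a::quat_hilbert \<Rightarrow>\<^sub>L 'a) set \<Rightarrow> ('a \<Rightarrow>\<^sub>L 'a) set \<Rightarrow> bool" where
  "inner_ideal_of C I \<longleftrightarrow> I \<subseteq> C \<and> closed I \<and> subtriple I \<and>
     (\<forall>a\<in>I. \<forall>c\<in>C. \<forall>b\<in>I. triple_product a c b \<in> I)"

section \<open>Rank\<close>

definition orthogonal_in ::
  "('a::quat_hilbert \<Rightarrow>\<^sub>L 'a) set \<Rightarrow> ('a \<Rightarrow>\<^sub>L 'a) \<Rightarrow> ('a \<Rightarrow>\<^sub>L 'a) \<Rightarrow> bool" where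
  "orthogonal_in T x y \<longleftrightarrow> (\<forall>z\<in>T. triple_product x y z = 0)"

definition orthogonal_subset ::
  "('a::quat_hilbert \<Rightarrow>\<^sub>L 'a) set \<Rightarrow> ('a \<Rightarrow>\<^sub>L 'a) set \<Rightarrow> bool" where
  "orthogonal_subset T S \<longleftrightarrow> S \<subseteq> T \<and> 0 \<notin> S \<and>
     (\<forall>x\<in>S. \<forall>y\<in>S. x \<noteq> y \<longrightarrow> orthogonal_in T x y)"

definition bounds_orthogonal_subsets ::
  "('a::quat_hilbert \<Rightarrow>\<^sub>L 'a) set \<Rightarrow> ('a \<Rightarrow>\<^sub>L 'a) rel \<Rightarrow> bool" where
  "bounds_orthogonal_subsets T m \<longleftrightarrow>
     Card_order m \<and> (\<forall>S. orthogonal_subset T S \<longrightarrow> |S| \<le>o m)"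

text \<open>The least cardinal bounding all orthogonal subsets, which is determined up to \<open>=o\<close>.
  Since \<open>|T|\<close> is such a bound, cardinals on the type of the operators suffice.\<close>

definition triple_rank :: "('a::quat_hilbert \<Rightarrow>\<^sub>L 'a) set \<Rightarrow> ('a \<Rightarrow>\<^sub>L 'a) rel" where
  "triple_rank T = (SOME m. bounds_orthogonal_subsets T m \<and>
     (\<forall>m'. bounds_orthogonal_subsets T m' \<longrightarrow> m \<le>o m'))"

section \<open>Preduals and the weak* topology\<close>

text \<open>\<open>isometric_predual X J\<close>: the Banach space \<open>'y\<close> is a predual of the subspace \<open>X\<close>, the map
  \<open>J\<close> being an isometric linear isomorphism of \<open>X\<close> onto the dual space of \<open>'y\<close>. Values of \<open>J\<close>
  outside \<open>X\<close> are irrelevant.\<close>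

definition isometric_predual ::
  "'a::real_normed_vector set \<Rightarrow> ('a \<Rightarrow> ('y::banach \<Rightarrow>\<^sub>L real)) \<Rightarrow> bool" where
  "isometric_predual X J \<longleftrightarrow>
     (\<forall>x\<in>X. \<forall>y\<in>X. J (x + y) = J x + J y) \<and>
     (\<forall>r. \<forall>x\<in>X. J (r *\<^sub>R x) = r *\<^sub>R J x) \<and>
     (\<forall>x\<in>X. norm (J x) = norm x) \<and>
     J ` X = UNIV"

text \<open>Here \<open>euclidean\<close> is the topology of pointwise convergence on \<open>'y \<Rightarrow> real\<close>.\<close>

definition weak_star_topology ::
  "'a::real_normed_vector set \<Rightarrow> ('a \<Rightarrow> ('y::banach \<Rightarrow>\<^sub>L real)) \<Rightarrow> 'a topology" where
  "weak_star_topology X J = pullback_topology X (\<lambda>x. blinfun_apply (J x)) euclidean"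

definition weak_star_functional_on ::
  "'a::real_normed_vector set \<Rightarrow> ('a \<Rightarrow> ('y::banach \<Rightarrow>\<^sub>L real)) \<Rightarrow> 'a set \<Rightarrow> ('a \<Rightarrow> real) \<Rightarrow> bool"
  where
  "weak_star_functional_on X J Z f \<longleftrightarrow>
     (\<forall>x\<in>Z. \<forall>y\<in>Z. f (x + y) = f x + f y) \<and>
     (\<forall>r. \<forall>x\<in>Z. f (r *\<^sub>R x) = r * f x) \<and>
     continuous_map (subtopology (weak_star_topology X J) Z) euclideanreal f"

definition functional_norm_on :: "'a::real_normed_vector set \<Rightarrow> ('a \<Rightarrow> real) \<Rightarrow> real" where
  "functional_norm_on Z f = (SUP z\<in>{z\<in>Z. norm z \<le> 1}. \<bar>f z\<bar>)"

text \<open>The functionals in the predual are the \<open>\<lambda>x. J x y\<close> with \<open>y :: 'y\<close>, of norm \<open>norm y\<close>;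
  distinct \<open>y\<close> give distinct functionals.\<close>

definition weak_star_hahn_banach_smooth ::
  "'a::real_normed_vector set \<Rightarrow> ('a \<Rightarrow> ('y::banach \<Rightarrow>\<^sub>L real)) \<Rightarrow> 'a set \<Rightarrow> bool" where
  "weak_star_hahn_banach_smooth X J Z \<longleftrightarrow>
     subspace Z \<and> closedin (weak_star_topology X J) Z \<and>
     (\<forall>f. weak_star_functional_on X J Z f \<longrightarrow>
        (\<exists>!y. (\<forall>z\<in>Z. blinfun_apply (J z) y = f z) \<and> norm y = functional_norm_on Z f))"

end

theory Submission
  imports Defs
begin

text \<open>The operators \<open>rank1 v\<close>, with \<open>v\<close> a unit vector, are points of Frechet differentiability of the norm of
  \<open>C\<close>. Their derivatives \<open>w \<mapsto> w v \<bullet> i v\<close> are therefore norm limits of functionals from any isometric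
  predual, and so every such predual consists of the norm limits of combinations of vector functionals.
  In particular \<open>I\<close> is closed under bounded weak operator limits, and contains the polar part, a
  tripotent, of each of its elements.

  Let \<open>e\<close> be a tripotent in \<open>I\<close>. Two distinct normal states of the Jordan algebra of the selfadjoint part
  of the Peirce-2 space of \<open>e\<close> are extended by distinct functionals of norm one which attain their norm at
  \<open>e\<close>, hence they differ on \<open>I\<close> by smoothness. By the Jordan decomposition of normal functionals, \<open>I\<close>
  contains this selfadjoint part. In matrix terms, \<open>I\<close> contains with \<open>e = i 1\<close> all \<open>u(n)\<close>, in particular
  the tripotents \<open>diag (i, - i)\<close>, whose selfadjoint parts contribute the off-diagonal entries in \<open>j\<close> and
  \<open>k\<close>; a triple product moves these to the diagonal. This needs two orthogonal
  lines, which rank at least two provides. Hence \<open>I\<close> contains every element of \<open>C\<close> supported by \<open>e\<close>. If \<open>e\<close> is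
  the polar part of \<open>x\<close>, then \<open>{x, c, x}\<close> is supported by \<open>e\<close> for all \<open>c\<close> in \<open>C\<close>.\<close>

subsection \<open>Quaternionic Hilbert spaces\<close>

text \<open>Why rank two matters: the real line through a single \<open>rank1 v\<close>, with
  \<open>v\<close> a unit vector, is smooth, since the norm is differentiable there, yet it is no
  inner ideal. On one quaternionic line the selfadjoint part belonging to i is just the real
  multiples of i. The directions j and k can only be reached through a second line. Spectral theory
  is avoided. The polar part is a strong limit of odd polynomials formed with the triple product,
  and the absolute value of a functional is replaced by a variational argument at a point where the
  functional attains its norm. All positivity statements are inequalities between quadratic forms.
  The range of a tripotent may have infinite dimension, so an operator supported by it is reached
  through finite compressions of bounded norm. This is why weak* closedness is first brought into a
  form that tests bounded sets against vector functionals only.\<close>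

lemma qcnj_simps [simp]:
  "qcnj (qcnj q) = q" "qcnj 1 = 1" "qcnj 0 = 0" "qcnj (- q) = - qcnj q"
  "qcnj (p + q) = qcnj p + qcnj q" "qcnj (p - q) = qcnj p - qcnj q"
  "qcnj (p * q) = qcnj q * qcnj p"
  "qcnj (of_real r) = of_real r"
  "qRe (qcnj q) = qRe q" "qRe (p + q) = qRe p + qRe q" "qRe (p - q) = qRe p - qRe q"
  "qRe (- p) = - qRe p" "qRe 1 = 1" "qRe 0 = 0" "qRe (of_real r * q) = r * qRe q"
  by (auto simp: quat_eq_iff quat_ops_defs of_real_def algebra_simps)

lemma qRe_mult_commute: "qRe (p * q) = qRe (q * p)"
  by (simp add: quat_ops_defs)

definition qnorm_sq :: "quat \<Rightarrow> real" where
  "qnorm_sq q = (qRe q)\<^sup>2 + (qIm1 q)\<^sup>2 + (qIm2 q)\<^sup>2 + (qIm3 q)\<^sup>2"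

lemma qnorm_sq_nonneg [simp]: "0 \<le> qnorm_sq q"
  by (simp add: qnorm_sq_def)

lemma qcnj_mult_self: "qcnj q * q = of_real (qnorm_sq q)" "q * qcnj q = of_real (qnorm_sq q)"
  by (auto simp: quat_eq_iff quat_ops_defs of_real_def qnorm_sq_def power2_eq_square)

lemma scaleQ_one [simp]: "1 *\<^sub>Q x = x"
  using scaleR_scaleQ[of 1 x] by (simp del: of_real_eq_0_iff)

lemma scaleQ_zero_right [simp]: "q *\<^sub>Q 0 = 0"
  using scaleQ_add_right[of q 0 0] by simp

lemma scaleQ_zero_left [simp]: "0 *\<^sub>Q x = 0"
  using scaleQ_add_left[of 0 0 x] by simp

lemma scaleQ_minus_right [simp]: "q *\<^sub>Q (- x) = - (q *\<^sub>Q x)"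
  using scaleQ_add_right[of q x "- x"] by (simp add: eq_neg_iff_add_eq_0 add.commute)

lemma scaleQ_minus_left [simp]: "(- q) *\<^sub>Q x = - (q *\<^sub>Q x)"
  using scaleQ_add_left[of q "- q" x] by (simp add: eq_neg_iff_add_eq_0 add.commute)

lemma scaleQ_diff_right: "q *\<^sub>Q (x - y) = q *\<^sub>Q x - q *\<^sub>Q y"
  using scaleQ_add_right[of q x "- y"] by simp

lemma scaleQ_diff_left: "(p - q) *\<^sub>Q x = p *\<^sub>Q x - q *\<^sub>Q x"
  using scaleQ_add_left[of p "- q" x] by simp

lemma scaleQ_scaleR: "q *\<^sub>Q (r *\<^sub>R x) = r *\<^sub>R (q *\<^sub>Q x)"
proof -
  have "q * of_real r = of_real r * q" by (auto simp: quat_eq_iff quat_ops_defs of_real_def)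
  then show ?thesis by (simp add: scaleR_scaleQ scaleQ_scaleQ)
qed

lemma qinner_add_right: "qinner x (y + z) = qinner x y + qinner x z"
  by (metis qinner_commute qinner_add_left qcnj_simps(5))

lemma qinner_scaleQ_right: "qinner x (q *\<^sub>Q y) = qinner x y * qcnj q"
  by (metis qinner_commute qinner_scaleQ_left qcnj_simps(7))

lemma qinner_zero [simp]: "qinner 0 x = 0" "qinner x 0 = 0"
  using qinner_add_left[of 0 0 x] qinner_add_right[of x 0 0] by auto

lemma qinner_minus [simp]: "qinner (- x) y = - qinner x y" "qinner x (- y) = - qinner x y"
  using qinner_add_left[of x "- x" y] qinner_add_right[of x y "- y"] by (simp_all add: eq_neg_iff_add_eq_0 add.commute)

lemma qinner_diff_left: "qinner (x - y) z = qinner x z - qinner y z"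
  using qinner_add_left[of x "- y" z] by simp

lemma qinner_scaleR: "qinner (r *\<^sub>R x) y = of_real r * qinner x y" "qinner x (r *\<^sub>R y) = qinner x y * of_real r"
  by (simp_all add: scaleR_scaleQ qinner_scaleQ_left qinner_scaleQ_right)

lemma qinner_self: "qinner x x = of_real (inner x x)"
  using qinner_commute[of x x]
  by (auto simp: quat_eq_iff quat_ops_defs of_real_def inner_eq_qRe)

lemma inner_scaleQ_left: "inner (q *\<^sub>Q x) y = inner x (qcnj q *\<^sub>Q y)"
  by (simp add: inner_eq_qRe qinner_scaleQ_left qinner_scaleQ_right qRe_mult_commute)

lemma inner_scaleQ_scaleQ: "inner (q *\<^sub>Q x) (q *\<^sub>Q y) = qnorm_sq q * inner x y"
proof -
  have "inner (q *\<^sub>Q x) (q *\<^sub>Q y) = inner x ((qcnj q * q) *\<^sub>Q y)"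
    by (simp only: inner_scaleQ_left scaleQ_scaleQ)
  also have "\<dots> = inner x (qnorm_sq q *\<^sub>R y)"
    by (simp only: qcnj_mult_self scaleR_scaleQ)
  finally show ?thesis by simp
qed

text \<open>A quaternion is determined by the real parts of its products with 1, i, j and k. This
  lifts identities for the real inner product, such as adjointness, to the quaternionic one.\<close>

lemma qinner_eqI:
  assumes "\<And>q. inner (q *\<^sub>Q x) y = inner (q *\<^sub>Q x') y'"
  shows "qinner x y = qinner x' y'"
proof -
  have *: "qRe (q * qinner x y) = qRe (q * qinner x' y')" for q
    using assms[of q] by (simp add: inner_eq_qRe qinner_scaleQ_left)
  show ?thesis
    using *[of 1] *[of "Quat 0 1 0 0"] *[of "Quat 0 0 1 0"] *[of "Quat 0 0 0 1"]
    by (simp add: quat_eq_iff times_quat_def)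
qed

lemma qinner_sum_left: "qinner (\<Sum>i\<in>A. f i) y = (\<Sum>i\<in>A. qinner (f i) y)"
  by (induction A rule: infinite_finite_induct) (auto simp: qinner_add_left)

lemma qinner_sum_right: "qinner y (\<Sum>i\<in>A. f i) = (\<Sum>i\<in>A. qinner y (f i))"
  by (induction A rule: infinite_finite_induct) (auto simp: qinner_add_right)

lemma scaleQ_sum_right: "q *\<^sub>Q (\<Sum>i\<in>A. f i) = (\<Sum>i\<in>A. q *\<^sub>Q f i)"
  by (induction A rule: infinite_finite_induct) (auto simp: scaleQ_add_right)

lemma scaleQ_sum_left: "(\<Sum>i\<in>A. q i) *\<^sub>Q x = (\<Sum>i\<in>A. q i *\<^sub>Q x)"
  by (induction A rule: infinite_finite_induct) (auto simp: scaleQ_add_left)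

lemma norm_scaleQ: "norm (q *\<^sub>Q x) = sqrt (qnorm_sq q) * norm (x :: 'a::quat_inner)"
  by (simp add: norm_eq_sqrt_inner inner_scaleQ_scaleQ real_sqrt_mult)

text \<open>The vector \<open>qinner x y *\<^sub>Q y\<close> is the orthogonal projection of
  \<open>x\<close> to the quaternionic line of \<open>y\<close>.\<close>

lemma norm_qinner_scaleQ_le:
  fixes x y z :: "'a::quat_inner"
  assumes "norm y = 1"
  shows "norm (qinner x y *\<^sub>Q y) \<le> norm x"
proof -
  let ?s = "qinner x y *\<^sub>Q y"
  have "qinner ?s y = qinner x y"
    using assms by (simp add: qinner_scaleQ_left qinner_self dot_square_norm)
  then have "qinner ?s ?s = qinner x ?s" by (simp add: qinner_scaleQ_right)
  then have "inner ?s ?s = inner x ?s" by (simp add: inner_eq_qRe)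
  then have "norm ?s * norm ?s \<le> norm x * norm ?s"
    using norm_cauchy_schwarz[of x ?s] by (simp add: dot_square_norm power2_eq_square)
  then show ?thesis by (cases "norm ?s = 0") (auto simp: mult_le_cancel_right)
qed

lemma inner_eqI:
  fixes x y :: "'a::real_inner"
  assumes "\<And>z. inner z x = inner z y"
  shows "x = y"
proof -
  have "inner (x - y) (x - y) = 0" using assms[of "x - y"] by (simp add: inner_diff_right)
  then show ?thesis by simp
qed

subsection \<open>Riesz representation and adjoints\<close>

text \<open>The representing vector is found as the minimizer of \<open>\<Phi>\<close>, which
  differs from the squared distance to it by a constant.\<close>

lemma riesz_representation:
  fixes f :: "'a::{real_inner,complete_space} \<Rightarrow> real"
  assumes f: "bounded_linear f"
  obtains y where "\<And>x. f x = inner x y"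
proof -
  interpret bounded_linear f by fact
  obtain K where K: "\<And>x. \<bar>f x\<bar> \<le> norm x * K" using bounded by auto
  define \<Phi> where "\<Phi> = (\<lambda>x. inner x x - 2 * f x)"
  have lower: "- K\<^sup>2 \<le> \<Phi> x" for x
  proof -
    have "0 \<le> (norm x - K)\<^sup>2" by simp
    then show ?thesis using K[of x] by (simp add: \<Phi>_def dot_square_norm power2_eq_square algebra_simps)
  qed
  define d where "d = (INF x. \<Phi> x)"
  have d: "d \<le> \<Phi> x" for x unfolding d_def
    by (intro cINF_lower bdd_belowI2[where m = "- K\<^sup>2"]) (auto simp: lower)
  have "\<exists>x. \<Phi> x < d + inverse (Suc n)" for n
  proof -
    have "d < d + inverse (Suc n)" by simp
    then show ?thesis using cINF_less_iff[of UNIV \<Phi> "d + inverse (Suc n)"] lower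
      unfolding d_def by (metis UNIV_I UNIV_not_empty bdd_belowI2)
  qed
  then obtain s where s: "\<And>n. \<Phi> (s n) < d + inverse (Suc n)" by metis
  text \<open>The parallelogram law for \<open>\<Phi>\<close> makes every minimizing sequence Cauchy.\<close>
  have par: "inner (x - y) (x - y) = 2 * \<Phi> x + 2 * \<Phi> y - 4 * \<Phi> ((1/2) *\<^sub>R (x + y))" for x y
    by (simp add: \<Phi>_def add scale inner_commute algebra_simps)
  have near: "(norm (s m - s n))\<^sup>2 \<le> 4 * inverse (Suc N)" if "m \<ge> N" "n \<ge> N" for m n N
  proof -
    have "inverse (Suc m) \<le> inverse (real (Suc N))" "inverse (Suc n) \<le> inverse (real (Suc N))"
      using that by (auto intro!: le_imp_inverse_le)
    then show ?thesis
      using par[of "s m" "s n"] d[of "(1/2) *\<^sub>R (s m + s n)"] s[of m] s[of n]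
      unfolding power2_norm_eq_inner by linarith
  qed
  have "Cauchy s"
    unfolding Cauchy_def
  proof (intro allI impI)
    fix e :: real assume e: "e > 0"
    obtain N where N: "inverse (real (Suc N)) < e\<^sup>2 / 4"
      using reals_Archimedean[of "e\<^sup>2 / 4"] e by auto
    have "dist (s m) (s n) < e" if "m \<ge> N" "n \<ge> N" for m n
    proof -
      have "(norm (s m - s n))\<^sup>2 < e\<^sup>2" using near[OF that] N by simp
      then show ?thesis using e by (simp add: dist_norm power2_less_imp_less)
    qed
    then show "\<exists>M. \<forall>m\<ge>M. \<forall>n\<ge>M. dist (s m) (s n) < e" by blast
  qed
  then obtain y where y: "s \<longlonglongrightarrow> y" by (metis Cauchy_convergent convergent_def)
  have "(\<lambda>n. \<Phi> (s n)) \<longlonglongrightarrow> \<Phi> y" unfolding \<Phi>_def by (intro tendsto_intros tendsto y)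
  moreover have "(\<lambda>n. d + inverse (Suc n)) \<longlonglongrightarrow> d + 0"
    by (intro tendsto_intros LIMSEQ_inverse_real_of_nat)
  ultimately have min: "\<Phi> y \<le> d" using s by (intro LIMSEQ_le) (auto intro: less_imp_le)
  have "f x = inner x y" for x
  proof -
    define c where "c = 2 * (inner x y - f x)"
    have q: "0 \<le> t * c + t\<^sup>2 * inner x x" for t
    proof -
      have "\<Phi> (y + t *\<^sub>R x) = \<Phi> y + t * c + t\<^sup>2 * inner x x"
        by (simp add: \<Phi>_def c_def add scale inner_commute power2_eq_square algebra_simps)
      then show ?thesis using d[of "y + t *\<^sub>R x"] min by linarith
    qed
    have "c = 0"
    proof (cases "inner x x = 0")
      case True
      then show ?thesis using q[of 1] q[of "-1"] by simp
    next
      case False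
      then have p: "inner x x > 0" by (simp add: less_le)
      have "0 \<le> - (c\<^sup>2 / inner x x) + c\<^sup>2 / (4 * inner x x) * 2"
        using q[of "- c / (2 * inner x x)"] p by (simp add: power2_eq_square field_simps)
      then have "c\<^sup>2 \<le> 0" using p by (simp add: field_simps)
      then show ?thesis by simp
    qed
    then show ?thesis by (simp add: c_def)
  qed
  then show ?thesis by (rule that)
qed

lemma adjoint_exists:
  fixes w :: "'a::{real_inner,complete_space} \<Rightarrow>\<^sub>L 'a"
  obtains v :: "'a \<Rightarrow>\<^sub>L 'a" where "\<And>x y. inner (w x) y = inner x (v y)"
proof -
  have "\<exists>z. \<forall>x. inner (w x) y = inner x z" for y
  proof -
    have "bounded_linear (\<lambda>x. inner (w x) y)"
      by (rule bounded_linear_compose[OF bounded_linear_inner_left blinfun.bounded_linear_right])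
    then show ?thesis by (metis riesz_representation)
  qed
  then obtain g where g: "\<And>x y. inner (w x) y = inner x (g y)" by metis
  have "bounded_linear g"
  proof (rule bounded_linear_intro[where K = "norm w"])
    fix x y :: 'a and r :: real
    have "inner z (g (x + y)) = inner z (g x + g y)" for z by (simp add: inner_add_right flip: g)
    then show "g (x + y) = g x + g y" by (rule inner_eqI)
    have "inner z (g (r *\<^sub>R x)) = inner z (r *\<^sub>R g x)" for z by (simp flip: g)
    then show "g (r *\<^sub>R x) = r *\<^sub>R g x" by (rule inner_eqI)
    have "norm (g x) * norm (g x) = inner (w (g x)) x"
      by (simp add: g dot_square_norm power2_eq_square)
    also have "\<dots> \<le> norm (w (g x)) * norm x" by (rule norm_cauchy_schwarz)
    also have "\<dots> \<le> norm w * norm (g x) * norm x" by (intro mult_right_mono norm_blinfun) auto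
    finally have *: "norm (g x) * norm (g x) \<le> norm x * norm w * norm (g x)" by (simp add: mult_ac)
    show "norm (g x) \<le> norm x * norm w"
      using * by (cases "norm (g x) = 0") (auto simp: mult_le_cancel_right)
  qed
  then show ?thesis using g by (intro that[of "Blinfun g"]) (simp add: bounded_linear_Blinfun_apply)
qed

lemma quat_operators_scaleQ: "w \<in> quat_operators \<Longrightarrow> w (q *\<^sub>Q x) = q *\<^sub>Q w x"
  by (simp add: quat_operators_def)

lemma quat_adj_unique:
  assumes "\<And>x y. qinner (blinfun_apply w x) y = qinner x (blinfun_apply v y)"
    and "\<And>x y. qinner (blinfun_apply w x) y = qinner x (blinfun_apply v' y)"
  shows "v = v'"
proof (rule blinfun_eqI)
  fix y
  have "inner x (v y) = inner x (v' y)" for x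
    using assms[of x y] by (simp add: inner_eq_qRe)
  then show "v y = v' y" by (rule inner_eqI)
qed

text \<open>The real adjoint is already quaternion-linear and adjoint for \<open>qinner\<close>, so
  the definite description in \<open>quat_adj\<close> denotes it.\<close>

lemma quat_adj:
  assumes w: "w \<in> quat_operators"
  shows "quat_adj w \<in> quat_operators"
    and "qinner (blinfun_apply w x) y = qinner x (blinfun_apply (quat_adj w) y)"
proof -
  obtain v where v: "\<And>x y. inner (w x) y = inner x (blinfun_apply v y)"
    using adjoint_exists by blast
  have q: "qinner (w x) y = qinner x (v y)" for x y
    by (rule qinner_eqI) (simp add: v flip: quat_operators_scaleQ[OF w])
  have "v (q *\<^sub>Q y) = q *\<^sub>Q v y" for q y
  proof -
    have "inner x (v (q *\<^sub>Q y)) = inner x (q *\<^sub>Q v y)" for x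
      by (metis inner_eq_qRe q qinner_scaleQ_right)
    then show ?thesis by (rule inner_eqI)
  qed
  then have "v \<in> quat_operators" by (simp add: quat_operators_def)
  then have "\<exists>!v. v \<in> quat_operators \<and> (\<forall>x y. qinner (blinfun_apply w x) y = qinner x (blinfun_apply v y))"
    using q quat_adj_unique by (intro ex1I[of _ v]) blast+
  from theI'[OF this, folded quat_adj_def]
  show "quat_adj w \<in> quat_operators" "qinner (w x) y = qinner x (quat_adj w y)" by auto
qed

text \<open>Membership becomes skewness for the real inner product, which removes
  \<open>quat_adj\<close> from all later computations.\<close>

lemma cartan_factor_iff:
  "w \<in> cartan_factor_III_H \<longleftrightarrow>
     w \<in> quat_operators \<and> (\<forall>x y. inner (blinfun_apply w x) y = - inner x (blinfun_apply w y))"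
proof (intro iffI conjI allI)
  assume w: "w \<in> cartan_factor_III_H"
  then show "w \<in> quat_operators" by (simp add: cartan_factor_III_H_def)
  fix x y show "inner (w x) y = - inner x (w y)"
    using quat_adj(2)[of w x y] w
    by (simp add: cartan_factor_III_H_def inner_eq_qRe uminus_blinfun.rep_eq)
next
  assume w: "w \<in> quat_operators \<and> (\<forall>x y. inner (blinfun_apply w x) y = - inner x (blinfun_apply w y))"
  have "qinner (w x) y = qinner x ((- w) y)" for x y
    by (rule qinner_eqI) (use w in \<open>simp add: uminus_blinfun.rep_eq flip: quat_operators_scaleQ\<close>)
  then have "quat_adj w = - w" using quat_adj(2)[of w] w by (intro quat_adj_unique) auto
  then show "w \<in> cartan_factor_III_H" using w by (simp add: cartan_factor_III_H_def)
qed

lemma cartan_scaleQ: "w \<in> cartan_factor_III_H \<Longrightarrow> w (q *\<^sub>Q x) = q *\<^sub>Q w x"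
  by (simp add: cartan_factor_iff quat_operators_scaleQ)

lemma cartan_skew: "w \<in> cartan_factor_III_H \<Longrightarrow> inner (w x) y = - inner x (w y)"
  by (simp add: cartan_factor_iff)

lemma cartan_qskew: "w \<in> cartan_factor_III_H \<Longrightarrow> qinner (w x) y = - qinner x (w y)"
  using qinner_eqI[of "w x" y "x" "- w y"] by (simp add: cartan_skew flip: cartan_scaleQ)

lemma cartanI:
  assumes "\<And>q x. blinfun_apply w (q *\<^sub>Q x) = q *\<^sub>Q blinfun_apply w x"
    and "\<And>x y. inner (blinfun_apply w x) y = - inner x (blinfun_apply w y)"
  shows "w \<in> cartan_factor_III_H"
  using assms by (simp add: cartan_factor_iff quat_operators_def)

lemma subspace_cartan: "subspace (cartan_factor_III_H :: ('a::quat_hilbert \<Rightarrow>\<^sub>L 'a) set)"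
  unfolding subspace_def
  by (auto simp: cartan_factor_iff quat_operators_def blinfun.add_left blinfun.scaleR_left
    scaleQ_add_right scaleQ_scaleR inner_add_left inner_add_right)

lemma triple_product_cartan:
  assumes "b \<in> cartan_factor_III_H"
  shows "triple_product a b c x = - (1/2) *\<^sub>R (a (b (c x)) + c (b (a x)))"
proof -
  have "quat_adj b = - b" using assms by (simp add: cartan_factor_III_H_def)
  then show ?thesis
    by (simp add: triple_product_def plus_blinfun.rep_eq scaleR_blinfun.rep_eq
        uminus_blinfun.rep_eq blinfun.minus_right algebra_simps)
qed

lemma triple_product_square:
  "b \<in> cartan_factor_III_H \<Longrightarrow> triple_product a b a x = - a (b (a x))"
  by (simp add: triple_product_cartan flip: scaleR_2)

lemma triple_product_in_cartan:
  assumes "a \<in> cartan_factor_III_H" "b \<in> cartan_factor_III_H" "c \<in> cartan_factor_III_H"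
  shows "triple_product a b c \<in> cartan_factor_III_H"
  by (rule cartanI)
    (simp_all add: triple_product_cartan assms cartan_scaleQ cartan_skew scaleQ_scaleR scaleQ_add_right
      scaleQ_diff_right inner_add_left inner_add_right algebra_simps)

lemma norm_triple_product_le:
  assumes b: "b \<in> cartan_factor_III_H"
  shows "norm (triple_product a b c) \<le> norm a * norm b * norm c"
proof (rule norm_blinfun_bound)
  fix x
  have "norm (a (b (c x))) \<le> norm a * (norm b * (norm c * norm x))" for a c :: "'a \<Rightarrow>\<^sub>L 'a"
    by (meson norm_blinfun order.trans mult_left_mono norm_ge_zero)
  from this[of a c] this[of c a] norm_triangle_ineq[of "a (b (c x))" "c (b (a x))"]
  show "norm (triple_product a b c x) \<le> norm a * norm b * norm c * norm x"
    by (simp add: triple_product_cartan[OF b] mult_ac)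
qed simp

subsection \<open>Preduals\<close>

definition sublinear :: "('a::real_vector \<Rightarrow> real) \<Rightarrow> bool" where
  "sublinear q \<longleftrightarrow> (\<forall>x y. q (x + y) \<le> q x + q y) \<and> (\<forall>t\<ge>0. \<forall>x. q (t *\<^sub>R x) = t * q x)"

lemma sublinearI:
  assumes "\<And>x y. q (x + y) \<le> q x + q y" and "q 0 = 0"
    and "\<And>t x. t > 0 \<Longrightarrow> q (t *\<^sub>R x) \<le> t * q x"
  shows "sublinear q"
  unfolding sublinear_def
proof (intro conjI allI impI)
  fix t :: real and x :: 'a assume "t \<ge> 0"
  show "q (t *\<^sub>R x) = t * q x"
  proof (cases "t = 0")
    case False
    with \<open>t \<ge> 0\<close> have t: "t > 0" by simp
    have "q x \<le> (1/t) * q (t *\<^sub>R x)"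
      using assms(3)[of "1/t" "t *\<^sub>R x"] t by simp
    then have "t * q x \<le> q (t *\<^sub>R x)" using t by (simp add: field_simps)
    with assms(3)[OF t, of x] show ?thesis by simp
  qed (simp add: assms(2))
qed (rule assms(1))

lemma sublinear_add: "sublinear q \<Longrightarrow> q (x + y) \<le> q x + q y"
  by (simp add: sublinear_def)

lemma sublinear_scale: "sublinear q \<Longrightarrow> t \<ge> 0 \<Longrightarrow> q (t *\<^sub>R x) = t * q x"
  by (simp add: sublinear_def)

lemma sublinear_zero: "sublinear q \<Longrightarrow> q 0 = 0"
  using sublinear_scale[of q 0 0] by simp

lemma sublinear_minus: "sublinear q \<Longrightarrow> - q (- x) \<le> q x"
  using sublinear_add[of q x "- x"] sublinear_zero[of q] by simp

text \<open>Lowers \<open>q\<close> along the ray of \<open>y\<close> by taking the infimum of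
  \<open>q (x + t y) - t q y\<close> over \<open>t \<ge> 0\<close>. A minimal \<open>q\<close>
  coincides with the result, and then the last bound makes it additive. The bound at
  \<open>- y\<close> is what forces the linear functional to agree with \<open>p\<close> at
  \<open>y\<close>.\<close>

lemma sublinear_reduce:
  assumes q: "sublinear q"
  shows "\<exists>r. sublinear r \<and> (\<forall>x. r x \<le> q x) \<and> r (- y) \<le> - q y \<and> (\<forall>x. r x \<le> q (x + y) - q y)"
proof -
  define g where "g = (\<lambda>x t. q (x + t *\<^sub>R y) - t * q y)"
  define r where "r = (\<lambda>x. INF t\<in>{0..}. g x t)"
  have lb: "- q (- x) \<le> g x t" if "t \<ge> 0" for x t
    using sublinear_add[OF q, of "x + t *\<^sub>R y" "- x"] sublinear_scale[OF q that, of y]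
    by (simp add: g_def)
  have bdd: "bdd_below (g x ` {0..})" for x
    using lb by (intro bdd_belowI2[where m = "- q (- x)"]) auto
  have le: "r x \<le> g x t" if "t \<ge> 0" for x t
    unfolding r_def using that by (intro cINF_lower bdd) auto
  have ge: "c \<le> r x" if "\<And>t. t \<ge> 0 \<Longrightarrow> c \<le> g x t" for c x
    unfolding r_def using that by (intro cINF_greatest) auto
  have "sublinear r"
  proof (rule sublinearI)
    fix x x'
    have "r (x + x') - g x' t' \<le> r x" if t': "t' \<ge> 0" for t'
    proof (rule ge)
      fix t :: real assume t: "t \<ge> 0"
      have "r (x + x') \<le> g (x + x') (t + t')" using t t' by (intro le) auto
      also have "\<dots> \<le> g x t + g x' t'"
        using sublinear_add[OF q, of "x + t *\<^sub>R y" "x' + t' *\<^sub>R y"]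
        by (simp add: g_def algebra_simps)
      finally show "r (x + x') - g x' t' \<le> g x t" by simp
    qed
    then have "r (x + x') - r x \<le> r x'" by (intro ge) (simp add: algebra_simps)
    then show "r (x + x') \<le> r x + r x'" by simp
  next
    have "g 0 t = 0" if "t \<ge> 0" for t using sublinear_scale[OF q that] by (simp add: g_def)
    then have "0 \<le> r 0" by (intro ge) simp
    moreover have "r 0 \<le> 0" using le[of 0 0] sublinear_zero[OF q] by (simp add: g_def)
    ultimately show "r 0 = 0" by simp
  next
    fix s :: real and x assume s: "s > 0"
    have "r (s *\<^sub>R x) / s \<le> r x"
    proof (rule ge)
      fix t :: real assume t: "t \<ge> 0"
      have "r (s *\<^sub>R x) \<le> g (s *\<^sub>R x) (s * t)" using s t by (intro le) auto
      also have "\<dots> = s * g x t"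
        using sublinear_scale[OF q, of s "x + t *\<^sub>R y"] s by (simp add: g_def algebra_simps)
      finally show "r (s *\<^sub>R x) / s \<le> g x t" using s by (simp add: field_simps)
    qed
    then show "r (s *\<^sub>R x) \<le> s * r x" using s by (simp add: field_simps)
  qed
  moreover have "r x \<le> q x" for x using le[of 0 x] by (simp add: g_def)
  moreover have "r (- y) \<le> - q y" using le[of 1 "- y"] sublinear_zero[OF q] by (simp add: g_def)
  moreover have "r x \<le> q (x + y) - q y" for x using le[of 1 x] by (simp add: g_def)
  ultimately show ?thesis by blast
qed

text \<open>Hahn--Banach: a sublinear functional that is minimal below \<open>p\<close> is linear.\<close>

lemma sublinear_dominates_linear:
  fixes p :: "'a::real_vector \<Rightarrow> real"
  assumes p: "sublinear p"
  obtains f where "linear f" and "\<And>x. f x \<le> p x" and "f y = p y"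
proof -
  obtain p' where p': "sublinear p'" "\<And>x. p' x \<le> p x" "p' (- y) \<le> - p y"
    using sublinear_reduce[OF p, of y] by blast
  define A where "A = {q. sublinear q \<and> (\<forall>x. q x \<le> p' x)}"
  define P where "P = (\<lambda>a b :: 'a \<Rightarrow> real. \<forall>x. b x \<le> a x)"
  have "\<exists>m\<in>A. \<forall>a\<in>A. P m a \<longrightarrow> a = m"
  proof (rule predicate_Zorn)
    show "partial_order_on A (relation_of P A)"
      by (intro partial_order_on_relation_ofI) (auto simp: P_def fun_eq_iff intro: order.trans antisym)
  next
    fix Ch assume Ch: "Ch \<in> Chains (relation_of P A)"
    then have ChA: "Ch \<subseteq> A" and tot: "\<And>a b. a \<in> Ch \<Longrightarrow> b \<in> Ch \<Longrightarrow> P a b \<or> P b a"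
      by (auto simp: Chains_def relation_of_def)
    show "\<exists>u\<in>A. \<forall>a\<in>Ch. P a u"
    proof (cases "Ch = {}")
      case True
      then show ?thesis using p' by (auto simp: A_def)
    next
      case False
      define u where "u = (\<lambda>x. INF q\<in>Ch. q x)"
      have lb: "- p' (- x) \<le> q x" if "q \<in> Ch" for q x
        proof -
        have "sublinear q" "q (- x) \<le> p' (- x)" using that ChA by (auto simp: A_def)
        then show ?thesis using sublinear_minus[of q x] by linarith
      qed
      have le: "u x \<le> q x" if "q \<in> Ch" for q x
        unfolding u_def using that lb by (intro cINF_lower bdd_belowI2[where m = "- p' (- x)"]) auto
      have ge: "c \<le> u x" if "\<And>q. q \<in> Ch \<Longrightarrow> c \<le> q x" for c x
        unfolding u_def using that False by (intro cINF_greatest) auto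
      have sub: "sublinear q" if "q \<in> Ch" for q using that ChA by (auto simp: A_def)
      have "sublinear u"
      proof (rule sublinearI)
        fix x x'
        have "u (x + x') \<le> q1 x + q2 x'" if q12: "q1 \<in> Ch" "q2 \<in> Ch" for q1 q2
        proof -
          consider "P q1 q2" | "P q2 q1" using tot q12 by blast
          then show ?thesis
          proof cases
            case 1
            have "u (x + x') \<le> q2 x + q2 x'"
              using le[OF q12(2)] sublinear_add[OF sub[OF q12(2)]] order.trans by blast
            also have "\<dots> \<le> q1 x + q2 x'" using 1 by (simp add: P_def)
            finally show ?thesis .
          next
            case 2
            have "u (x + x') \<le> q1 x + q1 x'"
              using le[OF q12(1)] sublinear_add[OF sub[OF q12(1)]] order.trans by blast
            also have "\<dots> \<le> q1 x + q2 x'" using 2 by (simp add: P_def)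
            finally show ?thesis .
          qed
        qed
        then have "u (x + x') - q2 x' \<le> u x" if "q2 \<in> Ch" for q2
          using that by (intro ge) (simp add: algebra_simps)
        then have "u (x + x') - u x \<le> u x'" by (intro ge) (simp add: algebra_simps)
        then show "u (x + x') \<le> u x + u x'" by simp
      next
        obtain q where "q \<in> Ch" using False by blast
        then show "u 0 = 0" using le[of q 0] ge[of 0 0] sublinear_zero[OF sub] by force
      next
        fix t :: real and x assume t: "t > 0"
        have "u (t *\<^sub>R x) / t \<le> u x"
        proof (rule ge)
          fix q assume q: "q \<in> Ch"
          show "u (t *\<^sub>R x) / t \<le> q x"
            using le[OF q, of "t *\<^sub>R x"] sublinear_scale[OF sub[OF q], of t x] t
            by (simp add: field_simps)
        qed
        then show "u (t *\<^sub>R x) \<le> t * u x" using t by (simp add: field_simps)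
      qed
      moreover have "u x \<le> p' x" for x
        using False le ChA by (force simp: A_def intro: order.trans)
      ultimately show ?thesis using le by (intro bexI[of _ u]) (auto simp: A_def P_def)
    qed
  qed
  then obtain f where f: "f \<in> A" and min: "\<And>a. a \<in> A \<Longrightarrow> P f a \<Longrightarrow> a = f" by blast
  have sf: "sublinear f" using f by (simp add: A_def)
  have add: "f (x + z) = f x + f z" for x z
  proof (rule antisym)
    obtain r where r: "sublinear r" "\<And>x. r x \<le> f x" "\<And>x. r x \<le> f (x + z) - f z"
      using sublinear_reduce[OF sf, of z] by blast
    have "r \<in> A" using r f by (force simp: A_def intro: order.trans)
    then have "r = f" using min r(2) by (simp add: P_def)
    then show "f x + f z \<le> f (x + z)" using r(3)[of x] by simp
  qed (rule sublinear_add[OF sf])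
  have minus: "f (- x) = - f x" for x
    using add[of x "- x"] sublinear_zero[OF sf] by simp
  have "linear f"
  proof (rule linearI)
    fix t :: real and x
    show "f (t *\<^sub>R x) = t *\<^sub>R f x"
    proof (cases "t \<ge> 0")
      case False
      then show ?thesis using sublinear_scale[OF sf, of "- t" x] minus[of "t *\<^sub>R x"] by simp
    qed (simp add: sublinear_scale[OF sf])
  qed (rule add)
  moreover have fp: "f x \<le> p x" for x using f p'(2) by (force simp: A_def intro: order.trans)
  moreover have "f y = p y"
  proof (rule antisym)
    have "f (- y) \<le> - p y" using f p'(3) by (force simp: A_def intro: order.trans)
    then show "p y \<le> f y" using minus by simp
  qed (rule fp)
  ultimately show ?thesis by (rule that)
qed

lemma subspace_closure:
  fixes S :: "'a::real_normed_vector set"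
  assumes S: "subspace S"
  shows "subspace (closure S)"
  unfolding subspace_def
proof (intro conjI ballI allI)
  show "0 \<in> closure S" using subspace_0[OF S] closure_subset by blast
  fix x c assume "x \<in> closure S"
  then obtain f where f: "\<And>n. f n \<in> S" "f \<longlonglongrightarrow> x" by (auto simp: closure_sequential)
  show "c *\<^sub>R x \<in> closure S"
    unfolding closure_sequential using f
    by (intro exI[of _ "\<lambda>n. c *\<^sub>R f n"]) (auto intro!: tendsto_intros subspace_scale[OF S])
  fix y assume "y \<in> closure S"
  then obtain g where g: "\<And>n. g n \<in> S" "g \<longlonglongrightarrow> y" by (auto simp: closure_sequential)
  show "x + y \<in> closure S"
    unfolding closure_sequential using f g
    by (intro exI[of _ "\<lambda>n. f n + g n"]) (auto intro!: tendsto_intros subspace_add[OF S])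
qed

text \<open>A linear functional below this seminorm vanishes on \<open>D\<close> and is bounded by
  the norm.\<close>

lemma sublinear_infdist:
  fixes D :: "'a::real_normed_vector set"
  assumes D: "subspace D"
  shows "sublinear (\<lambda>x. infdist x D)"
proof -
  have ne: "D \<noteq> {}" using subspace_0[OF D] by blast
  have le: "infdist x D \<le> dist x d" if "d \<in> D" for x d using that by (rule infdist_le)
  have ge: "c \<le> infdist x D" if "\<And>d. d \<in> D \<Longrightarrow> c \<le> dist x d" for c x
    unfolding infdist_notempty[OF ne] using that ne by (intro cINF_greatest) auto
  show ?thesis
  proof (rule sublinearI)
    fix x x' :: 'a
    have "infdist (x + x') D - dist x' d' \<le> infdist x D" if d': "d' \<in> D" for d'
    proof (rule ge)
      fix d assume d: "d \<in> D"
      have "infdist (x + x') D \<le> dist (x + x') (d + d')"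
        by (intro le subspace_add D d d')
      also have "\<dots> \<le> dist x d + dist x' d'" by (rule dist_triangle_add)
      finally show "infdist (x + x') D - dist x' d' \<le> dist x d" by simp
    qed
    then have "infdist (x + x') D - infdist x D \<le> infdist x' D" by (intro ge) (simp add: algebra_simps)
    then show "infdist (x + x') D \<le> infdist x D + infdist x' D" by simp
  next
    show "infdist 0 D = 0" by (simp add: subspace_0[OF D])
  next
    fix t :: real and x :: 'a assume t: "t > 0"
    have "infdist (t *\<^sub>R x) D / t \<le> infdist x D"
    proof (rule ge)
      fix d assume d: "d \<in> D"
      have "infdist (t *\<^sub>R x) D \<le> dist (t *\<^sub>R x) (t *\<^sub>R d)"
        by (intro le subspace_scale D d)
      also have "\<dots> = t * dist x d"
        using t by (simp add: dist_norm flip: scaleR_diff_right)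
      finally show "infdist (t *\<^sub>R x) D / t \<le> dist x d" using t by (simp add: field_simps)
    qed
    then show "infdist (t *\<^sub>R x) D \<le> t * infdist x D" using t by (simp add: field_simps)
  qed
qed

lemma dominated_linear_blinfun:
  fixes f :: "'a::real_normed_vector \<Rightarrow> real"
  assumes "linear f" and "\<And>x. f x \<le> norm x"
  obtains F where "blinfun_apply F = f" and "norm F \<le> 1"
proof -
  have b: "\<bar>f x\<bar> \<le> norm x" for x
    using assms(2)[of x] assms(2)[of "- x"] linear_neg[OF assms(1), of x] by simp
  then have "bounded_linear f"
    using assms(1) by (intro bounded_linear_intro[where K = 1]) (auto simp: linear_iff)
  then have F: "blinfun_apply (Blinfun f) = f" by (rule bounded_linear_Blinfun_apply)
  moreover have "norm (Blinfun f) \<le> 1" using b by (intro norm_blinfun_bound) (auto simp: F)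
  ultimately show ?thesis by (rule that)
qed

section \<open>Norming elements, total sets and separation for an isometric predual\<close>

locale predual =
  fixes X :: "'a::real_normed_vector set" and J :: "'a \<Rightarrow> ('y::banach \<Rightarrow>\<^sub>L real)"
  assumes X: "subspace X" and J: "isometric_predual X J"
begin

lemma J_add: "x \<in> X \<Longrightarrow> y \<in> X \<Longrightarrow> J (x + y) = J x + J y"
  and J_scale: "x \<in> X \<Longrightarrow> J (r *\<^sub>R x) = r *\<^sub>R J x"
  and norm_J: "x \<in> X \<Longrightarrow> norm (J x) = norm x"
  using J by (auto simp: isometric_predual_def)

lemma J_surj: obtains x where "x \<in> X" and "J x = F"
proof -
  have "F \<in> J ` X" using J by (auto simp: isometric_predual_def)
  then show ?thesis using that by blast
qed

lemma J_diff: "x \<in> X \<Longrightarrow> y \<in> X \<Longrightarrow> J (x - y) = J x - J y"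
  using J_add[of x "- y"] J_scale[of y "-1"] subspace_scale[OF X, of y "-1"] by simp

lemma J_bound: "x \<in> X \<Longrightarrow> \<bar>J x y\<bar> \<le> norm x * norm y"
  using norm_blinfun[of "J x" y] norm_J[of x] by simp

text \<open>Surjectivity of \<open>J\<close> onto the dual space turns the norming functional of
  Hahn-Banach into an element of the unit ball of \<open>X\<close>.\<close>

lemma norm_attained:
  obtains x where "x \<in> X" and "norm x \<le> 1" and "J x y = norm y"
proof -
  have "sublinear (norm :: 'y \<Rightarrow> real)"
    by (rule sublinearI) (auto intro: norm_triangle_ineq)
  then obtain f where f: "linear f" "\<And>x. f x \<le> norm x" "f y = norm y"
    using sublinear_dominates_linear[of norm y] by blast
  obtain F where F: "blinfun_apply F = f" "norm F \<le> 1"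
    using dominated_linear_blinfun[OF f(1,2)] .
  obtain x where x: "x \<in> X" "J x = F" by (rule J_surj)
  show ?thesis using norm_J[of x] x F f(3) by (intro that[OF x(1)]) auto
qed

lemma norm_predual_le:
  assumes "\<And>x. x \<in> X \<Longrightarrow> norm x \<le> 1 \<Longrightarrow> J x y \<le> K"
  shows "norm y \<le> K"
  by (metis assms norm_attained)

definition total :: "'y set \<Rightarrow> bool" where
  "total D \<longleftrightarrow> (\<forall>x\<in>X. (\<forall>d\<in>D. J x d = 0) \<longrightarrow> x = 0)"

lemma total_dense:
  assumes D: "total D"
  shows "closure (span D) = UNIV"
proof (rule ccontr)
  let ?E = "closure (span D)"
  assume "?E \<noteq> UNIV"
  then obtain y where y: "y \<notin> ?E" by blast
  have E: "subspace ?E" by (intro subspace_closure subspace_span)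
  obtain f where f: "linear f" "\<And>x. f x \<le> infdist x ?E" "f y = infdist y ?E"
    using sublinear_dominates_linear[OF sublinear_infdist[OF E], of y] by blast
  have "f x \<le> norm x" for x
    using f(2)[of x] infdist_le[OF subspace_0[OF E], of x] by simp
  then obtain F where F: "blinfun_apply F = f"
    using dominated_linear_blinfun[OF f(1)] by metis
  obtain x where x: "x \<in> X" "J x = F" by (rule J_surj)
  have "f d = 0" if "d \<in> D" for d
  proof -
    have d: "d \<in> ?E" using that span_base closure_subset by blast
    have "f d \<le> 0" "f (- d) \<le> 0"
      using f(2)[of d] f(2)[of "- d"] d subspace_neg[OF E d] by auto
    then show ?thesis using linear_neg[OF f(1), of d] by simp
  qed
  then have "x = 0" using D x F by (simp add: total_def)
  then have "f y = 0" using norm_J[OF x(1)] x(2) F by (metis norm_zero norm_eq_zero zero_blinfun.rep_eq)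
  moreover have "infdist y ?E \<noteq> 0"
    using y in_closed_iff_infdist_zero[of ?E y] span_zero[of D] by auto
  ultimately show False using f(3) by simp
qed

lemma total_approx:
  assumes "total D" and "\<epsilon> > 0"
  obtains d where "d \<in> span D" and "norm (y - d) < \<epsilon>"
proof -
  have "y \<in> closure (span D)" using total_dense[OF assms(1)] by simp
  then show ?thesis using assms(2) that unfolding closure_approachable
    by (metis dist_norm norm_minus_commute)
qed

text \<open>A total set spans a norm-dense subspace of the predual, so it suffices to treat its members.\<close>

lemma weak_star_compose:
  assumes D: "total D"
    and L: "\<And>x. x \<in> X \<Longrightarrow> L x \<in> X" "\<And>x y. x \<in> X \<Longrightarrow> y \<in> X \<Longrightarrow> L (x + y) = L x + L y"
      "\<And>x. x \<in> X \<Longrightarrow> norm (L x) \<le> K * norm x"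
    and LD: "\<And>d. d \<in> D \<Longrightarrow> \<exists>d'. \<forall>x\<in>X. J x d' = J (L x) d"
  shows "\<exists>y'. \<forall>x\<in>X. J x y' = J (L x) y"
proof -
  have K: "norm (L x) \<le> \<bar>K\<bar> * norm x" if "x \<in> X" for x
    using L(3)[OF that] mult_right_mono[OF abs_ge_self norm_ge_zero, of K x] by linarith
  define G where "G = {y. \<exists>y'. \<forall>x\<in>X. J x y' = J (L x) y}"
  have "subspace G"
    unfolding subspace_def
  proof (intro conjI ballI allI)
    show "0 \<in> G" by (auto simp: G_def intro: exI[of _ 0])
    fix a b r assume "a \<in> G"
    then obtain a' where a': "\<forall>x\<in>X. J x a' = J (L x) a" by (auto simp: G_def)
    then show "r *\<^sub>R a \<in> G"
      by (auto simp: G_def blinfun.scaleR_right intro!: exI[of _ "r *\<^sub>R a'"])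
    assume "b \<in> G"
    then obtain b' where "\<forall>x\<in>X. J x b' = J (L x) b" by (auto simp: G_def)
    with a' show "a + b \<in> G"
      by (auto simp: G_def blinfun.add_right intro!: exI[of _ "a' + b'"])
  qed
  then have span: "span D \<subseteq> G" using LD by (intro span_minimal) (auto simp: G_def)
  have "y \<in> closure (span D)" using total_dense[OF D] by simp
  then obtain s where s: "\<And>n. s n \<in> span D" "s \<longlonglongrightarrow> y" by (auto simp: closure_sequential)
  have "\<forall>n. \<exists>y'. \<forall>x\<in>X. J x y' = J (L x) (s n)" using s(1) span by (auto simp: G_def)
  then obtain t where t: "\<And>n x. x \<in> X \<Longrightarrow> J x (t n) = J (L x) (s n)" by metis
  \<comment> \<open>The norm of the predual is computed on the unit ball of \<open>X\<close>, where
    \<open>t\<close> and \<open>s\<close> are related by \<open>L\<close>; so \<open>t\<close>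
    inherits the Cauchy property of \<open>s\<close>.\<close>
  have dt: "norm (t m - t n) \<le> \<bar>K\<bar> * norm (s m - s n)" for m n
  proof (rule norm_predual_le)
    fix x assume x: "x \<in> X" "norm x \<le> 1"
    have "J x (t m - t n) = J (L x) (s m - s n)" by (simp add: blinfun.diff_right t x)
    also have "\<dots> \<le> norm (L x) * norm (s m - s n)"
      using J_bound[OF L(1)[OF x(1)], of "s m - s n"] by simp
    also have "\<dots> \<le> \<bar>K\<bar> * norm (s m - s n)"
      using K[OF x(1)] x(2) mult_left_mono[of "norm x" 1 "\<bar>K\<bar>"]
      by (intro mult_right_mono) auto
    finally show "J x (t m - t n) \<le> \<bar>K\<bar> * norm (s m - s n)" .
  qed
  have "Cauchy t"
    unfolding Cauchy_def
  proof (intro allI impI)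
    fix e :: real assume e: "e > 0"
    have "Cauchy s" using s(2) by (rule LIMSEQ_imp_Cauchy)
    then obtain M where M: "\<And>m n. m \<ge> M \<Longrightarrow> n \<ge> M \<Longrightarrow> dist (s m) (s n) < e / (\<bar>K\<bar> + 1)"
      unfolding Cauchy_def using e by (metis add_nonneg_pos abs_ge_zero divide_pos_pos zero_less_one)
    have "dist (t m) (t n) < e" if "m \<ge> M" "n \<ge> M" for m n
    proof -
      have "dist (t m) (t n) \<le> (\<bar>K\<bar> + 1) * dist (s m) (s n)"
        using dt[of m n] mult_right_mono[of "\<bar>K\<bar>" "\<bar>K\<bar> + 1" "norm (s m - s n)"]
        by (simp add: dist_norm)
      also have "\<dots> < (\<bar>K\<bar> + 1) * (e / (\<bar>K\<bar> + 1))"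
        using M[OF that] by (intro mult_strict_left_mono) auto
      also have "\<dots> = e" by (simp add: add_nonneg_eq_0_iff)
      finally show ?thesis .
    qed
    then show "\<exists>M. \<forall>m\<ge>M. \<forall>n\<ge>M. dist (t m) (t n) < e" by blast
  qed
  then obtain y' where y': "t \<longlonglongrightarrow> y'" by (metis Cauchy_convergent convergent_def)
  have "J x y' = J (L x) y" if x: "x \<in> X" for x
  proof (rule LIMSEQ_unique)
    show "(\<lambda>n. J x (t n)) \<longlonglongrightarrow> J x y'" using y' by (rule blinfun.tendsto[OF tendsto_const])
    show "(\<lambda>n. J x (t n)) \<longlonglongrightarrow> J (L x) y"
      unfolding t[OF x] using s(2) by (rule blinfun.tendsto[OF tendsto_const])
  qed
  then show ?thesis by blast
qed

text \<open>The linear algebra behind weak* separation: if no element of \<open>I\<close> has the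
  same \<open>K\<close>-coordinates as \<open>z\<close>, a linear combination of \<open>K\<close>
  annihilates \<open>I\<close> but not \<open>z\<close>. The induction eliminates one coordinate
  \<open>k\<close> by means of an element \<open>w0\<close> of \<open>I\<close> on which it equals
  1.\<close>

lemma finite_separation:
  assumes "finite K" and "subspace I" and "I \<subseteq> X" and "z \<in> X"
    and "\<And>w. w \<in> I \<Longrightarrow> \<exists>y\<in>K. J w y \<noteq> J z y"
  shows "\<exists>y. (\<forall>w\<in>I. J w y = 0) \<and> J z y \<noteq> 0"
  using assms
proof (induction K arbitrary: I z rule: finite_induct)
  case empty
  then show ?case using subspace_0 by blast
next
  case (insert k K)
  note I = \<open>subspace I\<close>
  show ?case
  proof (cases "\<forall>w\<in>I. J w k = 0")
    case True
    show ?thesis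
    proof (cases "J z k = 0")
      case False
      then show ?thesis using True by blast
    next
      case zk: True
      show ?thesis
      proof (rule insert.IH)
        fix w assume w: "w \<in> I"
        then show "\<exists>y\<in>K. J w y \<noteq> J z y" using insert.prems(4)[OF w] True zk by auto
      qed (use insert.prems in auto)
    qed
  next
    case False
    then obtain w1 where w1: "w1 \<in> I" "J w1 k \<noteq> 0" by blast
    define w0 where "w0 = (1 / J w1 k) *\<^sub>R w1"
    have w0: "w0 \<in> I" "w0 \<in> X" "J w0 k = 1"
      using w1 subspace_scale[OF I] insert.prems(2) J_scale[of w1]
      by (auto simp: w0_def blinfun.scaleR_left)
    define I' where "I' = {w \<in> I. J w k = 0}"
    define z' where "z' = z - (J z k) *\<^sub>R w0"
    have z': "z' \<in> X" unfolding z'_def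
      by (intro subspace_diff[OF X] subspace_scale[OF X] w0 insert.prems)
    have Jz': "J z' y = J z y - J z k * J w0 y" for y
      using insert.prems(3) w0 subspace_scale[OF X w0(2)]
      by (simp add: z'_def J_diff J_scale blinfun.diff_left blinfun.scaleR_left)
    have "\<exists>y. (\<forall>w\<in>I'. J w y = 0) \<and> J z' y \<noteq> 0"
    proof (rule insert.IH)
      show "subspace I'"
      proof -
        have "J 0 k = 0" using J_scale[OF w0(2), of 0] by simp
        moreover have "J (a + b) k = J a k + J b k" if "a \<in> I" "b \<in> I" for a b
          using that insert.prems(2) by (simp add: subsetD J_add blinfun.add_left)
        moreover have "J (r *\<^sub>R a) k = r * J a k" if "a \<in> I" for a r
          using that insert.prems(2) by (simp add: subsetD J_scale blinfun.scaleR_left)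
        ultimately show ?thesis using I unfolding subspace_def I'_def by simp
      qed
      show "I' \<subseteq> X" using insert.prems(2) by (auto simp: I'_def)
      show "z' \<in> X" by (rule z')
      fix w assume w: "w \<in> I'"
      then have wX: "w \<in> X" using insert.prems(2) by (auto simp: I'_def)
      let ?v = "w + (J z k) *\<^sub>R w0"
      have v: "?v \<in> I" using w w0 I by (auto simp: I'_def intro: subspace_add subspace_scale)
      have Jv: "J ?v y = J w y + J z k * J w0 y" for y
        using wX w0 subspace_scale[OF X w0(2)]
        by (simp add: J_add J_scale blinfun.add_left blinfun.scaleR_left)
      obtain y where "y \<in> insert k K" "J ?v y \<noteq> J z y" using insert.prems(4)[OF v] by blast
      moreover have "J ?v k = J z k" using Jv[of k] w w0(3) by (simp add: I'_def)
      ultimately show "\<exists>y\<in>K. J w y \<noteq> J z' y" by (auto simp: Jv Jz' algebra_simps)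
    qed
    then obtain y where y: "\<And>w. w \<in> I' \<Longrightarrow> J w y = 0" "J z' y \<noteq> 0" by blast
    \<comment> \<open>The correction makes the functional vanish at \<open>w0\<close> as well, hence
      on all of \<open>I\<close>, which is spanned by \<open>I'\<close> and
      \<open>w0\<close>.\<close>
    let ?y = "y - J w0 y *\<^sub>R k"
    have "J w ?y = 0" if w: "w \<in> I" for w
    proof -
      have wX: "w \<in> X" using w insert.prems(2) by blast
      have J': "J (w - J w k *\<^sub>R w0) u = J w u - J w k * J w0 u" for u
        using wX w0 subspace_scale[OF X w0(2)]
        by (simp add: J_diff J_scale blinfun.diff_left blinfun.scaleR_left)
      have "w - J w k *\<^sub>R w0 \<in> I'"
        using w w0 I by (auto simp: I'_def J' intro: subspace_diff subspace_scale)
      from y(1)[OF this] show ?thesis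
        by (simp add: J' blinfun.diff_right blinfun.scaleR_right algebra_simps)
    qed
    moreover have "J z ?y \<noteq> 0"
      using y(2) by (simp add: Jz' blinfun.diff_right blinfun.scaleR_right algebra_simps)
    ultimately show ?thesis by blast
  qed
qed

text \<open>A basic neighbourhood of \<open>z\<close> that avoids \<open>I\<close> restricts only
  finitely many coordinates, so the separation is a finite-dimensional matter.\<close>

lemma weak_star_separation:
  assumes I: "subspace I" "I \<subseteq> X" "closedin (weak_star_topology X J) I" and z: "z \<in> X" "z \<notin> I"
  obtains y where "\<And>w. w \<in> I \<Longrightarrow> J w y = 0" and "J z y \<noteq> 0"
proof -
  have top: "topspace (weak_star_topology X J) = X"
    by (simp add: weak_star_topology_def topspace_pullback_topology)
  have "openin (weak_star_topology X J) (X - I)"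
    using I(3) unfolding closedin_def top by blast
  then obtain U where U: "open U" "X - I = (\<lambda>x. blinfun_apply (J x)) -` U \<inter> X"
    by (auto simp: weak_star_topology_def openin_pullback_topology)
  have zU: "blinfun_apply (J z) \<in> U" using U(2) z by blast
  have "openin (product_topology (\<lambda>_. euclidean) UNIV) U"
    using U(1) by (simp add: euclidean_product_topology)
  from product_topology_open_contains_basis[OF this zU]
  obtain V where V: "blinfun_apply (J z) \<in> (\<Pi>\<^sub>E i\<in>UNIV. V i)" "finite {i. V i \<noteq> UNIV}"
    "(\<Pi>\<^sub>E i\<in>UNIV. V i) \<subseteq> U" by auto
  have "\<exists>y. (\<forall>w\<in>I. J w y = 0) \<and> J z y \<noteq> 0"
  proof (rule finite_separation[OF V(2) I(1,2) z(1)])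
    fix w assume w: "w \<in> I"
    show "\<exists>y\<in>{i. V i \<noteq> UNIV}. J w y \<noteq> J z y"
    proof (rule ccontr)
      assume *: "\<not> ?thesis"
      have "J w y \<in> V y" for y
      proof (cases "V y = UNIV")
        case False
        then have "J w y = J z y" using * by blast
        then show ?thesis using V(1) by (auto simp: PiE_iff)
      qed simp
      then have "blinfun_apply (J w) \<in> U" using V(3) by (auto simp: PiE_iff)
      then show False using U(2) w I(2) by blast
    qed
  qed
  then show ?thesis using that by blast
qed

lemma weak_star_bounded_limit:
  assumes D: "total D"
    and I: "subspace I" "I \<subseteq> X" "closedin (weak_star_topology X J) I" and z: "z \<in> X"
    and approx: "\<And>F \<epsilon>. finite F \<Longrightarrow> F \<subseteq> D \<Longrightarrow> \<epsilon> > 0 \<Longrightarrow>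
      \<exists>w\<in>I. norm w \<le> M \<and> (\<forall>d\<in>F. \<bar>J w d - J z d\<bar> < \<epsilon>)"
  shows "z \<in> I"
proof (rule ccontr)
  assume "z \<notin> I"
  then obtain y where y: "\<And>w. w \<in> I \<Longrightarrow> J w y = 0" "J z y \<noteq> 0"
    using weak_star_separation[OF I z] by blast
  let ?c = "\<bar>J z y\<bar>"
  \<comment> \<open>\<open>B\<close> bounds the norm of \<open>z - w\<close>. The error at
    \<open>y\<close> is split into halves: one for replacing \<open>y\<close> by \<open>d\<close>,
    one for the finitely many terms of \<open>d\<close>.\<close>
  define B where "B = norm z + \<bar>M\<bar> + 1"
  have B: "B > 0" by (simp add: B_def add_nonneg_pos)
  obtain d where d: "d \<in> span D" "norm (y - d) < ?c / (2 * B)"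
    using total_approx[OF D, of "?c / (2 * B)"] y(2) B by auto
  obtain F r where F: "finite F" "F \<subseteq> D" "d = (\<Sum>a\<in>F. r a *\<^sub>R a)"
    using d(1) unfolding span_explicit by blast
  define S where "S = (\<Sum>a\<in>F. \<bar>r a\<bar>) + 1"
  have S: "S > 0" by (simp add: S_def add_nonneg_pos sum_nonneg)
  obtain w where w: "w \<in> I" "norm w \<le> M" "\<And>a. a \<in> F \<Longrightarrow> \<bar>J w a - J z a\<bar> < ?c / (2 * S)"
    using approx[OF F(1,2), of "?c / (2 * S)"] S y(2) by auto
  have wX: "w \<in> X" using w I by blast
  have zw: "z - w \<in> X" by (intro subspace_diff[OF X] z wX)
  have Jzw: "J (z - w) a = J z a - J w a" for a using z wX by (simp add: J_diff blinfun.diff_left)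
  have "\<bar>J (z - w) d\<bar> \<le> (\<Sum>a\<in>F. \<bar>r a\<bar> * (?c / (2 * S)))"
    unfolding F(3) blinfun.sum_right blinfun.scaleR_right
  proof (intro order.trans[OF sum_abs] sum_mono)
    fix a assume a: "a \<in> F"
    have "\<bar>J (z - w) a\<bar> \<le> ?c / (2 * S)" using w(3)[OF a] Jzw[of a] by linarith
    then show "\<bar>r a *\<^sub>R J (z - w) a\<bar> \<le> \<bar>r a\<bar> * (?c / (2 * S))"
      unfolding real_scaleR_def abs_mult by (intro mult_left_mono) auto
  qed
  also have "\<dots> = (S - 1) * (?c / (2 * S))" unfolding S_def by (simp only: sum_distrib_right add_diff_cancel_right')
  also have "\<dots> \<le> ?c / 2" using S by (simp add: field_simps)
  finally have 1: "\<bar>J (z - w) d\<bar> \<le> ?c / 2" .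
  have "\<bar>J (z - w) (y - d)\<bar> \<le> norm (z - w) * norm (y - d)" by (rule J_bound[OF zw])
  also have "\<dots> \<le> B * norm (y - d)"
    using norm_triangle_ineq4[of z w] w(2) by (intro mult_right_mono) (auto simp: B_def)
  also have "\<dots> < B * (?c / (2 * B))" using d(2) B by (intro mult_strict_left_mono)
  also have "\<dots> = ?c / 2" using B by simp
  finally have "\<bar>J (z - w) y\<bar> < ?c" using 1 unfolding blinfun.diff_right by linarith
  then show False using y(1)[OF w(1)] by (simp add: Jzw)
qed

end

section \<open>The imaginary units\<close>

abbreviation cartan :: "('a::quat_hilbert \<Rightarrow>\<^sub>L 'a) set" where
  "cartan \<equiv> cartan_factor_III_H"

definition qi :: quat where "qi = Quat 0 1 0 0"
definition qj :: quat where "qj = Quat 0 0 1 0"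
definition qk :: quat where "qk = Quat 0 0 0 1"

lemma quat_unit_simps [simp]:
  "qcnj qi = - qi" "qcnj qj = - qj" "qcnj qk = - qk"
  "qi * qi = - 1" "qj * qj = - 1" "qk * qk = - 1"
  "qi * qj = qk" "qj * qk = qi" "qk * qi = qj"
  "qj * qi = - qk" "qk * qj = - qi" "qi * qk = - qj"
  "qnorm_sq qi = 1" "qnorm_sq qj = 1" "qnorm_sq qk = 1"
  by (auto simp: quat_eq_iff quat_ops_defs qi_def qj_def qk_def qnorm_sq_def)

lemma quat_unit_assoc_simps [simp]:
  "q * qi * qi = - q" "q * qj * qj = - q" "q * qk * qk = - q"
  by (simp_all add: mult.assoc)

lemma quat_expand: "q = of_real (qRe q) + of_real (qIm1 q) * qi + of_real (qIm2 q) * qj + of_real (qIm3 q) * qk"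
  by (simp add: quat_eq_iff quat_ops_defs qi_def qj_def qk_def of_real_def)

subsection \<open>Skew operators of rank at most two\<close>

lemma sqrt_qnorm_sq_qinner_le: "sqrt (qnorm_sq (qinner x u)) \<le> norm x * norm (u :: 'a::quat_inner)"
proof (cases "u = 0")
  case False
  define y where "y = (1 / norm u) *\<^sub>R u"
  have y: "norm y = 1" "u = norm u *\<^sub>R y" using False by (auto simp: y_def)
  have "qnorm_sq (of_real r * q) = r\<^sup>2 * qnorm_sq q" for r q
    by (simp add: qnorm_sq_def quat_ops_defs of_real_def power2_eq_square algebra_simps)
  moreover have "qinner x u = of_real (norm u) * qinner x y"
    by (subst y(2)) (simp add: qinner_scaleR quat_eq_iff quat_ops_defs of_real_def)
  ultimately have "sqrt (qnorm_sq (qinner x u)) = norm u * sqrt (qnorm_sq (qinner x y))"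
    by (simp add: real_sqrt_mult)
  moreover have "sqrt (qnorm_sq (qinner x y)) \<le> norm x"
    using norm_qinner_scaleQ_le[OF y(1), of x] by (simp add: norm_scaleQ y(1))
  ultimately show ?thesis by (simp add: mult.commute mult_left_mono)
qed (simp add: qnorm_sq_def quat_ops_defs)

definition rank2 :: "'a::quat_hilbert \<Rightarrow> 'a \<Rightarrow> ('a \<Rightarrow>\<^sub>L 'a)" where
  "rank2 u v = Blinfun (\<lambda>x. qinner x u *\<^sub>Q v - qinner x v *\<^sub>Q u)"

lemma rank2_apply: "rank2 u v x = qinner x u *\<^sub>Q v - qinner x v *\<^sub>Q u"
proof -
  have "bounded_linear (\<lambda>x. qinner x u *\<^sub>Q v)" for u v :: 'a
  proof (rule bounded_linear_intro[where K = "norm u * norm v"])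
    fix x y and r :: real
    show "qinner (x + y) u *\<^sub>Q v = qinner x u *\<^sub>Q v + qinner y u *\<^sub>Q v"
      by (simp add: qinner_add_left scaleQ_add_left)
    show "qinner (r *\<^sub>R x) u *\<^sub>Q v = r *\<^sub>R (qinner x u *\<^sub>Q v)"
      unfolding qinner_scaleR by (simp add: scaleR_scaleQ scaleQ_scaleQ)
    show "norm (qinner x u *\<^sub>Q v) \<le> norm x * (norm u * norm v)"
      using mult_right_mono[OF sqrt_qnorm_sq_qinner_le norm_ge_zero, of x u v]
      by (simp add: norm_scaleQ mult_ac)
  qed
  then have "bounded_linear (\<lambda>x. qinner x u *\<^sub>Q v - qinner x v *\<^sub>Q u)"
    by (intro bounded_linear_sub)
  then show ?thesis by (simp add: rank2_def bounded_linear_Blinfun_apply)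
qed

lemma rank2_in_cartan: "rank2 u v \<in> cartan"
proof (rule cartanI)
  show "rank2 u v (q *\<^sub>Q x) = q *\<^sub>Q rank2 u v x" for q x
    by (simp add: rank2_apply qinner_scaleQ_left scaleQ_diff_right scaleQ_scaleQ)
  show "inner (rank2 u v x) y = - inner x (rank2 u v y)" for x y
  proof -
    have *: "inner (qinner x u *\<^sub>Q v) y = inner x (qinner y v *\<^sub>Q u)" for u v :: 'a
      unfolding inner_eq_qRe qinner_scaleQ_left qinner_scaleQ_right
      by (metis qinner_commute)
    show ?thesis by (simp add: rank2_apply inner_diff_left inner_diff_right *)
  qed
qed

lemma rank2_add_right: "rank2 u (v + w) = rank2 u v + rank2 u w"
  by (rule blinfun_eqI) (simp add: rank2_apply plus_blinfun.rep_eq qinner_add_right scaleQ_add_left scaleQ_add_right)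

lemma rank2_minus_commute: "rank2 v u = - rank2 u v"
  by (rule blinfun_eqI) (simp add: rank2_apply uminus_blinfun.rep_eq)

lemma rank2_add_left: "rank2 (v + w) u = rank2 v u + rank2 w u"
  by (metis rank2_add_right rank2_minus_commute minus_add_distrib)

lemma rank2_minus_right [simp]: "rank2 u (- v) = - rank2 u v"
  by (rule blinfun_eqI) (simp add: rank2_apply uminus_blinfun.rep_eq)

lemma rank2_minus_left [simp]: "rank2 (- u) v = - rank2 u v"
  by (metis rank2_minus_right rank2_minus_commute)

lemma rank2_scaleQ_left: "rank2 (q *\<^sub>Q u) v = rank2 u (qcnj q *\<^sub>Q v)"
  by (rule blinfun_eqI) (simp add: rank2_apply scaleQ_scaleQ qinner_scaleQ_right)

lemma rank2_scaleR_right: "rank2 u (r *\<^sub>R v) = r *\<^sub>R rank2 u v"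
proof (rule blinfun_eqI)
  fix x
  have "qinner x v * of_real r = of_real r * qinner x v"
    by (simp add: quat_eq_iff quat_ops_defs of_real_def)
  then show "rank2 u (r *\<^sub>R v) x = (r *\<^sub>R rank2 u v) x"
    by (simp add: rank2_apply scaleR_blinfun.rep_eq scaleQ_scaleR qinner_scaleR scaleR_diff_right)
       (simp add: scaleR_scaleQ scaleQ_scaleQ)
qed

text \<open>\<open>rank1 v\<close> is \<open>|v|\<^sup>2 i\<close> on the quaternionic line through \<open>v\<close>.\<close>

definition rank1 :: "'a::quat_hilbert \<Rightarrow> ('a \<Rightarrow>\<^sub>L 'a)" where
  "rank1 v = (1/2) *\<^sub>R rank2 v (qi *\<^sub>Q v)"

lemma rank1_apply: "rank1 v x = (qinner x v * qi) *\<^sub>Q v"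
  by (simp add: rank1_def rank2_apply scaleR_blinfun.rep_eq scaleQ_scaleQ qinner_scaleQ_right
      flip: scaleR_2)

lemma rank1_in_cartan: "rank1 v \<in> cartan"
  unfolding rank1_def by (intro subspace_scale[OF subspace_cartan] rank2_in_cartan)

subsection \<open>Vector functionals are weak*-continuous\<close>

text \<open>Frechet differentiability of the norm at \<open>rank1 v\<close>, with derivative \<open>w \<mapsto> w v \<bullet> i v\<close>.\<close>

lemma norm_rank1_add_le:
  assumes v: "norm v = 1" and w: "w \<in> cartan" "norm w \<le> 1/4"
  shows "norm (rank1 v + w) \<le> 1 + inner (w v) (qi *\<^sub>Q v) + 2 * (norm w)\<^sup>2"
proof -
  define t where "t = norm w"
  define \<phi> where "\<phi> = inner (w v) (qi *\<^sub>Q v)"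
  have t: "0 \<le> t" "t \<le> 1/4" using w by (auto simp: t_def)
  have "\<bar>\<phi>\<bar> \<le> norm (w v) * norm (qi *\<^sub>Q v)" unfolding \<phi>_def by (rule Cauchy_Schwarz_ineq2)
  also have "\<dots> \<le> t" using norm_blinfun[of w v] v by (simp add: norm_scaleQ t_def)
  finally have phi: "\<bar>\<phi>\<bar> \<le> t" .
  have k0: "0 \<le> 1 + \<phi> + 2 * t\<^sup>2"
  proof -
    have "0 \<le> t\<^sup>2" by simp
    then show ?thesis using phi t by linarith
  qed
  show ?thesis unfolding t_def[symmetric] \<phi>_def[symmetric]
  proof (rule norm_blinfun_bound[OF k0])
    fix u
    define q where "q = qinner u v"
    define s where "s = q *\<^sub>Q v"
    define u' where "u' = u - s"
    define z where "z = q *\<^sub>Q qi *\<^sub>Q v"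
    have u: "u = s + u'" by (simp add: u'_def)
    have "qinner s v = q" using v by (simp add: s_def qinner_scaleQ_left qinner_self dot_square_norm)
    then have "qinner u' v = 0" by (simp add: u'_def qinner_diff_left q_def)
    then have "inner u' s = 0" by (simp add: s_def inner_eq_qRe qinner_scaleQ_right)
    then have su': "inner s u' = 0" by (simp add: inner_commute)
    have nu: "(norm u)\<^sup>2 = (norm s)\<^sup>2 + (norm u')\<^sup>2"
      unfolding power2_norm_eq_inner u using su' by (simp add: inner_add_left inner_add_right inner_commute)
    have ns: "(norm s)\<^sup>2 = qnorm_sq q" "(norm z)\<^sup>2 = qnorm_sq q"
      using v by (simp_all add: s_def z_def power2_norm_eq_inner inner_scaleQ_scaleQ dot_square_norm norm_scaleQ)
    then have zs: "norm z = norm s" by (metis norm_ge_zero power2_eq_imp_eq)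
    have e: "(rank1 v + w) u = z + w u"
      by (simp add: plus_blinfun.rep_eq rank1_apply z_def q_def scaleQ_scaleQ)
    have "inner z (w s) = qnorm_sq q * \<phi>"
      by (simp add: z_def s_def cartan_scaleQ[OF w(1)] inner_scaleQ_scaleQ \<phi>_def inner_commute)
    moreover have "inner z (w u') \<le> norm s * (t * norm u')"
      using norm_cauchy_schwarz[of z "w u'"] mult_left_mono[OF norm_blinfun[of w u'] norm_ge_zero[of s]]
      by (simp add: zs t_def)
    ultimately have 1: "inner z (w u) \<le> (norm s)\<^sup>2 * \<phi> + norm s * (t * norm u')"
      by (subst u) (simp add: blinfun.add_right inner_add_right ns)
    have 2: "(norm (w u))\<^sup>2 \<le> t\<^sup>2 * ((norm s)\<^sup>2 + (norm u')\<^sup>2)"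
      using power_mono[OF norm_blinfun[of w u], of 2] by (simp add: power_mult_distrib nu t_def)
    \<comment> \<open>The weights leave the coefficient \<open>1/2 + t\<^sup>2\<close> on the part
      orthogonal to \<open>v\<close>. Since \<open>\<phi> \<ge> - t\<close> and
      \<open>t \<le> 1/4\<close>, there is room for the missing linear term.\<close>
    have 3: "2 * (norm s * (t * norm u')) \<le> 2 * t\<^sup>2 * (norm s)\<^sup>2 + (1/2) * (norm u')\<^sup>2"
      using zero_le_power2[of "2 * t * norm s - norm u'"] by (simp add: power2_eq_square algebra_simps)
    have "(norm ((rank1 v + w) u))\<^sup>2 = (norm s)\<^sup>2 + 2 * inner z (w u) + (norm (w u))\<^sup>2"
      unfolding e zs[symmetric] by (simp add: power2_norm_eq_inner inner_add_left inner_add_right inner_commute)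
    also have "\<dots> \<le> (norm s)\<^sup>2 * (1 + 2 * \<phi> + 3 * t\<^sup>2) + (norm u')\<^sup>2 * (1/2 + t\<^sup>2)"
      using 1 2 3 by (simp add: algebra_simps)
    also have "\<dots> \<le> (norm s)\<^sup>2 * (1 + \<phi> + 2 * t\<^sup>2)\<^sup>2 + (norm u')\<^sup>2 * (1 + \<phi> + 2 * t\<^sup>2)\<^sup>2"
    proof (intro add_mono mult_left_mono)
      have sq: "1 + 2 * \<phi> + 4 * t\<^sup>2 \<le> (1 + \<phi> + 2 * t\<^sup>2)\<^sup>2"
        using zero_le_power2[of "\<phi> + 2 * t\<^sup>2"] by (simp add: power2_eq_square algebra_simps)
      have "0 \<le> t\<^sup>2" by simp
      then show "1 + 2 * \<phi> + 3 * t\<^sup>2 \<le> (1 + \<phi> + 2 * t\<^sup>2)\<^sup>2"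
        "1/2 + t\<^sup>2 \<le> (1 + \<phi> + 2 * t\<^sup>2)\<^sup>2" using sq phi t by linarith+
    qed auto
    also have "\<dots> = ((1 + \<phi> + 2 * t\<^sup>2) * norm u)\<^sup>2"
      unfolding power_mult_distrib nu by (simp add: distrib_left)
    finally show "norm ((rank1 v + w) u) \<le> (1 + \<phi> + 2 * t\<^sup>2) * norm u"
      by (rule power2_le_imp_le) (use k0 in simp)
  qed
qed

lemma norm_rank1_ge:
  assumes "norm v = 1"
  shows "1 \<le> norm (rank1 v)"
proof -
  have "qinner v v = 1" using assms by (simp add: qinner_self dot_square_norm)
  then have "norm (rank1 v v) = 1" using assms by (simp add: rank1_apply norm_scaleQ)
  then show ?thesis using norm_blinfun[of "rank1 v" v] assms by simp
qed

lemma almost_attained: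
  fixes F :: "'a::real_normed_vector \<Rightarrow>\<^sub>L real"
  assumes "1 \<le> norm F" and "\<delta> > 0" and "\<delta> < 1"
  shows "\<exists>y. norm y \<le> 1 \<and> 1 - \<delta> \<le> F y"
proof (rule ccontr)
  assume "\<not> ?thesis"
  then have *: "F y < 1 - \<delta>" if "norm y \<le> 1" for y using that by (meson not_le)
  have "norm F \<le> 1 - \<delta>"
  proof (rule norm_blinfun_bound)
    show "0 \<le> 1 - \<delta>" using assms by simp
    have *: "F x \<le> (1 - \<delta>) * norm x" for x
    proof (cases "x = 0")
      case False
      have "F ((1 / norm x) *\<^sub>R x) < 1 - \<delta>" using False by (intro *) simp
      then show ?thesis using False by (simp add: blinfun.scaleR_right field_simps)
    qed simp
    show "norm (F x) \<le> (1 - \<delta>) * norm x" for x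
      using *[of x] *[of "- x"] by (simp add: blinfun.minus_right)
  qed
  then show False using assms by simp
qed

locale cartan_predual =
  fixes J :: "('a::quat_hilbert \<Rightarrow>\<^sub>L 'a) \<Rightarrow> ('y::banach \<Rightarrow>\<^sub>L real)"
  assumes predual_J: "isometric_predual cartan J"
begin

sublocale predual cartan J
  by unfold_locales (rule subspace_cartan predual_J)+

definition representable :: "(('a \<Rightarrow>\<^sub>L 'a) \<Rightarrow> real) \<Rightarrow> bool" where
  "representable g \<longleftrightarrow> (\<exists>y. \<forall>w\<in>cartan. J w y = g w)"

lemma representable_add: "representable f \<Longrightarrow> representable g \<Longrightarrow> representable (\<lambda>w. f w + g w)"
  unfolding representable_def by (metis blinfun.add_right)

lemma representable_scale: "representable f \<Longrightarrow> representable (\<lambda>w. r * f w)"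
  unfolding representable_def by (metis blinfun.scaleR_right real_scaleR_def)

lemma representable_cong: "representable f \<Longrightarrow> (\<And>w. w \<in> cartan \<Longrightarrow> f w = g w) \<Longrightarrow> representable g"
  unfolding representable_def by metis

text \<open>Smulian's argument: a perturbation of size \<open>\<delta>\<close> sees the derivative
  to first order, while the defect \<open>\<delta>\<^sup>2\<close> of \<open>y\<close> and the
  remainder \<open>2 * \<delta>\<^sup>2\<close> of the norm add up to
  \<open>3 * \<delta>\<^sup>2\<close>; division by \<open>\<delta>\<close> gives the bound.\<close>

lemma smulian:
  assumes v: "norm v = 1" and y: "norm y \<le> 1" "1 - \<delta>\<^sup>2 \<le> J (rank1 v) y"
    and \<delta>: "0 < \<delta>" "\<delta> \<le> 1/4" and w: "w \<in> cartan"
  shows "\<bar>J w y - inner (w v) (qi *\<^sub>Q v)\<bar> \<le> 3 * \<delta> * norm w"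
proof -
  have *: "J w y - inner (w v) (qi *\<^sub>Q v) \<le> 3 * \<delta> * norm w" if w: "w \<in> cartan" for w
  proof (cases "w = 0")
    case True
    then show ?thesis using J_scale[OF w, of 0] by simp
  next
    case False
    define c where "c = \<delta> / norm w"
    have c: "c > 0" "c * norm w = \<delta>" using False \<delta> by (auto simp: c_def)
    have cw: "c *\<^sub>R w \<in> cartan" "norm (c *\<^sub>R w) = \<delta>"
      using c subspace_scale[OF X w] by auto
    have "J (rank1 v + c *\<^sub>R w) y \<le> norm (rank1 v + c *\<^sub>R w)"
      using J_bound[OF subspace_add[OF X rank1_in_cartan cw(1)], of v y]
        mult_left_mono[OF y(1) norm_ge_zero[of "rank1 v + c *\<^sub>R w"]] by linarith
    also have "\<dots> \<le> 1 + c * inner (w v) (qi *\<^sub>Q v) + 2 * \<delta>\<^sup>2"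
      using norm_rank1_add_le[OF v cw(1)] \<delta> cw(2) by (simp add: scaleR_blinfun.rep_eq)
    finally have "c * (J w y - inner (w v) (qi *\<^sub>Q v)) \<le> 3 * \<delta>\<^sup>2"
      using y(2) by (simp add: J_add[OF rank1_in_cartan cw(1)] J_scale[OF w] blinfun.add_left
          blinfun.scaleR_left algebra_simps)
    also have "\<dots> = c * (3 * \<delta> * norm w)" using c(2) by (simp add: power2_eq_square mult_ac)
    finally show ?thesis using c(1) by simp
  qed
  from *[OF w] *[OF subspace_neg[OF X w]] J_scale[OF w, of "-1"] show ?thesis
    by (simp add: uminus_blinfun.rep_eq blinfun.minus_left abs_le_iff)
qed

text \<open>By \<open>smulian\<close>, predual elements that nearly attain the norm of
  \<open>rank1 v\<close> form a Cauchy sequence. Completeness of the predual then places the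
  derivative in it. This is where an arbitrary predual gets tied to concrete functionals.\<close>

lemma representable_rank1_functional:
  assumes v: "norm v = 1"
  shows "representable (\<lambda>w. inner (w v) (qi *\<^sub>Q v))"
proof -
  \<comment> \<open>The offset 4 keeps \<open>\<delta> n\<close> within the range
    \<open>\<delta> \<le> 1/4\<close> of \<open>smulian\<close>.\<close>
  define \<delta> where "\<delta> n = 1 / (real n + 4)" for n
  have \<delta>: "0 < \<delta> n" "\<delta> n \<le> 1/4" for n by (auto simp: \<delta>_def field_simps)
  have d0: "\<delta> \<longlonglongrightarrow> 0" using LIMSEQ_ignore_initial_segment[OF LIMSEQ_inverse_real_of_nat, of 3]
    by (simp add: \<delta>_def[abs_def] divide_inverse add.commute)
  have "\<exists>y. norm y \<le> 1 \<and> 1 - (\<delta> n)\<^sup>2 \<le> J (rank1 v) y" for n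
  proof -
    have "1 \<le> norm (J (rank1 v))" using norm_rank1_ge[OF v] norm_J[OF rank1_in_cartan] by simp
    moreover have "0 < (\<delta> n)\<^sup>2" "(\<delta> n)\<^sup>2 < 1"
      using \<delta>[of n] by (auto simp: power2_eq_square intro: le_less_trans[OF mult_mono[of _ "1/4" _ "1/4"]])
    ultimately show ?thesis using almost_attained by blast
  qed
  then obtain s where "\<And>n. norm (s n) \<le> 1" "\<And>n. 1 - (\<delta> n)\<^sup>2 \<le> J (rank1 v) (s n)" by metis
  then have est: "\<bar>J w (s n) - inner (w v) (qi *\<^sub>Q v)\<bar> \<le> 3 * \<delta> n * norm w" if "w \<in> cartan" for w n
    using smulian[OF v _ _ \<delta>] that by blast
  have dist: "dist (s m) (s n) \<le> 3 * \<delta> m + 3 * \<delta> n" for m n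
    unfolding dist_norm
  proof (rule norm_predual_le)
    fix w :: "'a \<Rightarrow>\<^sub>L 'a" assume w: "w \<in> cartan" "norm w \<le> 1"
    have "3 * \<delta> k * norm w \<le> 3 * \<delta> k" for k using \<delta>[of k] w(2) by (simp add: mult_left_le)
    from this[of m] this[of n] est[OF w(1), of m] est[OF w(1), of n]
    show "J w (s m - s n) \<le> 3 * \<delta> m + 3 * \<delta> n" by (simp add: blinfun.diff_right)
  qed
  have "Cauchy s"
  proof (rule metric_CauchyI)
    fix e :: real assume "e > 0"
    then have "\<forall>\<^sub>F n in sequentially. \<delta> n < e / 6" using d0 by (intro order_tendstoD) auto
    then obtain N where "\<And>n. n \<ge> N \<Longrightarrow> \<delta> n < e / 6" by (auto simp: eventually_sequentially)
    then have N: "\<delta> m < e / 6" "\<delta> n < e / 6" if "m \<ge> N" "n \<ge> N" for m n using that by auto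
    have "dist (s m) (s n) < e" if "m \<ge> N" "n \<ge> N" for m n
      using dist[of m n] N[OF that] by linarith
    then show "\<exists>M. \<forall>m\<ge>M. \<forall>n\<ge>M. dist (s m) (s n) < e" by blast
  qed
  then obtain y where y: "s \<longlonglongrightarrow> y" by (metis Cauchy_convergent convergent_def)
  have "J w y = inner (w v) (qi *\<^sub>Q v)" if w: "w \<in> cartan" for w
  proof (rule LIMSEQ_unique)
    show "(\<lambda>n. J w (s n)) \<longlonglongrightarrow> J w y" using y by (rule blinfun.tendsto[OF tendsto_const])
    have "(\<lambda>n. J w (s n) - inner (w v) (qi *\<^sub>Q v)) \<longlonglongrightarrow> 0"
    proof (rule Lim_null_comparison)
      have "(\<lambda>n. 3 * \<delta> n * norm w) \<longlonglongrightarrow> 3 * 0 * norm w" by (intro tendsto_intros d0)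
      then show "(\<lambda>n. 3 * \<delta> n * norm w) \<longlonglongrightarrow> 0" by simp
      show "\<forall>\<^sub>F n in sequentially. norm (J w (s n) - inner (w v) (qi *\<^sub>Q v)) \<le> 3 * \<delta> n * norm w"
        using est[OF w] by (intro always_eventually allI) simp
    qed
    then show "(\<lambda>n. J w (s n)) \<longlonglongrightarrow> inner (w v) (qi *\<^sub>Q v)" by (simp add: LIM_zero_iff)
  qed
  then show ?thesis by (auto simp: representable_def)
qed

text \<open>Since \<open>w\<close> and multiplication by i are both skew and commute,
  \<open>inner (w u) (qi *\<^sub>Q v)\<close> is symmetric in \<open>u\<close> and \<open>v\<close>,
  so polarization recovers it from its diagonal. The factor i is then absorbed into
  \<open>v\<close>.\<close>

lemma representable_vector_functional: "representable (\<lambda>w. inner (w u) v)"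
proof -
  have 1: "representable (\<lambda>w. inner (w v) (qi *\<^sub>Q v))" for v
  proof (cases "v = 0")
    case True
    then show ?thesis by (auto simp: representable_def intro!: exI[of _ 0])
  next
    case False
    define e where "e = (1 / norm v) *\<^sub>R v"
    have e: "norm e = 1" "v = norm v *\<^sub>R e" using False by (auto simp: e_def)
    have "representable (\<lambda>w. (norm v)\<^sup>2 * inner (w e) (qi *\<^sub>Q e))"
      by (intro representable_scale representable_rank1_functional e(1))
    moreover have "(norm v)\<^sup>2 * inner (w e) (qi *\<^sub>Q e) = inner (w v) (qi *\<^sub>Q v)" for w :: "'a \<Rightarrow>\<^sub>L 'a"
    proof -
      have "inner (w v) (qi *\<^sub>Q v) = inner (w (norm v *\<^sub>R e)) (qi *\<^sub>Q (norm v *\<^sub>R e))"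
        by (simp flip: e(2))
      then show ?thesis by (simp add: blinfun.scaleR_right scaleQ_scaleR power2_eq_square mult_ac)
    qed
    ultimately show ?thesis by simp
  qed
  have 2: "representable (\<lambda>w. inner (w u) (qi *\<^sub>Q v))" for u v
  proof (rule representable_cong)
    show "representable (\<lambda>w. (1/2) * (inner (w (u + v)) (qi *\<^sub>Q (u + v))
        + (-1) * (inner (w u) (qi *\<^sub>Q u) + inner (w v) (qi *\<^sub>Q v))))"
      by (intro representable_scale representable_add 1)
    fix w :: "'a \<Rightarrow>\<^sub>L 'a" assume w: "w \<in> cartan"
    have "inner (w v) (qi *\<^sub>Q u) = - inner (qi *\<^sub>Q w v) u"
      by (simp add: inner_scaleQ_left)
    also have "\<dots> = inner (w u) (qi *\<^sub>Q v)"
      using cartan_skew[OF w, of "qi *\<^sub>Q v" u] by (simp add: cartan_scaleQ[OF w] inner_commute)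
    finally show "(1/2) * (inner (w (u + v)) (qi *\<^sub>Q (u + v))
        + (-1) * (inner (w u) (qi *\<^sub>Q u) + inner (w v) (qi *\<^sub>Q v))) = inner (w u) (qi *\<^sub>Q v)"
      by (simp add: blinfun.add_right scaleQ_add_right inner_add_left inner_add_right)
  qed
  show ?thesis using 2[of u "- (qi *\<^sub>Q v)"] by (simp add: scaleQ_scaleQ)
qed

definition vector_functionals :: "'y set" where
  "vector_functionals = {y. \<exists>u v. \<forall>w\<in>cartan. J w y = inner (blinfun_apply w u) v}"

lemma total_vector_functionals: "total vector_functionals"
  unfolding total_def
proof (intro ballI impI)
  fix w :: "'a \<Rightarrow>\<^sub>L 'a" assume w: "w \<in> cartan" and z: "\<forall>d\<in>vector_functionals. J w d = 0"
  show "w = 0"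
  proof (rule blinfun_eqI)
    fix u
    obtain y where y: "\<forall>w'\<in>cartan. J w' y = inner (w' u) (w u)"
      using representable_vector_functional[of u "w u"] by (auto simp: representable_def)
    then have "y \<in> vector_functionals" by (auto simp: vector_functionals_def)
    then have "J w y = 0" using z by blast
    then have "inner (w u) (w u) = 0" using y w by metis
    then show "w u = blinfun_apply 0 u" by simp
  qed
qed

lemma representable_compose:
  assumes L: "\<And>x. x \<in> cartan \<Longrightarrow> L x \<in> cartan"
      "\<And>x y. x \<in> cartan \<Longrightarrow> y \<in> cartan \<Longrightarrow> L (x + y) = L x + L y"
      "\<And>x. x \<in> cartan \<Longrightarrow> norm (L x) \<le> K * norm x"
    and vec: "\<And>u v. representable (\<lambda>w. inner (blinfun_apply (L w) u) v)"
  shows "representable (\<lambda>w. J (L w) y)"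
proof -
  have "\<exists>y'. \<forall>x\<in>cartan. J x y' = J (L x) y"
  proof (rule weak_star_compose[OF total_vector_functionals L])
    fix d assume "d \<in> vector_functionals"
    then obtain u v where "\<forall>w\<in>cartan. J w d = inner (blinfun_apply w u) v"
      by (auto simp: vector_functionals_def)
    then show "\<exists>d'. \<forall>x\<in>cartan. J x d' = J (L x) d"
      using vec[of u v] L(1) by (simp add: representable_def)
  qed
  then show ?thesis by (simp add: representable_def)
qed

text \<open>Bounded weak operator limits are weak* limits because the vector functionals are
  total.\<close>

lemma bounded_weak_limit:
  assumes I: "subspace I" "I \<subseteq> cartan" "closedin (weak_star_topology cartan J) I"
    and z: "z \<in> cartan"
    and approx: "\<And>A \<epsilon>. finite A \<Longrightarrow> \<epsilon> > 0 \<Longrightarrow> \<exists>w\<in>I. norm w \<le> M \<and>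
      (\<forall>(u, v)\<in>A. \<bar>inner (blinfun_apply w u) v - inner (blinfun_apply z u) v\<bar> < \<epsilon>)"
  shows "z \<in> I"
proof (rule weak_star_bounded_limit[OF total_vector_functionals I z])
  fix F and \<epsilon> :: real assume F: "finite F" "F \<subseteq> vector_functionals" and \<epsilon>: "\<epsilon> > 0"
  have "\<forall>d\<in>F. \<exists>p. \<forall>w\<in>cartan. J w d = inner (blinfun_apply w (fst p)) (snd p)"
    using F(2) by (fastforce simp: vector_functionals_def)
  then obtain p where p: "\<And>d w. d \<in> F \<Longrightarrow> w \<in> cartan \<Longrightarrow> J w d = inner (blinfun_apply w (fst (p d))) (snd (p d))"
    by metis
  obtain w where w: "w \<in> I" "norm w \<le> M"
    "\<forall>(u, v)\<in>p ` F. \<bar>inner (blinfun_apply w u) v - inner (blinfun_apply z u) v\<bar> < \<epsilon>"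
    using approx[of "p ` F" \<epsilon>] F(1) \<epsilon> by auto
  then have "\<forall>d\<in>F. \<bar>J w d - J z d\<bar> < \<epsilon>" using p z I(2) by (force simp: case_prod_beta)
  then show "\<exists>w\<in>I. norm w \<le> M \<and> (\<forall>d\<in>F. \<bar>J w d - J z d\<bar> < \<epsilon>)" using w by blast
qed

lemma bounded_strong_limit:
  assumes I: "subspace I" "I \<subseteq> cartan" "closedin (weak_star_topology cartan J) I"
    and z: "z \<in> cartan"
    and s: "\<And>n :: nat. s n \<in> I" "\<And>n. norm (s n) \<le> M" "\<And>u. (\<lambda>n. s n u) \<longlonglongrightarrow> blinfun_apply z u"
  shows "z \<in> I"
proof (rule bounded_weak_limit[OF I z])
  fix A :: "('a \<times> 'a) set" and \<epsilon> :: real assume A: "finite A" and \<epsilon>: "\<epsilon> > 0"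
  have "\<forall>\<^sub>F n in sequentially. \<bar>inner (s n u) v - inner (z u) v\<bar> < \<epsilon>" for u v
  proof -
    have "(\<lambda>n. inner (s n u) v) \<longlonglongrightarrow> inner (z u) v" by (intro tendsto_intros s)
    then show ?thesis using \<epsilon> tendstoD[of _ "inner (z u) v" _ \<epsilon>] by (simp add: dist_real_def)
  qed
  then have "\<forall>\<^sub>F n in sequentially. \<forall>a\<in>A. \<bar>inner (s n (fst a)) (snd a) - inner (z (fst a)) (snd a)\<bar> < \<epsilon>"
    using A by (intro eventually_ball_finite) auto
  then obtain n where "\<forall>a\<in>A. \<bar>inner (s n (fst a)) (snd a) - inner (z (fst a)) (snd a)\<bar> < \<epsilon>"
    by (auto simp: eventually_sequentially)
  then show "\<exists>w\<in>I. norm w \<le> M \<and>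
      (\<forall>(u, v)\<in>A. \<bar>inner (blinfun_apply w u) v - inner (blinfun_apply z u) v\<bar> < \<epsilon>)"
    using s(1,2) by (intro bexI[of _ "s n"]) (auto simp: case_prod_beta)
qed

end

subsection \<open>Tripotents\<close>

lemma blinfun_strong_limit:
  fixes s :: "nat \<Rightarrow> 'a::real_normed_vector \<Rightarrow>\<^sub>L 'b::banach"
  assumes Cauchy: "\<And>u. Cauchy (\<lambda>n. s n u)" and bound: "\<And>n. norm (s n) \<le> K"
  obtains e where "\<And>u. (\<lambda>n. s n u) \<longlonglongrightarrow> blinfun_apply e u" and "norm e \<le> K"
proof -
  have "\<exists>l. (\<lambda>n. s n u) \<longlonglongrightarrow> l" for u using Cauchy by (metis Cauchy_convergent convergent_def)
  then obtain g where g: "\<And>u. (\<lambda>n. s n u) \<longlonglongrightarrow> g u" by metis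
  have K: "0 \<le> K" using order.trans[OF norm_ge_zero bound] .
  have gK: "norm (g u) \<le> K * norm u" for u
  proof (rule LIMSEQ_le_const2)
    show "(\<lambda>n. norm (s n u)) \<longlonglongrightarrow> norm (g u)" by (intro tendsto_norm g)
    have "norm (s n u) \<le> K * norm u" for n
      using norm_blinfun[of "s n" u] mult_right_mono[OF bound[of n] norm_ge_zero[of u]] by linarith
    then show "\<exists>N. \<forall>n\<ge>N. norm (s n u) \<le> K * norm u" by blast
  qed
  have bl: "bounded_linear g"
  proof (rule bounded_linear_intro[where K = K])
    fix u v and r :: real
    show "g (u + v) = g u + g v"
      by (rule LIMSEQ_unique[OF g]) (simp add: blinfun.add_right tendsto_add g)
    show "g (r *\<^sub>R u) = r *\<^sub>R g u"
      by (rule LIMSEQ_unique[OF g]) (simp add: blinfun.scaleR_right tendsto_scaleR g)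
    show "norm (g u) \<le> norm u * K" using gK[of u] by (simp add: mult.commute)
  qed
  show ?thesis
  proof (rule that[of "Blinfun g"])
    show "(\<lambda>n. s n u) \<longlonglongrightarrow> Blinfun g u" for u using g by (simp add: bounded_linear_Blinfun_apply bl)
    show "norm (Blinfun g) \<le> K"
      using gK K by (intro norm_blinfun_bound) (auto simp: bounded_linear_Blinfun_apply bl)
  qed
qed

lemma tendsto_blinfun_apply_bounded:
  fixes s :: "nat \<Rightarrow> 'a::real_normed_vector \<Rightarrow>\<^sub>L 'b::real_normed_vector"
  assumes s: "\<And>u. (\<lambda>n. s n u) \<longlonglongrightarrow> blinfun_apply e u" and bound: "\<And>n. norm (s n) \<le> K" and y: "y \<longlonglongrightarrow> l"
  shows "(\<lambda>n. s n (y n)) \<longlonglongrightarrow> e l"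
proof -
  have "(\<lambda>n. s n (y n) - s n l) \<longlonglongrightarrow> 0"
  proof (rule Lim_null_comparison)
    have "(\<lambda>n. K * norm (y n - l)) \<longlonglongrightarrow> K * norm (l - l)" by (intro tendsto_intros y)
    then show "(\<lambda>n. K * norm (y n - l)) \<longlonglongrightarrow> 0" by simp
    show "\<forall>\<^sub>F n in sequentially. norm (s n (y n) - s n l) \<le> K * norm (y n - l)"
    proof (intro always_eventually allI)
      fix n
      show "norm (s n (y n) - s n l) \<le> K * norm (y n - l)"
        using norm_blinfun[of "s n" "y n - l"] mult_right_mono[OF bound[of n] norm_ge_zero[of "y n - l"]]
        by (simp add: blinfun.diff_right)
    qed
  qed
  from tendsto_add[OF this s[of l]] show ?thesis by simp
qed

lemma cartan_strong_limit:
  fixes s :: "nat \<Rightarrow> 'a::quat_hilbert \<Rightarrow>\<^sub>L 'a"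
  assumes s: "\<And>n. s n \<in> cartan" and lim: "\<And>u. (\<lambda>n. s n u) \<longlonglongrightarrow> blinfun_apply e u"
  shows "e \<in> cartan"
proof (rule cartanI)
  fix q u
  have "bounded_linear (\<lambda>x. q *\<^sub>Q x :: 'a)"
    by (rule bounded_linear_intro[where K = "sqrt (qnorm_sq q)"])
      (auto simp: scaleQ_add_right scaleQ_scaleR norm_scaleQ)
  then have "(\<lambda>n. q *\<^sub>Q s n u) \<longlonglongrightarrow> q *\<^sub>Q e u" using lim by (rule bounded_linear.tendsto)
  then show "e (q *\<^sub>Q u) = q *\<^sub>Q e u"
    using LIMSEQ_unique[OF lim] by (simp add: cartan_scaleQ[OF s])
next
  fix u v
  have "(\<lambda>n. inner (s n u) v) \<longlonglongrightarrow> inner (e u) v" "(\<lambda>n. - inner u (s n v)) \<longlonglongrightarrow> - inner u (e v)"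
    by (intro tendsto_intros lim)+
  then show "inner (e u) v = - inner u (e v)"
    using LIMSEQ_unique by (simp add: cartan_skew[OF s]) blast
qed

text \<open>On the spectrum of the positive operator \<open>b = - x\<^sup>2\<close>, one step multiplies by
  \<open>1 + (1 - b)\<^sup>2 / 2\<close>. The iteration converges to the polar part of \<open>x\<close>. The factor exceeds \<open>1\<close> by
  a square, so monotonicity needs no square roots of operators.\<close>

definition polar_step :: "('a::quat_hilbert \<Rightarrow>\<^sub>L 'a) \<Rightarrow> ('a \<Rightarrow>\<^sub>L 'a)" where
  "polar_step x = (3/2) *\<^sub>R x - triple_product x x x + (1/2) *\<^sub>R triple_product x x (triple_product x x x)"

text \<open>The origin of the coefficients: \<open>triple_product x x x\<close> is the negative
  cube, so the step is 3/2 x + x^3 + 1/2 x^5 = x (1 + c^2 / 2) with c = 1 + x^2.\<close>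

lemma polar_step_apply:
  assumes x: "x \<in> cartan"
  shows "polar_step x u = x u + (1/2) *\<^sub>R x ((u + x (x u)) + x (x (u + x (x u))))"
proof -
  have 3: "triple_product x x x v = - x (x (x v))" for v
    by (simp add: triple_product_cartan[OF x] flip: scaleR_2)
  have 5: "triple_product x x (triple_product x x x) u = x (x (x (x (x u))))"
    by (simp add: triple_product_cartan[OF x] 3 blinfun.minus_right flip: scaleR_2)
  have *: "(3/2) *\<^sub>R a + b + (1/2) *\<^sub>R d = a + (1/2) *\<^sub>R (a + b + (b + d))" for a b d :: 'a
  proof -
    have 1: "(3/2) *\<^sub>R a = a + (1/2) *\<^sub>R a" using scaleR_left_distrib[of 1 "1/2" a] by simp
    have 2: "b = (1/2) *\<^sub>R b + (1/2) *\<^sub>R b" using scaleR_left_distrib[of "1/2" "1/2" b] by simp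
    have "a + (1/2) *\<^sub>R (a + b + (b + d)) = (a + (1/2) *\<^sub>R a) + ((1/2) *\<^sub>R b + (1/2) *\<^sub>R b) + (1/2) *\<^sub>R d"
      by (simp add: scaleR_add_right add_ac)
    then show ?thesis by (simp only: 1[symmetric] 2[symmetric])
  qed
  show ?thesis
    using *[of "x u" "x (x (x u))" "x (x (x (x (x u))))"]
    by (simp add: polar_step_def plus_blinfun.rep_eq minus_blinfun.rep_eq scaleR_blinfun.rep_eq 3 5
        blinfun.add_right)
qed

lemma polar_step_in_cartan: "x \<in> cartan \<Longrightarrow> polar_step x \<in> cartan"
  unfolding polar_step_def
  by (intro subspace_add[OF subspace_cartan] subspace_diff[OF subspace_cartan]
      subspace_scale[OF subspace_cartan] triple_product_in_cartan)

lemma contraction_apply: "norm x \<le> 1 \<Longrightarrow> norm (blinfun_apply x u) \<le> norm u"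
  using norm_blinfun[of x u] mult_right_mono[of "norm x" 1 "norm u"] by simp

text \<open>With b = - x^2 and c = 1 - b, the squared norm corresponds to b + b c^2 + b c^4 / 4. The
  identity 1 - b - b c^2 = c^2 + b^2 (1 - b) leaves c^2 to dominate the last term. The facts
  \<open>1\<close> and \<open>2\<close> are these identities as quadratic forms.\<close>

lemma norm_polar_step_le:
  assumes x: "x \<in> cartan" "norm x \<le> 1"
  shows "norm (polar_step x) \<le> 1"
proof (rule norm_blinfun_bound)
  fix u
  note skew = cartan_skew[OF x(1)]
  have le: "inner (x v) (x v) \<le> inner v v" for v
    using power_mono[OF contraction_apply[OF x(2)], of v 2] by (simp add: power2_norm_eq_inner)
  define c where "c v = v + x (x v)" for v
  have c_le: "inner (c v) (c v) \<le> inner v v" for v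
  proof -
    have "inner (c v) (c v) = inner v v - 2 * inner (x v) (x v) + inner (x (x v)) (x (x v))"
      by (simp add: c_def inner_add_left inner_add_right skew inner_commute)
    then show ?thesis using le[of v] le[of "x v"] inner_ge_zero[of "x v"] by linarith
  qed
  have T: "polar_step x u = x u + (1/2) *\<^sub>R x (c (c u))"
    by (simp add: polar_step_apply[OF x(1)] c_def)
  have 1: "inner (polar_step x u) (polar_step x u)
      = inner (x u) (x u) + inner (x (c u)) (x (c u)) + (1/4) * inner (x (c (c u))) (x (c (c u)))"
    by (simp add: T c_def inner_add_left inner_add_right skew blinfun.add_right inner_commute algebra_simps)
  have 2: "inner u u - inner (x u) (x u) - inner (x (c u)) (x (c u))
      = inner (c u) (c u) + (inner (x (x u)) (x (x u)) - inner (x (x (x u))) (x (x (x u))))"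
    by (simp add: c_def inner_add_left inner_add_right skew blinfun.add_right inner_commute algebra_simps)
  have "inner (polar_step x u) (polar_step x u) \<le> inner u u"
    using 1 2 le[of "x (x u)"] le[of "c (c u)"] c_le[of "c u"] inner_ge_zero[of "c u"] by linarith
  then show "norm (polar_step x u) \<le> 1 * norm u" by (simp add: norm_le)
qed simp

lemma polar_step_commute:
  assumes "x \<in> cartan" and "\<And>u. blinfun_apply y (blinfun_apply x u) = blinfun_apply x (blinfun_apply y u)"
  shows "blinfun_apply y (polar_step x u) = polar_step x (blinfun_apply y u)"
  by (simp add: polar_step_apply assms blinfun.add_right blinfun.scaleR_right)

lemma incseq_bounded_Cauchy:
  fixes f :: "nat \<Rightarrow> real"
  assumes "incseq f" and "\<And>n. f n \<le> K"
  shows "Cauchy f"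
  using assms by (meson LIMSEQ_imp_Cauchy incseq_convergent)

text \<open>The iterates are commuting skew operators, and each increment is half of
  \<open>s n\<close> times the square of a symmetric operator. This makes the norms of
  \<open>s n v\<close> increase, which yields both strong convergence and the preservation of the
  kernel of \<open>x\<close>.\<close>

lemma polar_part_exists:
  assumes x: "x \<in> cartan" "norm x \<le> 1"
  obtains e where "e \<in> cartan" and "\<And>u. e (e (blinfun_apply e u)) = - e u"
    and "\<And>u. blinfun_apply e u = 0 \<longleftrightarrow> x u = 0"
    and "\<And>u. (\<lambda>n. (polar_step ^^ n) x u) \<longlonglongrightarrow> e u" and "\<And>n. norm ((polar_step ^^ n) x) \<le> 1"
proof -
  define s where "s n = (polar_step ^^ n) x" for n
  have s0: "s 0 = x" and sSuc: "s (Suc n) = polar_step (s n)" for n by (auto simp: s_def)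
  have sC: "s n \<in> cartan" for n
    by (induction n) (auto simp: s0 sSuc x polar_step_in_cartan)
  have sN: "norm (s n) \<le> 1" for n
    by (induction n) (auto simp: s0 sSuc x norm_polar_step_le sC)
  have sx: "x (s n u) = s n (x u)" for n u
    by (induction n arbitrary: u) (auto simp: s0 sSuc polar_step_commute[OF sC])
  have comm: "s m (s n u) = s n (s m u)" for m n u
    by (induction n arbitrary: u) (auto simp: s0 sSuc sx polar_step_commute[OF sC])
  define c where "c n v = v + s n (s n v)" for n v
  have step: "s (Suc n) v = s n v + (1/2) *\<^sub>R s n (c n (c n v))" for n v
    by (simp add: sSuc polar_step_apply[OF sC] c_def)
  \<comment> \<open>One of the two factors \<open>c\<close> of the increment is moved to the other
    side, which gives the same form at \<open>c (n + k) v\<close>; it is nonnegative by induction,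
    hence the arbitrary \<open>v\<close>.\<close>
  have mono: "inner (s n v) (s n v) \<le> inner (s n v) (s (n + k) v)" for n k v
  proof (induction k arbitrary: v)
    case (Suc k)
    let ?m = "n + k"
    have "inner (s n v) (s ?m (c ?m (c ?m v))) = inner (s n (c ?m v)) (s ?m (c ?m v))"
      by (simp add: c_def blinfun.add_right inner_add_left inner_add_right cartan_skew[OF sC] comm[of n ?m])
    moreover have "0 \<le> inner (s n (c ?m v)) (s ?m (c ?m v))"
      using Suc.IH[of "c ?m v"] inner_ge_zero[of "s n (c ?m v)"] by linarith
    ultimately show ?case using Suc.IH[of v] by (simp add: step inner_add_right)
  qed simp
  have le: "norm (s n v) \<le> norm (s (n + k) v)" for n k v
  proof -
    have "norm (s n v) * norm (s n v) \<le> norm (s n v) * norm (s (n + k) v)"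
      using mono[of n v k] norm_cauchy_schwarz[of "s n v" "s (n + k) v"]
      by (simp add: dot_square_norm power2_eq_square)
    then show ?thesis by (cases "s n v = 0") auto
  qed
  have diff: "(norm (s (n + k) v - s n v))\<^sup>2 \<le> (norm (s (n + k) v))\<^sup>2 - (norm (s n v))\<^sup>2" for n k v
    using mono[of n v k]
    by (simp add: power2_norm_eq_inner inner_diff_left inner_diff_right inner_commute)
  have Cauchy: "Cauchy (\<lambda>n. s n v)" for v
  proof (rule metric_CauchyI)
    have "incseq (\<lambda>n. (norm (s n v))\<^sup>2)"
      using le[of _ v 1] by (intro incseq_SucI power_mono) auto
    moreover have "(norm (s n v))\<^sup>2 \<le> (norm v)\<^sup>2" for n
      using contraction_apply[OF sN, of n v] by (intro power_mono) auto
    ultimately have C: "Cauchy (\<lambda>n. (norm (s n v))\<^sup>2)" by (rule incseq_bounded_Cauchy)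
    fix \<epsilon> :: real assume \<epsilon>: "\<epsilon> > 0"
    then obtain N where N: "\<And>m n. m \<ge> N \<Longrightarrow> n \<ge> N \<Longrightarrow> dist ((norm (s m v))\<^sup>2) ((norm (s n v))\<^sup>2) < \<epsilon>\<^sup>2"
      using metric_CauchyD[OF C, of "\<epsilon>\<^sup>2"] by auto
    have *: "dist (s m v) (s n v) < \<epsilon>" if "m \<ge> n" "n \<ge> N" for m n
    proof -
      obtain k where k: "m = n + k" using le_Suc_ex \<open>m \<ge> n\<close> by blast
      have "(norm (s m v - s n v))\<^sup>2 \<le> (norm (s m v))\<^sup>2 - (norm (s n v))\<^sup>2" unfolding k by (rule diff)
      also have "\<dots> < \<epsilon>\<^sup>2" using N[of m n] that by (simp add: dist_real_def)
      finally show ?thesis using \<epsilon> by (simp add: dist_norm power2_less_imp_less)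
    qed
    have "dist (s m v) (s n v) < \<epsilon>" if "m \<ge> N" "n \<ge> N" for m n
      using *[of m n] *[of n m] that by (cases "m \<ge> n") (auto simp: dist_commute)
    then show "\<exists>M. \<forall>m\<ge>M. \<forall>n\<ge>M. dist (s m v) (s n v) < \<epsilon>" by blast
  qed
  obtain e where lim: "\<And>u. (\<lambda>n. s n u) \<longlonglongrightarrow> blinfun_apply e u" and eN: "norm e \<le> 1"
    using blinfun_strong_limit[of s 1] Cauchy sN by blast
  note lim' = tendsto_blinfun_apply_bounded[OF lim sN]
  have eC: "e \<in> cartan" by (rule cartan_strong_limit[OF sC lim])
  define ce where "ce v = v + e (e v)" for v
  have ecc: "e (ce (ce v)) = 0" for v
  proof -
    have "(\<lambda>n. c n v) \<longlonglongrightarrow> ce v" for v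
      unfolding c_def ce_def by (intro tendsto_intros lim')
    moreover have "(\<lambda>n. c n (y n)) \<longlonglongrightarrow> ce l" if "y \<longlonglongrightarrow> l" for y l
      unfolding c_def ce_def by (intro tendsto_intros lim' that)
    ultimately have 1: "(\<lambda>n. s n (c n (c n v))) \<longlonglongrightarrow> e (ce (ce v))" by (intro lim') blast
    have "(\<lambda>n. s (Suc n) v) \<longlonglongrightarrow> e v" by (rule LIMSEQ_Suc) (rule lim)
    from tendsto_scaleR[OF tendsto_const[of 2] tendsto_diff[OF this lim[of v]]]
    have 2: "(\<lambda>n. 2 *\<^sub>R (s (Suc n) v - s n v)) \<longlonglongrightarrow> 0" by simp
    have "2 *\<^sub>R (s (Suc n) v - s n v) = s n (c n (c n v))" for n by (simp add: step)
    with 2 have "(\<lambda>n. s n (c n (c n v))) \<longlonglongrightarrow> 0" by simp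
    with 1 show ?thesis using LIMSEQ_unique by blast
  qed
  \<comment> \<open>\<open>ce\<close> is symmetric and commutes with \<open>e\<close>, so the square
    in \<open>ecc\<close> can be cancelled.\<close>
  have ec: "e (ce v) = 0" for v
  proof -
    have "inner (e (ce v)) (e (ce v)) = - inner v (e (e (ce (ce v))))"
      by (simp add: ce_def blinfun.add_right inner_add_left inner_add_right cartan_skew[OF eC])
    then show ?thesis by (simp add: ecc)
  qed
  show ?thesis
  proof (rule that[OF eC])
    show "e (e (e u)) = - e u" for u
      using ec[of u] by (simp add: ce_def blinfun.add_right eq_neg_iff_add_eq_0 add.commute)
    show "e u = 0 \<longleftrightarrow> x u = 0" for u
    proof
      assume "x u = 0"
      have "s n u = 0" for n
      proof (induction n)
        case (Suc n)
        then show ?case by (simp add: sSuc polar_step_apply[OF sC] blinfun.add_right)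
      qed (simp add: s0 \<open>x u = 0\<close>)
      then show "e u = 0" using LIMSEQ_unique[OF lim[of u]] by simp
    next
      assume "e u = 0"
      have "norm (x u) \<le> norm (s n u)" for n using le[of 0 u n] by (simp add: s0)
      then have "norm (x u) \<le> norm (e u)"
        using LIMSEQ_le_const[OF tendsto_norm[OF lim[of u]]] by blast
      with \<open>e u = 0\<close> show "x u = 0" by simp
    qed
    show "(\<lambda>n. (polar_step ^^ n) x u) \<longlonglongrightarrow> e u" for u using lim by (simp add: s_def)
    show "norm ((polar_step ^^ n) x) \<le> 1" for n using sN by (simp add: s_def)
  qed
qed

subsection \<open>Elements commuting with a tripotent\<close>

text \<open>The norm of a symmetric operator is its numerical radius: polarize with \<open>v\<close>
  in the direction of \<open>S u\<close> and of the same norm as \<open>u\<close>, then apply the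
  parallelogram law.\<close>

lemma symmetric_norm_bound:
  fixes S :: "'a::real_inner \<Rightarrow>\<^sub>L 'a"
  assumes sym: "\<And>u v. inner (S u) v = inner u (S v)"
    and quad: "\<And>v. \<bar>inner (S v) v\<bar> \<le> m * (norm v)\<^sup>2"
  shows "norm (S u) \<le> m * norm u"
proof (cases "u = 0 \<or> S u = 0")
  case True
  show ?thesis
  proof (cases "u = 0")
    case False
    then have "0 \<le> m * (norm u)\<^sup>2" using quad[of u] by simp
    then have "0 \<le> m" using False by (simp add: zero_le_mult_iff)
    with True show ?thesis by auto
  qed simp
next
  case False
  define c where "c = norm u / norm (S u)"
  define v where "v = c *\<^sub>R S u"
  have nv: "norm v = norm u" using False by (simp add: v_def c_def)
  have "4 * inner (S u) v = inner (S (u + v)) (u + v) - inner (S (u - v)) (u - v)"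
    by (simp add: blinfun.add_right blinfun.diff_right inner_add_left inner_add_right
        inner_diff_left inner_diff_right sym) (simp add: inner_commute[of "S v" u] flip: sym)
  also have "\<dots> \<le> m * (norm (u + v))\<^sup>2 + m * (norm (u - v))\<^sup>2"
    using quad[of "u + v"] quad[of "u - v"] by linarith
  also have "\<dots> = m * (2 * (norm u)\<^sup>2 + 2 * (norm v)\<^sup>2)"
    by (simp add: power2_norm_eq_inner inner_add_left inner_add_right
        inner_diff_left inner_diff_right algebra_simps)
  finally have "inner (S u) v \<le> m * (norm u)\<^sup>2" by (simp add: nv)
  moreover have "inner (S u) v = norm u * norm (S u)"
    using False by (simp add: v_def c_def dot_square_norm power2_eq_square)
  ultimately have "norm u * norm (S u) \<le> norm u * (m * norm u)" by (simp add: power2_eq_square mult_ac)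
  then show ?thesis using False by simp
qed

text \<open>With \<open>\<alpha> = 1 - A\<close> and \<open>\<beta> = 1 + A\<close>, both \<open>1 - S\<close> and \<open>1 + S\<close> are, up to \<open>t\<^sup>2\<close> terms, of the form
  \<open>(1 - t H / 2) \<gamma> (1 - t H / 2)\<close> plus a positive operator.\<close>

lemma jordan_perturbation_bound:
  fixes A H S :: "'a::real_inner \<Rightarrow>\<^sub>L 'a"
  assumes A: "\<And>u v. inner (A u) v = inner u (A v)" "\<And>u. norm (A u) \<le> norm u"
    and H: "\<And>u v. inner (H u) v = inner u (H v)" "\<And>u. norm (H u) \<le> 2 * norm u" "\<And>u. 0 \<le> inner (H u) u"
    and S: "\<And>u. S u = A u - t *\<^sub>R ((1/2) *\<^sub>R (A (H u) + H (A u)) + H u)"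
    and t: "0 \<le> t"
  shows "norm (S u) \<le> (1 + 2 * t\<^sup>2) * norm u"
proof (rule symmetric_norm_bound)
  show "inner (S u) v = inner u (S v)" for u v
    by (simp add: S inner_diff_left inner_diff_right inner_add_left inner_add_right A(1) H(1) algebra_simps)
  fix v
  define r where "r = v - (t/2) *\<^sub>R H v"
  have Abd: "\<bar>inner (A u) u\<bar> \<le> inner u u" for u
    using Cauchy_Schwarz_ineq2[of "A u" u] mult_right_mono[OF A(2)[of u] norm_ge_zero[of u]]
    by (simp add: dot_square_norm power2_eq_square)
  have Hbd: "inner (H v) (H v) \<le> 4 * inner v v"
    using power_mono[OF H(2)[of v], of 2] by (simp add: power_mult_distrib power2_norm_eq_inner)
  have AH: "inner v (H (A v)) = inner v (A (H v))"
    using A(1)[of v "H v"] H(1)[of v "A v"] by (simp add: inner_commute)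
  \<comment> \<open>For 1 + S the conjugation reproduces the linear terms exactly; for 1 - S the
    term in \<open>H\<close> alone has the wrong sign and leaves
    \<open>2 * t * inner (H v) v\<close>, where positivity of \<open>H\<close> enters.\<close>
  have 1: "inner v v - inner (S v) v = (inner r r - inner (A r) r)
      - t\<^sup>2 / 4 * (inner (H v) (H v) - inner (A (H v)) (H v)) + 2 * t * inner (H v) v"
    by (simp add: S r_def blinfun.diff_right blinfun.scaleR_right inner_diff_left inner_diff_right
        inner_add_left inner_add_right A(1) H(1) AH power2_eq_square algebra_simps)
  have 2: "inner v v + inner (S v) v = (inner r r + inner (A r) r)
      - t\<^sup>2 / 4 * (inner (H v) (H v) + inner (A (H v)) (H v))"
    by (simp add: S r_def blinfun.diff_right blinfun.scaleR_right inner_diff_left inner_diff_right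
        inner_add_left inner_add_right A(1) H(1) AH power2_eq_square algebra_simps)
  have t2: "0 \<le> t\<^sup>2 / 4" by simp
  have "t\<^sup>2 / 4 * (inner (H v) (H v) - inner (A (H v)) (H v)) \<le> t\<^sup>2 / 4 * (8 * inner v v)"
    "t\<^sup>2 / 4 * (inner (H v) (H v) + inner (A (H v)) (H v)) \<le> t\<^sup>2 / 4 * (8 * inner v v)"
    using Abd[of "H v"] Hbd by (intro mult_left_mono t2; linarith)+
  moreover have "0 \<le> 2 * t * inner (H v) v" using t H(3)[of v] by simp
  moreover have "t\<^sup>2 / 4 * (8 * inner v v) = 2 * t\<^sup>2 * inner v v" by simp
  ultimately have "\<bar>inner (S v) v\<bar> \<le> inner v v + 2 * t\<^sup>2 * inner v v"
    using 1 2 Abd[of r] by linarith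
  then show "\<bar>inner (S v) v\<bar> \<le> (1 + 2 * t\<^sup>2) * (norm v)\<^sup>2"
    by (simp add: power2_norm_eq_inner distrib_right)
qed

lemma tripotent_contraction:
  assumes e: "e \<in> cartan" "\<And>u. e (e (blinfun_apply e u)) = - e u"
  shows "norm e \<le> 1"
proof (rule norm_blinfun_bound)
  fix u
  have "norm (e (e u)) = norm (e u)"
    by (simp add: norm_eq cartan_skew[OF e(1)] e(2) blinfun.minus_right)
  moreover have "inner (e u) (e u) = - inner u (e (e u))" by (simp add: cartan_skew[OF e(1)])
  ultimately have "norm (e u) * norm (e u) \<le> norm u * norm (e u)"
    using Cauchy_Schwarz_ineq2[of u "e (e u)"] by (simp add: dot_square_norm power2_eq_square)
  then show "norm (e u) \<le> 1 * norm u" by (cases "e u = 0") auto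
qed simp

text \<open>The selfadjoint part of the Peirce-2 space of a tripotent \<open>e\<close>; on the range of \<open>e\<close> it consists of
  the products of \<open>e\<close> with selfadjoint operators commuting with \<open>e\<close>.\<close>

definition peirce1 :: "('a::quat_hilbert \<Rightarrow>\<^sub>L 'a) \<Rightarrow> ('a \<Rightarrow>\<^sub>L 'a) set" where
  "peirce1 e = {w \<in> cartan. \<forall>u. w (e u) = e (w u) \<and> e (e (w u)) = - w u}"

text \<open>With Q w = {e, w, e}, the square of Q is the Peirce-2 projection of a tripotent
  \<open>e\<close>, and Q is an involution of the Peirce-2 space with fixed points
  \<open>peirce1 e\<close>. Written by triple products, the projection preserves every subtriple
  containing \<open>e\<close>.\<close>

definition peirce1_proj :: "('a::quat_hilbert \<Rightarrow>\<^sub>L 'a) \<Rightarrow> ('a \<Rightarrow>\<^sub>L 'a) \<Rightarrow> ('a \<Rightarrow>\<^sub>L 'a)" where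
  "peirce1_proj e w = (1/2) *\<^sub>R (triple_product e (triple_product e w e) e + triple_product e w e)"

context
  fixes e :: "'a::quat_hilbert \<Rightarrow>\<^sub>L 'a"
  assumes e: "e \<in> cartan" and eee: "\<And>u. e (e (blinfun_apply e u)) = - e u"
begin

lemma triple_product_ewe: "w \<in> cartan \<Longrightarrow> triple_product e w e u = - e (w (e u))"
  by (simp add: triple_product_cartan flip: scaleR_2)

lemma peirce1_proj_apply:
  assumes w: "w \<in> cartan"
  shows "peirce1_proj e w u = (1/2) *\<^sub>R (e (e (w (e (e u)))) - e (w (e u)))"
  by (simp add: peirce1_proj_def scaleR_blinfun.rep_eq plus_blinfun.rep_eq triple_product_ewe w
      triple_product_in_cartan e blinfun.minus_right)

lemma peirce1_proj_in_peirce1: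
  assumes w: "w \<in> cartan"
  shows "peirce1_proj e w \<in> peirce1 e"
proof -
  have "peirce1_proj e w \<in> cartan"
    unfolding peirce1_proj_def
    by (intro subspace_add[OF subspace_cartan] subspace_scale[OF subspace_cartan]
        triple_product_in_cartan w e)
  then show ?thesis
    by (simp add: peirce1_def peirce1_proj_apply w eee blinfun.scaleR_right blinfun.diff_right
        blinfun.minus_right algebra_simps)
qed

lemma peirce1_proj_ident:
  assumes w: "w \<in> peirce1 e"
  shows "peirce1_proj e w = w"
proof (rule blinfun_eqI)
  fix u
  have "w \<in> cartan" and c: "\<And>u. w (e u) = e (w u)" and p: "\<And>u. e (e (w u)) = - w u"
    using w by (auto simp: peirce1_def)
  then show "peirce1_proj e w u = w u"
    by (simp add: peirce1_proj_apply blinfun.minus_right flip: scaleR_2)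
qed

lemma norm_peirce1_proj_le:
  assumes w: "w \<in> cartan"
  shows "norm (peirce1_proj e w) \<le> norm w"
proof -
  have Q: "norm (triple_product e w e) \<le> norm w" if w: "w \<in> cartan" for w
  proof -
    have "norm (triple_product e w e) \<le> norm e * norm w * norm e" by (rule norm_triple_product_le[OF w])
    also have "\<dots> \<le> 1 * norm w * 1"
      using tripotent_contraction[OF e eee] by (intro mult_mono) auto
    finally show ?thesis by simp
  qed
  have "norm (triple_product e (triple_product e w e) e) \<le> norm w"
    using Q[OF triple_product_in_cartan[OF e w e]] Q[OF w] by linarith
  with Q[OF w] norm_triangle_ineq[of "triple_product e (triple_product e w e) e" "triple_product e w e"]
  show ?thesis by (simp add: peirce1_proj_def)
qed

lemma peirce1_proj_add:
  assumes "w \<in> cartan" "w' \<in> cartan"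
  shows "peirce1_proj e (w + w') = peirce1_proj e w + peirce1_proj e w'"
  by (rule blinfun_eqI)
    (simp add: peirce1_proj_apply assms subspace_add[OF subspace_cartan] plus_blinfun.rep_eq
      blinfun.add_right algebra_simps)

lemma peirce1_self: "e \<in> peirce1 e"
  using e eee by (simp add: peirce1_def)

text \<open>Multiplication by \<open>- e\<close> turns \<open>x\<close> and \<open>h\<close> into
  symmetric operators, the second one positive because \<open>w\<close> is a contraction supported
  by \<open>e\<close>. The point is that the curve leaves the unit ball only to second order in
  \<open>t\<close>.\<close>

lemma peirce1_perturbation_bound:
  assumes x: "x \<in> peirce1 e" "norm x \<le> 1" and w: "w \<in> peirce1 e" "norm w \<le> 1" and t: "0 \<le> t"
  defines "h \<equiv> e - w"
  shows "norm (x - t *\<^sub>R (triple_product x e h + h)) \<le> 1 + 2 * t\<^sup>2" (is "norm ?g \<le> _")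
proof (rule norm_blinfun_bound)
  have eN: "norm (e u) \<le> norm u" for u by (rule contraction_apply[OF tripotent_contraction[OF e eee]])
  have xC: "x \<in> cartan" and xe: "\<And>u. x (e u) = e (x u)" and eex: "\<And>u. e (e (x u)) = - x u"
    using x(1) by (auto simp: peirce1_def)
  have wC: "w \<in> cartan" and we: "\<And>u. w (e u) = e (w u)" and eew: "\<And>u. e (e (w u)) = - w u"
    using w(1) by (auto simp: peirce1_def)
  have hC: "h \<in> cartan" using e wC unfolding h_def by (intro subspace_diff[OF subspace_cartan])
  have he: "h (e u) = e (h u)" and eeh: "e (e (h u)) = - h u" for u
    by (simp_all add: h_def minus_blinfun.rep_eq blinfun.diff_right we eew eee)
  define A where "A = - (e o\<^sub>L x)"
  define H where "H = - (e o\<^sub>L h)"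
  define S where "S = - (e o\<^sub>L ?g)"
  have A: "A u = - e (x u)" and H: "H u = - e (h u)" and S: "S u = - e (?g u)" for u
    by (simp_all add: A_def H_def S_def uminus_blinfun.rep_eq)
  fix u
  have "norm (S u) \<le> (1 + 2 * t\<^sup>2) * norm u"
  proof (rule jordan_perturbation_bound)
    show "inner (A u) v = inner u (A v)" for u v
      by (simp add: A cartan_skew[OF e] cartan_skew[OF xC] xe)
    show "norm (A u) \<le> norm u" for u
      using eN[of "x u"] contraction_apply[OF x(2), of u] by (simp add: A)
    show "inner (H u) v = inner u (H v)" for u v
      by (simp add: H cartan_skew[OF e] cartan_skew[OF hC] he)
    show "norm (H u) \<le> 2 * norm u" for u
      using eN[of "h u"] eN[of u] contraction_apply[OF w(2), of u] norm_triangle_ineq4[of "e u" "w u"]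
      by (simp add: H h_def minus_blinfun.rep_eq)
    show "0 \<le> inner (H u) u" for u
    proof -
      have "inner (H u) u = inner (e u) (e u) - inner (w u) (e u)"
        by (simp add: H h_def minus_blinfun.rep_eq cartan_skew[OF e, of "e u - w u"] inner_diff_left)
      moreover have "norm (w u) \<le> norm (e u)"
      proof -
        have "w u = - w (e (e u))" using eew[of u] by (simp add: we)
        then have "norm (w u) = norm (w (e (e u)))" by simp
        also have "\<dots> \<le> norm (e (e u))" by (rule contraction_apply[OF w(2)])
        also have "\<dots> \<le> norm (e u)" by (rule eN)
        finally show ?thesis .
      qed
      then have "inner (w u) (e u) \<le> inner (e u) (e u)"
        using norm_cauchy_schwarz[of "w u" "e u"] mult_right_mono[of "norm (w u)" "norm (e u)" "norm (e u)"]
        by (simp add: dot_square_norm power2_eq_square)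
      ultimately show ?thesis by simp
    qed
    show "S u = A u - t *\<^sub>R ((1/2) *\<^sub>R (A (H u) + H (A u)) + H u)" for u
      by (simp add: S A H minus_blinfun.rep_eq scaleR_blinfun.rep_eq plus_blinfun.rep_eq
          triple_product_cartan[OF e] blinfun.diff_right blinfun.add_right blinfun.scaleR_right
          blinfun.minus_right algebra_simps)
  qed (rule t)
  moreover have "?g u = e (S u)"
  proof -
    have "e (e (?g u)) = - ?g u"
      by (simp add: minus_blinfun.rep_eq scaleR_blinfun.rep_eq plus_blinfun.rep_eq
          triple_product_cartan[OF e] blinfun.diff_right blinfun.add_right blinfun.scaleR_right
          blinfun.minus_right eex eeh algebra_simps)
    then show ?thesis by (simp add: S blinfun.minus_right)
  qed
  ultimately show "norm (?g u) \<le> (1 + 2 * t\<^sup>2) * norm u" using eN[of "S u"] by simp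
qed simp

end

section \<open>Smoothness as uniqueness of extensions attaining their norm\<close>

locale smooth_subtriple = cartan_predual J
  for J :: "('a::quat_hilbert \<Rightarrow>\<^sub>L 'a) \<Rightarrow> ('y::banach \<Rightarrow>\<^sub>L real)" +
  fixes I :: "('a \<Rightarrow>\<^sub>L 'a) set"
  assumes I_cartan: "I \<subseteq> cartan" and subtriple: "subtriple I"
    and closedin_I: "closedin (weak_star_topology cartan J) I"
    and smooth: "weak_star_hahn_banach_smooth cartan J I"
begin

lemma subspace_I: "subspace I"
  and triple_I: "\<And>a b c. a \<in> I \<Longrightarrow> b \<in> I \<Longrightarrow> c \<in> I \<Longrightarrow> triple_product a b c \<in> I"
  using subtriple by (auto simp: subtriple_def)

lemmas I_strong_limit = bounded_strong_limit[OF subspace_I I_cartan closedin_I]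
lemmas I_weak_limit = bounded_weak_limit[OF subspace_I I_cartan closedin_I]

lemma weak_star_functional: "weak_star_functional_on cartan J I (\<lambda>w. J w y)"
  unfolding weak_star_functional_on_def
proof (intro conjI ballI allI)
  fix x x' r assume x: "x \<in> I"
  then show "J (r *\<^sub>R x) y = r * J x y"
    using I_cartan by (simp add: J_scale subsetD blinfun.scaleR_left)
  assume "x' \<in> I"
  with x show "J (x + x') y = J x y + J x' y"
    using I_cartan by (simp add: J_add subsetD blinfun.add_left)
next
  have "continuous_map euclidean euclideanreal (\<lambda>h :: 'y \<Rightarrow> real. h y)"
    by (simp add: continuous_on_product_coordinates)
  then have "continuous_map (weak_star_topology cartan J) euclideanreal ((\<lambda>h. h y) \<circ> (\<lambda>x. blinfun_apply (J x)))"
    unfolding weak_star_topology_def by (rule continuous_map_pullback)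
  then show "continuous_map (subtopology (weak_star_topology cartan J) I) euclideanreal (\<lambda>w. J w y)"
    by (simp add: o_def continuous_map_from_subtopology)
qed

text \<open>Attaining \<open>c\<close> at a point of \<open>I\<close> makes \<open>c\<close> the
  norm of both functionals and of their common restriction, so both are norm-preserving
  extensions.\<close>

lemma unique_extension:
  assumes eq: "\<And>w. w \<in> I \<Longrightarrow> J w y1 = J w y2"
    and n1: "\<And>w. w \<in> cartan \<Longrightarrow> norm w \<le> 1 \<Longrightarrow> J w y1 \<le> c"
    and n2: "\<And>w. w \<in> cartan \<Longrightarrow> norm w \<le> 1 \<Longrightarrow> J w y2 \<le> c"
    and e: "e \<in> I" "norm e \<le> 1" "J e y1 = c"
  shows "y1 = y2"
proof -
  have eC: "e \<in> cartan" using e I_cartan by blast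
  have c: "0 \<le> c"
    using n1[OF subspace_0[OF X]] J_scale[OF subspace_0[OF X], of 0] by simp
  have norm: "norm y = c" if "J e y = c" "\<And>w. w \<in> cartan \<Longrightarrow> norm w \<le> 1 \<Longrightarrow> J w y \<le> c" for y
  proof (rule antisym)
    show "norm y \<le> c" using that(2) by (rule norm_predual_le)
    show "c \<le> norm y"
      using J_bound[OF eC, of y] mult_right_mono[OF e(2) norm_ge_zero[of y]] that(1) by linarith
  qed
  have ny: "norm y1 = c" "norm y2 = c" using norm n1 n2 e eq by auto
  have sup: "functional_norm_on I (\<lambda>w. J w y1) = c"
    unfolding functional_norm_on_def
  proof (rule antisym)
    have le: "\<bar>J w y1\<bar> \<le> c" if "w \<in> {w \<in> I. norm w \<le> 1}" for w
    proof -
      have "w \<in> cartan" "norm w \<le> 1" using that I_cartan by auto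
      then show ?thesis
        using J_bound[of w y1] mult_right_mono[of "norm w" 1 "norm y1"] ny c by simp
    qed
    have "e \<in> {w \<in> I. norm w \<le> 1}" using e by simp
    then show "(SUP w\<in>{w \<in> I. norm w \<le> 1}. \<bar>J w y1\<bar>) \<le> c" using le by (intro cSUP_least) blast+
    have "\<bar>J e y1\<bar> \<le> (SUP w\<in>{w \<in> I. norm w \<le> 1}. \<bar>J w y1\<bar>)"
      using le e by (intro cSUP_upper bdd_aboveI2[where M = c]) auto
    then show "c \<le> (SUP w\<in>{w \<in> I. norm w \<le> 1}. \<bar>J w y1\<bar>)" using e(3) by simp
  qed
  have "\<exists>!y. (\<forall>w\<in>I. J w y = J w y1) \<and> norm y = functional_norm_on I (\<lambda>w. J w y1)"
    using smooth weak_star_functional[of y1] unfolding weak_star_hahn_banach_smooth_def by blast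
  then show ?thesis using ny sup eq by metis
qed

text \<open>If \<open>I\<close> misses an element of \<open>peirce1 e\<close>, some \<open>k \<noteq> 0\<close> in the predual lives on \<open>peirce1 e\<close> and
  vanishes on \<open>I\<close>. Let \<open>k\<close> attain its norm at \<open>x\<close>. Then \<open>\<psi> = k {x, e, \<cdot>}\<close> plays the role of \<open>|k|\<close>, and
  \<open>\<psi>\<close> and \<open>\<psi> + k\<close> are distinct functionals which attain the same norm at \<open>e\<close> and agree on \<open>I\<close>.\<close>

lemma peirce1_subset:
  assumes eI: "e \<in> I" and eee: "\<And>u. e (e (blinfun_apply e u)) = - e u"
  shows "peirce1 e \<subseteq> I"
proof
  fix z assume z: "z \<in> peirce1 e"
  then have zC: "z \<in> cartan" by (simp add: peirce1_def)
  have eC: "e \<in> cartan" using eI I_cartan by blast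
  note tri = eC eee
  note P_cartan = peirce1_proj_in_peirce1[OF tri, unfolded peirce1_def, THEN CollectD, THEN conjunct1]
  have eN: "norm e \<le> 1" by (rule tripotent_contraction[OF tri])
  show "z \<in> I"
  proof (rule ccontr)
    assume "z \<notin> I"
    then obtain y where y: "\<And>w. w \<in> I \<Longrightarrow> J w y = 0" "J z y \<noteq> 0"
      using weak_star_separation[OF subspace_I I_cartan closedin_I zC] by blast
    have repP: "representable (\<lambda>w. inner (peirce1_proj e w u) v)" for u v
    proof (rule representable_cong)
      show "representable (\<lambda>w. (1/2) * (inner (w (e (e u))) (e (e v)) + inner (w (e u)) (e v)))"
        by (intro representable_scale representable_add representable_vector_functional)
      show "(1/2) * (inner (w (e (e u))) (e (e v)) + inner (w (e u)) (e v)) = inner (peirce1_proj e w u) v"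
        if "w \<in> cartan" for w
        by (simp add: peirce1_proj_apply[OF tri that] inner_diff_left cartan_skew[OF eC])
    qed
    have "representable (\<lambda>w. J (peirce1_proj e w) y)"
    proof (rule representable_compose[where K = 1])
      show "norm (peirce1_proj e w) \<le> 1 * norm w" if "w \<in> cartan" for w
        using norm_peirce1_proj_le[OF tri that] by simp
    qed (simp_all add: P_cartan peirce1_proj_add[OF tri] repP)
    then obtain k where k: "\<And>w. w \<in> cartan \<Longrightarrow> J w k = J (peirce1_proj e w) y"
      by (auto simp: representable_def)
    have k0: "J w k = 0" if w: "w \<in> I" for w
    proof -
      have "peirce1_proj e w \<in> I"
        unfolding peirce1_proj_def
        by (intro subspace_scale[OF subspace_I] subspace_add[OF subspace_I] triple_I eI w)
      then show ?thesis using y(1) k w I_cartan by auto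
    qed
    have kz: "J z k \<noteq> 0" using y(2) by (simp add: k zC peirce1_proj_ident[OF tri z])
    obtain x0 where x0: "x0 \<in> cartan" "norm x0 \<le> 1" "J x0 k = norm k" by (rule norm_attained)
    \<comment> \<open>The norming element may be moved into \<open>peirce1 e\<close>: the projection
      is contractive and \<open>k\<close> factors through it.\<close>
    define x where "x = peirce1_proj e x0"
    have x: "x \<in> peirce1 e" unfolding x_def by (rule peirce1_proj_in_peirce1[OF tri x0(1)])
    have xC: "x \<in> cartan" using x by (simp add: peirce1_def)
    have xN: "norm x \<le> 1" using norm_peirce1_proj_le[OF tri x0(1)] x0(2) by (simp add: x_def)
    have kx: "J x k = norm k"
      using k[OF xC] k[OF x0(1)] x0(3) peirce1_proj_ident[OF tri x] by (simp add: x_def)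
    define L where "L w = triple_product x e (peirce1_proj e w)" for w
    have LC: "L w \<in> cartan" if "w \<in> cartan" for w
      unfolding L_def by (intro triple_product_in_cartan xC eC P_cartan that)
    have LN: "norm (L w) \<le> norm w" if w: "w \<in> cartan" for w
    proof -
      have "norm (L w) \<le> norm x * norm e * norm (peirce1_proj e w)"
        unfolding L_def by (rule norm_triple_product_le[OF eC])
      also have "\<dots> \<le> 1 * 1 * norm w"
        using norm_peirce1_proj_le[OF tri w] eN xN by (intro mult_mono) auto
      finally show ?thesis by simp
    qed
    have Ladd: "L (w + w') = L w + L w'" if "w \<in> cartan" "w' \<in> cartan" for w w'
      unfolding L_def peirce1_proj_add[OF tri that]
      by (rule blinfun_eqI) (simp add: triple_product_cartan[OF eC] plus_blinfun.rep_eq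
          blinfun.add_right algebra_simps)
    have repL: "representable (\<lambda>w. inner (L w u) v)" for u v
    proof (rule representable_cong)
      show "representable (\<lambda>w. (- 1/2) * (inner (peirce1_proj e w u) (e (x v)) + inner (peirce1_proj e w (e (x u))) v))"
        by (intro representable_scale representable_add repP)
      show "(- 1/2) * (inner (peirce1_proj e w u) (e (x v)) + inner (peirce1_proj e w (e (x u))) v) = inner (L w u) v"
        if "w \<in> cartan" for w
        by (simp add: L_def triple_product_cartan[OF eC] inner_add_left cartan_skew[OF eC] cartan_skew[OF xC]
            algebra_simps)
    qed
    have "representable (\<lambda>w. J (L w) k)"
      by (rule representable_compose[where K = 1]) (simp_all add: LC LN Ladd repL)
    then obtain y1 where y1: "\<And>w. w \<in> cartan \<Longrightarrow> J w y1 = J (L w) k"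
      by (auto simp: representable_def)
    have Le: "L e = x"
    proof (rule blinfun_eqI)
      fix u
      have "\<And>u. x (e u) = e (x u)" "\<And>u. e (e (x u)) = - x u" using x by (auto simp: peirce1_def)
      then show "L e u = x u"
        by (simp add: L_def peirce1_proj_ident[OF tri peirce1_self[OF tri]] triple_product_cartan[OF eC]
            flip: scaleR_2)
    qed
    have "y1 = y1 + k"
    proof (rule unique_extension[where c = "norm k", OF _ _ _ eI eN])
      show "J w y1 = J w (y1 + k)" if "w \<in> I" for w using k0[OF that] by (simp add: blinfun.add_right)
      show "J w y1 \<le> norm k" if "w \<in> cartan" "norm w \<le> 1" for w
      proof -
        have "norm (L w) * norm k \<le> 1 * norm k"
          using LN[OF that(1)] that(2) by (intro mult_right_mono) auto
        then show ?thesis using J_bound[OF LC[OF that(1)], of k] by (simp add: y1 that(1))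
      qed
      show "J e y1 = norm k" by (simp add: y1 eC Le kx)
      fix w :: "'a \<Rightarrow>\<^sub>L 'a" assume w: "w \<in> cartan" "norm w \<le> 1"
      define w1 where "w1 = peirce1_proj e w"
      have w1: "w1 \<in> peirce1 e" "norm w1 \<le> 1" "w1 \<in> cartan"
        using peirce1_proj_in_peirce1[OF tri w(1)] norm_peirce1_proj_le[OF tri w(1)] w(2) P_cartan[OF w(1)]
        by (auto simp: w1_def)
      define h where "h = e - w1"
      define g where "g = triple_product x e h + h"
      have hC: "h \<in> cartan" unfolding h_def by (intro subspace_diff[OF X] eC w1)
      have gC: "g \<in> cartan" unfolding g_def by (intro subspace_add[OF X] triple_product_in_cartan xC eC hC)
      have "triple_product x e h = x - L w"
      proof (rule blinfun_eqI)
        fix u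
        have "L e u = x u" by (simp add: Le)
        then show "triple_product x e h u = (x - L w) u"
          by (simp add: L_def h_def w1_def peirce1_proj_ident[OF tri peirce1_self[OF tri]]
              triple_product_cartan[OF eC] minus_blinfun.rep_eq blinfun.diff_right algebra_simps)
      qed
      then have "J g k = J (x - L w) k + J (e - w1) k"
        using J_add[OF triple_product_in_cartan[OF xC eC hC] hC]
        by (simp add: g_def h_def blinfun.add_left)
      also have "\<dots> = norm k - J (L w) k - J w k"
        using k0[OF eI] k[OF w1(3)] k[OF w(1)] peirce1_proj_ident[OF tri w1(1)]
        by (simp add: J_diff xC LC w eC w1(3) blinfun.diff_left kx) (simp add: w1_def)
      finally have Jg: "J g k = norm k - J w (y1 + k)" by (simp add: blinfun.add_right y1 w)
      \<comment> \<open>By \<open>Jg\<close> this is the required bound. If it failed, moving from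
        \<open>x\<close> in the direction \<open>- g\<close> would raise \<open>k\<close> to first
        order while the norm grows by at most \<open>2 * t\<^sup>2\<close>.\<close>
      have "0 \<le> J g k"
      proof (rule ccontr)
        assume "\<not> 0 \<le> J g k"
        then have neg: "0 < - J g k" by simp
        have t: "t * (- J g k) \<le> 2 * t\<^sup>2 * norm k" if t: "0 \<le> t" for t
        proof -
          have "J (x - t *\<^sub>R g) k \<le> norm (x - t *\<^sub>R g) * norm k"
            using J_bound[OF subspace_diff[OF X xC subspace_scale[OF X gC]], of t k] by simp
          also have "\<dots> \<le> (1 + 2 * t\<^sup>2) * norm k"
            using peirce1_perturbation_bound[OF tri x xN w1(1,2) t]
            by (intro mult_right_mono) (auto simp: g_def h_def)
          finally show ?thesis
            by (simp add: J_diff xC subspace_scale[OF X gC] J_scale[OF gC] blinfun.diff_left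
                blinfun.scaleR_left kx algebra_simps)
        qed
        have K: "norm k > 0" using kz by auto
        \<comment> \<open>Half of the value at which the linear and the quadratic term
          balance.\<close>
        define t where "t = - J g k / (4 * norm k)"
        have t0: "t > 0" unfolding t_def by (rule divide_pos_pos) (use neg K in simp_all)
        have "t * (- J g k) \<le> t * (2 * t * norm k)"
          using t[of t] t0 by (simp add: power2_eq_square mult_ac)
        then have "- J g k \<le> 2 * t * norm k" by (simp only: mult_le_cancel_left_pos[OF t0])
        also have "\<dots> = - J g k / 2" using K by (simp add: t_def)
        finally show False using neg by simp
      qed
      then show "J w (y1 + k) \<le> norm k" using Jg by simp
    qed
    then show False using kz by simp
  qed
qed

end

subsection \<open>Rank-two operators in a smooth subtriple\<close>

lemma rank2_scaleQ_of_real: "rank2 u (of_real r *\<^sub>Q v) = r *\<^sub>R rank2 u v"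
  by (simp add: rank2_scaleR_right flip: scaleR_scaleQ)

lemma rank2_in_subspace:
  assumes I: "subspace I"
    and "rank2 u v \<in> I" "rank2 u (qi *\<^sub>Q v) \<in> I" "rank2 u (qj *\<^sub>Q v) \<in> I" "rank2 u (qk *\<^sub>Q v) \<in> I"
  shows "rank2 u (q *\<^sub>Q v) \<in> I"
proof -
  have "rank2 u (q *\<^sub>Q v) = qRe q *\<^sub>R rank2 u v + qIm1 q *\<^sub>R rank2 u (qi *\<^sub>Q v)
      + qIm2 q *\<^sub>R rank2 u (qj *\<^sub>Q v) + qIm3 q *\<^sub>R rank2 u (qk *\<^sub>Q v)"
    by (subst quat_expand[of q])
      (simp add: scaleQ_add_left rank2_add_right rank2_scaleQ_of_real flip: scaleQ_scaleQ)
  then show ?thesis using assms by (auto intro!: subspace_add subspace_scale)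
qed

text \<open>Only scalars commuting with i preserve the equation, so the solutions form a complex
  space; j maps it to the solutions for - i.\<close>

definition eigenvector :: "('a::quat_hilbert \<Rightarrow>\<^sub>L 'a) \<Rightarrow> 'a \<Rightarrow> bool" where
  "eigenvector e f \<longleftrightarrow> blinfun_apply e f = qi *\<^sub>Q f"

lemma rank2_in_peirce1:
  assumes e: "e \<in> cartan" and f: "eigenvector e f" and g: "eigenvector e g"
  shows "rank2 f g \<in> peirce1 e"
proof -
  have q: "qinner (e x) h = qinner x h * qi" if "eigenvector e h" for x h
    using that by (simp add: eigenvector_def cartan_qskew[OF e] qinner_scaleQ_right)
  have ee: "e (rank2 f g u) = (qinner u f * qi) *\<^sub>Q g - (qinner u g * qi) *\<^sub>Q f" for u
    using f g by (simp add: rank2_apply blinfun.diff_right cartan_scaleQ[OF e] eigenvector_def scaleQ_scaleQ)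
  have "e (e (rank2 f g u)) = - rank2 f g u" for u
    unfolding ee using f g
    by (simp add: blinfun.diff_right cartan_scaleQ[OF e] eigenvector_def scaleQ_scaleQ rank2_apply)
  then show ?thesis
    by (simp add: peirce1_def rank2_in_cartan ee) (simp add: rank2_apply q f g)
qed

definition quat_orthonormal :: "'a::quat_hilbert \<Rightarrow> 'a \<Rightarrow> bool" where
  "quat_orthonormal f g \<longleftrightarrow> qinner f f = 1 \<and> qinner g g = 1 \<and> qinner f g = 0 \<and> qinner g f = 0"

context smooth_subtriple
begin

lemma rank2_in_I:
  assumes "e \<in> I" "\<And>u. e (e (blinfun_apply e u)) = - e u" "eigenvector e f" "eigenvector e g"
  shows "rank2 f g \<in> I"
  using peirce1_subset[OF assms(1,2)] rank2_in_peirce1[OF _ assms(3,4)] assms(1) I_cartan by blast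

lemma eigenvector_qi: "e \<in> cartan \<Longrightarrow> eigenvector e f \<Longrightarrow> eigenvector e (qi *\<^sub>Q f)"
  by (simp add: eigenvector_def cartan_scaleQ scaleQ_scaleQ)

text \<open>Conjugating i on the line of \<open>f\<close> by an off-diagonal entry \<open>q\<close>
  carries a rotated imaginary unit to the line of \<open>g\<close>.\<close>

lemma rank2_conjugate:
  assumes fg: "quat_orthonormal f g"
    and f: "rank2 f (qi *\<^sub>Q f) \<in> I" and fgq: "\<And>q. rank2 f (q *\<^sub>Q g) \<in> I"
  shows "rank2 g ((qcnj q * qi * q) *\<^sub>Q g) \<in> I"
proof -
  let ?x = "rank2 f (q *\<^sub>Q g)" and ?d = "rank2 f (qi *\<^sub>Q f)"
  have o: "qinner f f = 1" "qinner g g = 1" "qinner f g = 0" "qinner g f = 0"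
    using fg by (auto simp: quat_orthonormal_def)
  have "triple_product ?x ?d ?x = rank2 g ((qcnj q * qi * q) *\<^sub>Q g)"
  proof (rule blinfun_eqI)
    fix u
    have x: "?x v = (qinner v f * q) *\<^sub>Q g - (qinner v g * qcnj q) *\<^sub>Q f" for v
      by (simp add: rank2_apply scaleQ_scaleQ qinner_scaleQ_right)
    have d: "?d v = 2 *\<^sub>R ((qinner v f * qi) *\<^sub>Q f)" for v
      by (simp add: rank2_apply scaleQ_scaleQ qinner_scaleQ_right scaleR_2)
    have "triple_product ?x ?d ?x u = - ?x (?d (?x u))"
      by (simp add: triple_product_cartan rank2_in_cartan flip: scaleR_2)
    also have "\<dots> = 2 *\<^sub>R ((qinner u g * qcnj q * qi * q) *\<^sub>Q g)"
      by (simp add: x d qinner_diff_left qinner_scaleQ_left qinner_scaleR o scaleQ_scaleQ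
          blinfun.minus_right blinfun.scaleR_right)
    also have "\<dots> = rank2 g ((qcnj q * qi * q) *\<^sub>Q g) u"
      by (simp add: rank2_apply scaleQ_scaleQ qinner_scaleQ_right scaleR_2 mult.assoc)
    finally show "triple_product ?x ?d ?x u = rank2 g ((qcnj q * qi * q) *\<^sub>Q g) u" .
  qed
  then show ?thesis using triple_I[OF fgq f fgq, of q q] by simp
qed

text \<open>With \<open>c = -1\<close> the tripotent is - i on the line of \<open>g\<close>, so
  there the eigenvector is \<open>qj *\<^sub>Q g\<close>. The two signs together give access to all
  four quaternionic entries between \<open>f\<close> and \<open>g\<close>.\<close>

lemma rank1_tripotents:
  assumes fg: "quat_orthonormal f g" and c: "c = 1 \<or> c = -1"
    and I: "rank2 f (qi *\<^sub>Q f) \<in> I" "rank2 g (qi *\<^sub>Q g) \<in> I"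
  defines "e \<equiv> rank1 f + c *\<^sub>R rank1 g"
  shows "e \<in> I" and "e (e (blinfun_apply e u)) = - e u" and "eigenvector e f"
    and "c = 1 \<Longrightarrow> eigenvector e g" and "c = -1 \<Longrightarrow> eigenvector e (qj *\<^sub>Q g)"
proof -
  have o: "qinner f f = 1" "qinner g g = 1" "qinner f g = 0" "qinner g f = 0"
    using fg by (auto simp: quat_orthonormal_def)
  show "e \<in> I" unfolding e_def rank1_def
    by (intro subspace_add[OF subspace_I] subspace_scale[OF subspace_I] I)
  have e: "e v = (qinner v f * qi) *\<^sub>Q f + c *\<^sub>R ((qinner v g * qi) *\<^sub>Q g)" for v
    by (simp add: e_def plus_blinfun.rep_eq scaleR_blinfun.rep_eq rank1_apply)
  have cc: "c * c = 1" using c by auto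
  have inner: "qinner (e v) f = qinner v f * qi" "qinner (e v) g = of_real c * (qinner v g * qi)" for v
    by (simp_all add: e qinner_add_left qinner_scaleQ_left qinner_scaleR o)
  show "e (e (e u)) = - e u"
  proof -
    have "c = 1 \<Longrightarrow> ?thesis" "c = -1 \<Longrightarrow> ?thesis"
      by (simp_all only: e[of "e (e u)"] inner) (simp_all add: e[of u])
    then show ?thesis using c by blast
  qed
  show "eigenvector e f" by (simp add: eigenvector_def e o)
  show "eigenvector e g" if "c = 1" using that by (simp add: eigenvector_def e o)
  show "eigenvector e (qj *\<^sub>Q g)" if "c = -1"
    using that by (simp add: eigenvector_def e o qinner_scaleQ_left scaleQ_scaleQ)
qed

lemma rank2_mixed_in_I:
  assumes fg: "quat_orthonormal f g"
    and I: "rank2 f (qi *\<^sub>Q f) \<in> I" "rank2 g (qi *\<^sub>Q g) \<in> I"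
  shows "rank2 f (q *\<^sub>Q g) \<in> I"
proof (rule rank2_in_subspace[OF subspace_I])
  let ?e = "rank1 f + 1 *\<^sub>R rank1 g" and ?e' = "rank1 f + (-1) *\<^sub>R rank1 g"
  note t = rank1_tripotents[OF fg _ I, of 1] and t' = rank1_tripotents[OF fg _ I, of "-1"]
  have eC: "?e \<in> cartan" "?e' \<in> cartan" using t(1) t'(1) I_cartan by auto
  show "rank2 f g \<in> I" by (rule rank2_in_I[of ?e]) (use t in auto)
  show "rank2 f (qi *\<^sub>Q g) \<in> I"
    by (rule rank2_in_I[of ?e]) (use t eigenvector_qi[OF eC(1)] in auto)
  show "rank2 f (qj *\<^sub>Q g) \<in> I" by (rule rank2_in_I[of ?e']) (use t' in auto)
  have "eigenvector ?e' (qi *\<^sub>Q qj *\<^sub>Q g)" by (rule eigenvector_qi[OF eC(2)]) (use t' in auto)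
  then show "rank2 f (qk *\<^sub>Q g) \<in> I"
    by (intro rank2_in_I[of ?e']) (use t' in \<open>auto simp: scaleQ_scaleQ\<close>)
qed

lemma rank2_self_in_I:
  assumes fg: "quat_orthonormal f g"
    and I: "rank2 f (qi *\<^sub>Q f) \<in> I" "rank2 g (qi *\<^sub>Q g) \<in> I"
  shows "rank2 g (q *\<^sub>Q g) \<in> I"
proof (rule rank2_in_subspace[OF subspace_I])
  note c = rank2_conjugate[OF fg I(1) rank2_mixed_in_I[OF fg I]]
  have "rank2 g g = 0" by (rule blinfun_eqI) (simp add: rank2_apply)
  then show "rank2 g g \<in> I" using subspace_0[OF subspace_I] by simp
  show "rank2 g (qi *\<^sub>Q g) \<in> I" by (rule I)
  \<comment> \<open>Conjugation by 1 + k and 1 + j is a quarter turn about the axes k and j; the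
    factor 2 is the squared norm of these quaternions.\<close>
  have "qcnj (1 + qk) * qi * (1 + qk) = of_real (- 2) * qj" "qcnj (1 + qj) * qi * (1 + qj) = of_real 2 * qk"
    by (auto simp: quat_eq_iff quat_ops_defs of_real_def qi_def qj_def qk_def)
  then have "rank2 g ((of_real (- 2) * qj) *\<^sub>Q g) \<in> I" "rank2 g ((of_real 2 * qk) *\<^sub>Q g) \<in> I"
    using c by metis+
  then have "(- 2) *\<^sub>R rank2 g (qj *\<^sub>Q g) \<in> I" "2 *\<^sub>R rank2 g (qk *\<^sub>Q g) \<in> I"
    by (simp_all only: rank2_scaleQ_of_real flip: scaleQ_scaleQ)
  from subspace_scale[OF subspace_I this(1), of "- 1/2"] subspace_scale[OF subspace_I this(2), of "1/2"]
  show "rank2 g (qj *\<^sub>Q g) \<in> I" "rank2 g (qk *\<^sub>Q g) \<in> I" by simp_all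
qed

end

subsection \<open>Spaces of eigenvectors\<close>

text \<open>For a tripotent this is the spectral projection to the eigenvalue i among i, - i and
  0.\<close>

definition eigen_part :: "('a::quat_hilbert \<Rightarrow>\<^sub>L 'a) \<Rightarrow> 'a \<Rightarrow> 'a" where
  "eigen_part e u = - ((1/2) *\<^sub>R (e (e u) + qi *\<^sub>Q e u))"

lemma eigenvector_scaleR: "eigenvector e f \<Longrightarrow> eigenvector e (r *\<^sub>R f)"
  by (simp add: eigenvector_def blinfun.scaleR_right scaleQ_scaleR)

lemma eigenvector_diff: "eigenvector e f \<Longrightarrow> eigenvector e g \<Longrightarrow> eigenvector e (f - g)"
  by (simp add: eigenvector_def blinfun.diff_right scaleQ_diff_right)

lemma eigenvector_sum: "(\<And>x. x \<in> A \<Longrightarrow> eigenvector e (f x)) \<Longrightarrow> eigenvector e (\<Sum>x\<in>A. f x)"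
  by (simp add: eigenvector_def blinfun.sum_right scaleQ_sum_right)

lemma qinner_eq_zero_sym: "qinner f g = 0 \<Longrightarrow> qinner g f = (0 :: quat)"
  by (metis qinner_commute qcnj_simps(3))

text \<open>Inner products of eigenvectors are complex numbers, so orthogonal projection and
  Gram-Schmidt do not leave the eigenspace.\<close>

lemma eigenvector_qinner_comm:
  assumes e: "e \<in> cartan" and f: "eigenvector e f" and g: "eigenvector e g"
  shows "qi * qinner f g = qinner f g * qi"
  using cartan_qskew[OF e, of f g] f g
  by (simp add: eigenvector_def qinner_scaleQ_left qinner_scaleQ_right)

lemma eigenvector_component:
  assumes e: "e \<in> cartan" and f: "eigenvector e f" and g: "eigenvector e g"
  shows "eigenvector e (qinner f g *\<^sub>Q g)"
  using g eigenvector_qinner_comm[OF assms]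
  by (simp add: eigenvector_def cartan_scaleQ[OF e] scaleQ_scaleQ)

definition qproj :: "'a::quat_hilbert set \<Rightarrow> 'a \<Rightarrow> 'a" where
  "qproj F u = (\<Sum>f\<in>F. qinner u f *\<^sub>Q f)"

definition quat_orthonormal_set :: "'a::quat_hilbert set \<Rightarrow> bool" where
  "quat_orthonormal_set F \<longleftrightarrow> (\<forall>f\<in>F. \<forall>g\<in>F. qinner f g = (if f = g then 1 else 0))"

lemma qinner_qproj:
  assumes "finite F" "quat_orthonormal_set F" "f \<in> F"
  shows "qinner (qproj F u) f = qinner u f"
proof -
  have "qinner (qproj F u) f = (\<Sum>g\<in>F. if g = f then qinner u f else 0)"
    unfolding qproj_def qinner_sum_left qinner_scaleQ_left
    using assms(2,3) by (intro sum.cong) (auto simp: quat_orthonormal_set_def)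
  then show ?thesis using assms by simp
qed

lemma qinner_qproj_right: "qinner v (qproj F u) = (\<Sum>f\<in>F. qinner v f * qcnj (qinner u f))"
  by (simp add: qproj_def qinner_sum_right qinner_scaleQ_right)

lemma inner_qproj: "inner (qproj F u) v = inner u (qproj F v)"
proof -
  have "qinner (qproj F u) v = qinner u (qproj F v)"
    by (simp add: qproj_def qinner_sum_right qinner_sum_left qinner_scaleQ_right qinner_scaleQ_left
        flip: qinner_commute)
  then show ?thesis by (simp add: inner_eq_qRe)
qed

lemma norm_qproj_le:
  assumes "finite F" "quat_orthonormal_set F"
  shows "norm (qproj F u) \<le> norm u"
proof -
  have "qinner (qproj F u) (qproj F u) = qinner u (qproj F u)"
    unfolding qinner_qproj_right by (intro sum.cong) (simp_all add: qinner_qproj[OF assms])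
  then have "inner (qproj F u) (qproj F u) = inner u (qproj F u)" by (simp add: inner_eq_qRe)
  then have "norm (qproj F u) * norm (qproj F u) \<le> norm u * norm (qproj F u)"
    using norm_cauchy_schwarz[of u "qproj F u"] by (simp add: dot_square_norm power2_eq_square)
  then show ?thesis by (cases "qproj F u = 0") auto
qed

text \<open>Gram-Schmidt inside the eigenspace. Orthonormality alone would not do: the operators
  \<open>rank2 f (qi *\<^sub>Q f)\<close> are known to lie in \<open>I\<close> only for
  eigenvectors.\<close>

lemma eigenvector_orthonormalize:
  assumes e: "e \<in> cartan" and "finite B" and "\<And>b. b \<in> B \<Longrightarrow> eigenvector e b"
  shows "\<exists>F. finite F \<and> (\<forall>f\<in>F. eigenvector e f) \<and> quat_orthonormal_set F \<and> (\<forall>b\<in>B. qproj F b = b)"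
  using assms(2,3)
proof (induction B rule: finite_induct)
  case empty
  show ?case by (intro exI[of _ "{}"]) (auto simp: quat_orthonormal_set_def)
next
  case (insert a B)
  then obtain F where F: "finite F" "\<forall>f\<in>F. eigenvector e f" "quat_orthonormal_set F" "\<forall>b\<in>B. qproj F b = b"
    by auto
  define r where "r = a - qproj F a"
  have r_orth: "qinner r f = 0" if "f \<in> F" for f
    using that qinner_qproj[OF F(1,3)] by (simp add: r_def qinner_diff_left)
  show ?case
  proof (cases "r = 0")
    case True
    then show ?thesis using F by (intro exI[of _ F]) (auto simp: r_def)
  next
    case False
    define h where "h = (1 / norm r) *\<^sub>R r"
    have h: "qinner h h = 1" using False
      by (simp add: h_def qinner_self dot_square_norm power2_eq_square)
    have h_orth: "qinner h f = 0" "qinner f h = 0" if "f \<in> F" for f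
      using r_orth[OF that] qinner_eq_zero_sym[OF r_orth[OF that]] by (auto simp: h_def qinner_scaleR)
    have hF: "h \<notin> F" using h_orth h by fastforce
    have ins: "qproj (insert h F) u = qinner u h *\<^sub>Q h + qproj F u" for u
      using F(1) hF by (simp add: qproj_def)
    have "eigenvector e h"
      unfolding h_def r_def qproj_def using F(2) insert.prems
      by (intro eigenvector_scaleR eigenvector_diff eigenvector_sum eigenvector_component[OF e]) auto
    moreover have "quat_orthonormal_set (insert h F)"
      using F(3) h h_orth hF unfolding quat_orthonormal_set_def by auto
    moreover have "qproj (insert h F) b = b" if "b \<in> B" for b
    proof -
      have "qinner (qproj F b) h = 0"
        using h_orth by (simp add: qproj_def qinner_sum_left qinner_scaleQ_left)
      then show ?thesis using F(4) that by (simp add: ins)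
    qed
    moreover have "qproj (insert h F) a = a"
    proof -
      have "qinner (qproj F a) h = 0"
        using h_orth by (simp add: qproj_def qinner_sum_left qinner_scaleQ_left)
      then have "qinner a h = qinner r h" by (simp add: r_def qinner_diff_left)
      moreover have r: "r = norm r *\<^sub>R h" using False by (simp add: h_def)
      ultimately have "qinner a h = of_real (norm r)"
        using h by (metis qinner_scaleR(1) mult.right_neutral)
      then have "qinner a h *\<^sub>Q h = r" using r by (simp flip: scaleR_scaleQ)
      then show ?thesis by (simp add: ins r_def)
    qed
    ultimately show ?thesis using F by (intro exI[of _ "insert h F"]) auto
  qed
qed

context
  fixes e :: "'a::quat_hilbert \<Rightarrow>\<^sub>L 'a"
  assumes e: "e \<in> cartan" and eee: "\<And>u. e (e (blinfun_apply e u)) = - e u"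
begin

lemma eigenvector_eigen_part: "eigenvector e (eigen_part e u)"
  by (simp add: eigenvector_def eigen_part_def blinfun.minus_right blinfun.scaleR_right
      blinfun.add_right eee cartan_scaleQ[OF e] scaleQ_scaleR scaleQ_add_right scaleQ_scaleQ)

text \<open>The quaternionic span of the eigenvectors is the range of \<open>e\<close>; two of them
  suffice for each vector.\<close>

lemma eigen_part_decomp: "e (e u) = qj *\<^sub>Q eigen_part e (qj *\<^sub>Q u) - eigen_part e u"
proof -
  have "qj *\<^sub>Q eigen_part e (qj *\<^sub>Q u) = (1/2) *\<^sub>R (e (e u) - qi *\<^sub>Q e u)"
    by (simp add: eigen_part_def cartan_scaleQ[OF e] scaleQ_scaleR scaleQ_add_right scaleQ_scaleQ
        scaleR_diff_right flip: mult.assoc)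
  then show ?thesis by (simp add: eigen_part_def algebra_simps flip: scaleR_2)
qed

lemma unit_eigenvector_exists:
  assumes "e \<noteq> 0"
  obtains f where "eigenvector e f" and "qinner f f = 1"
proof -
  obtain u where u: "e u \<noteq> 0" using assms by (metis blinfun_eqI zero_blinfun.rep_eq)
  then have "e (e u) \<noteq> 0" using eee[of u] by auto
  then obtain v where v: "eigen_part e v \<noteq> 0" using eigen_part_decomp[of u] by force
  show ?thesis
  proof (rule that[of "(1 / norm (eigen_part e v)) *\<^sub>R eigen_part e v"])
    show "eigenvector e ((1 / norm (eigen_part e v)) *\<^sub>R eigen_part e v)"
      by (intro eigenvector_scaleR eigenvector_eigen_part)
    show "qinner ((1 / norm (eigen_part e v)) *\<^sub>R eigen_part e v) ((1 / norm (eigen_part e v)) *\<^sub>R eigen_part e v) = 1"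
      using v by (simp add: qinner_self dot_square_norm power2_eq_square)
  qed
qed

end

subsection \<open>Rank\<close>

text \<open>Orthogonality is tested only inside \<open>T\<close>, so \<open>x\<close> and
  \<open>y\<close> themselves have to serve as arguments. They give yxy = 0 and y^2 x = - x y^2,
  hence y^3 x = 0. Skewness cancels the powers of y, and passing to adjoints exchanges the
  factors.\<close>

lemma orthogonal_imp_mult_eq_0:
  assumes T: "T \<subseteq> cartan" and xy: "x \<in> T" "y \<in> T"
    and o: "orthogonal_in T x y" "orthogonal_in T y x"
  shows "x (blinfun_apply y u) = 0"
proof -
  have xC: "x \<in> cartan" and yC: "y \<in> cartan" using T xy by auto
  have "triple_product x y y = 0" "triple_product y x y = 0"
    using o xy by (auto simp: orthogonal_in_def)
  then have "triple_product x y y u = 0" "triple_product y x y u = 0" for u by auto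
  then have 1: "y (y (x u)) = - x (y (y u))" and 2: "y (x (y u)) = 0" for u
    by (simp_all add: triple_product_cartan xC yC eq_neg_iff_add_eq_0 add.commute)
  have ker: "y v = 0" if "y (y v) = 0" for v
  proof -
    have "inner (y v) (y v) = 0" using that by (simp add: cartan_skew[OF yC])
    then show ?thesis by simp
  qed
  have "y (y (y (x u))) = 0" for u by (simp add: 1 2 blinfun.minus_right)
  then have yx: "y (x u) = 0" for u using ker by blast
  have "inner v (x (y u)) = 0" for v
    using cartan_skew[OF xC, of v "y u"] cartan_skew[OF yC, of "x v" u] yx[of v] by simp
  from this[of "x (y u)"] show ?thesis by simp
qed

text \<open>Otherwise the cardinal of a singleton bounds all orthogonal subsets. A least bound
  exists since cardinals are well-ordered, so the choice in \<open>triple_rank\<close> is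
  meaningful.\<close>

lemma rank_ge_2:
  assumes "|{..<2::nat}| \<le>o triple_rank T"
  shows "\<exists>S x y. orthogonal_subset T S \<and> x \<in> S \<and> y \<in> S \<and> x \<noteq> y"
proof (rule ccontr)
  assume "\<not> ?thesis"
  then have one: "x = y" if "orthogonal_subset T S" "x \<in> S" "y \<in> S" for S x y using that by blast
  define m where "m = |{0 :: 'a \<Rightarrow>\<^sub>L 'a}|"
  have "|S| \<le>o m" if "orthogonal_subset T S" for S
    unfolding m_def card_of_ordLeq[symmetric] using one[OF that] by (intro exI[of _ "\<lambda>_. 0"]) (auto simp: inj_on_def)
  then have m: "bounds_orthogonal_subsets T m"
    by (simp add: bounds_orthogonal_subsets_def m_def card_of_Card_order)
  let ?R = "{m. bounds_orthogonal_subsets T m}"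
  have "\<exists>r\<in>?R. \<forall>r'\<in>?R. r \<le>o r'"
    using m by (intro exists_minim_Card_order) (auto simp: bounds_orthogonal_subsets_def)
  then have "\<exists>r. bounds_orthogonal_subsets T r \<and> (\<forall>m'. bounds_orthogonal_subsets T m' \<longrightarrow> r \<le>o m')"
    by blast
  from someI_ex[OF this, folded triple_rank_def] m have "triple_rank T \<le>o m" by blast
  then have "|{..<2::nat}| \<le>o m" using assms ordLeq_transitive by blast
  then obtain f :: "nat \<Rightarrow> 'a \<Rightarrow>\<^sub>L 'a" where "inj_on f {..<2}" "f ` {..<2} \<subseteq> {0}"
    unfolding m_def card_of_ordLeq[symmetric] by blast
  then have "f 0 = f 1" "inj_on f {0, 1}" by (auto simp: lessThan_Suc numeral_2_eq_2 insert_commute)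
  then show False by (simp add: inj_on_def)
qed

context smooth_subtriple
begin

lemma polar_step_in_I: "x \<in> I \<Longrightarrow> polar_step x \<in> I"
  unfolding polar_step_def
  by (intro subspace_add[OF subspace_I] subspace_diff[OF subspace_I] subspace_scale[OF subspace_I] triple_I)

lemma tripotent_in_I:
  assumes x: "x \<in> I"
  obtains e where "e \<in> I" and "\<And>u. e (e (blinfun_apply e u)) = - e u"
    and "\<And>u. blinfun_apply e u = 0 \<longleftrightarrow> x u = 0"
proof -
  \<comment> \<open>The summand 1 covers \<open>x = 0\<close>; scaling does not change the
    kernel.\<close>
  define y where "y = (1 / (norm x + 1)) *\<^sub>R x"
  have pos: "norm x + 1 > 0" by (simp add: add_nonneg_pos)
  have yI: "y \<in> I" unfolding y_def by (intro subspace_scale[OF subspace_I] x)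
  have yC: "y \<in> cartan" using yI I_cartan by blast
  have yN: "norm y \<le> 1" using pos by (simp add: y_def field_simps)
  have y0: "y u = 0 \<longleftrightarrow> x u = 0" for u using pos by (simp add: y_def scaleR_blinfun.rep_eq)
  obtain e where e: "e \<in> cartan" "\<And>u. e (e (blinfun_apply e u)) = - e u"
    "\<And>u. blinfun_apply e u = 0 \<longleftrightarrow> y u = 0"
    "\<And>u. (\<lambda>n. (polar_step ^^ n) y u) \<longlonglongrightarrow> e u" "\<And>n. norm ((polar_step ^^ n) y) \<le> 1"
    using polar_part_exists[OF yC yN] by blast
  have "(polar_step ^^ n) y \<in> I" for n by (induction n) (auto simp: yI polar_step_in_I)
  then have "e \<in> I" using I_strong_limit[OF e(1), of "\<lambda>n. (polar_step ^^ n) y" 1] e(4,5) by blast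
  then show ?thesis using that e(2,3) y0 by blast
qed

lemma eigenvector_rank2_in_I:
  assumes "e \<in> I" "\<And>u. e (e (blinfun_apply e u)) = - e u" "eigenvector e f"
  shows "rank2 f (qi *\<^sub>Q f) \<in> I"
  using rank2_in_I[OF assms(1,2,3)] eigenvector_qi[OF _ assms(3)] assms(1) I_cartan by blast

lemma orthonormal_pair_exists:
  assumes "|{..<2::nat}| \<le>o triple_rank I"
  obtains f g where "quat_orthonormal f g" and "rank2 f (qi *\<^sub>Q f) \<in> I" and "rank2 g (qi *\<^sub>Q g) \<in> I"
proof -
  obtain S x y where S: "orthogonal_subset I S" "x \<in> S" "y \<in> S" "x \<noteq> y"
    using rank_ge_2[OF assms] by blast
  then have x: "x \<in> I" "x \<noteq> 0" and y: "y \<in> I" "y \<noteq> 0"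
    and o: "orthogonal_in I x y" "orthogonal_in I y x"
    by (auto simp: orthogonal_subset_def)
  have xy: "x (y u) = 0" for u by (rule orthogonal_imp_mult_eq_0[OF I_cartan x(1) y(1) o])
  obtain e where e: "e \<in> I" "\<And>u. e (e (blinfun_apply e u)) = - e u" "\<And>u. blinfun_apply e u = 0 \<longleftrightarrow> x u = 0"
    using tripotent_in_I[OF x(1)] by blast
  obtain d where d: "d \<in> I" "\<And>u. d (d (blinfun_apply d u)) = - d u" "\<And>u. blinfun_apply d u = 0 \<longleftrightarrow> y u = 0"
    using tripotent_in_I[OF y(1)] by blast
  have C: "e \<in> cartan" "d \<in> cartan" "y \<in> cartan" using e d y I_cartan by auto
  have "e \<noteq> 0" using e(3) x(2) by (metis blinfun_eqI zero_blinfun.rep_eq)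
  then obtain f where f: "eigenvector e f" "qinner f f = 1"
    using unit_eigenvector_exists[OF C(1) e(2)] by blast
  have "d \<noteq> 0" using d(3) y(2) by (metis blinfun_eqI zero_blinfun.rep_eq)
  then obtain g where g: "eigenvector d g" "qinner g g = 1"
    using unit_eigenvector_exists[OF C(2) d(2)] by blast
  \<comment> \<open>Kernels are all that passes from \<open>x\<close> and \<open>y\<close> to their
    tripotents: xy = 0 gives ey = 0, by skewness ye = 0, and then de = 0.\<close>
  have "e (y u) = 0" for u using e(3) xy by blast
  then have "inner (y (e v)) (y (e v)) = 0" for v by (simp add: cartan_skew C)
  then have "d (e v) = 0" for v using d(3) by simp
  moreover have "f = e (- (qi *\<^sub>Q f))"
    using f(1) by (simp add: blinfun.minus_right cartan_scaleQ[OF C(1)] eigenvector_def scaleQ_scaleQ)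
  ultimately have "d f = 0" by metis
  then have "qi * qinner g f = 0"
    using cartan_qskew[OF C(2), of g f] g(1) by (simp add: eigenvector_def qinner_scaleQ_left)
  then have gf: "qinner g f = 0"
    by (metis add.inverse_inverse mult_minus_left mult_zero_right quat_unit_simps(4) mult.assoc mult_1)
  show ?thesis
  proof (rule that)
    show "quat_orthonormal f g" using f g gf qinner_eq_zero_sym by (auto simp: quat_orthonormal_def)
    show "rank2 f (qi *\<^sub>Q f) \<in> I" by (rule eigenvector_rank2_in_I[OF e(1,2) f(1)])
    show "rank2 g (qi *\<^sub>Q g) \<in> I" by (rule eigenvector_rank2_in_I[OF d(1,2) g(1)])
  qed
qed

text \<open>The line of \<open>h\<close> need not be orthogonal to \<open>f\<close> or
  \<open>g\<close>, but \<open>rank2_self_in_I\<close> requires an orthogonal partner. The span of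
  \<open>f\<close> and \<open>g\<close> always contains a unit vector orthogonal to
  \<open>h\<close>, and every \<open>rank2\<close> operator within that span is already in
  \<open>I\<close>.\<close>

lemma rank2_line_in_I:
  assumes fg: "quat_orthonormal f g" and I: "rank2 f (qi *\<^sub>Q f) \<in> I" "rank2 g (qi *\<^sub>Q g) \<in> I"
    and h: "qinner h h = 1" "rank2 h (qi *\<^sub>Q h) \<in> I"
  shows "rank2 h (q *\<^sub>Q h) \<in> I"
proof -
  have o: "qinner f f = 1" "qinner g g = 1" "qinner f g = 0" "qinner g f = 0"
    using fg by (auto simp: quat_orthonormal_def)
  have gf: "quat_orthonormal g f" using o by (simp add: quat_orthonormal_def)
  obtain u where u: "qinner u u = 1" "qinner u h = 0" "rank2 u (qi *\<^sub>Q u) \<in> I"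
  proof (cases "qinner f h = 0")
    case True
    then show ?thesis using that o I by blast
  next
    case False
    define c where "c = qinner g h * inverse (qinner f h)"
    define v where "v = g - c *\<^sub>Q f"
    have vh: "qinner v h = 0"
      using False by (simp add: v_def c_def qinner_diff_left qinner_scaleQ_left mult.assoc)
    have "qinner v g = 1" using o by (simp add: v_def qinner_diff_left qinner_scaleQ_left)
    then have v0: "v \<noteq> 0" by auto
    have "rank2 v (qi *\<^sub>Q v) = rank2 g (qi *\<^sub>Q g) - rank2 g ((qi * c) *\<^sub>Q f)
        - rank2 f ((qcnj c * qi) *\<^sub>Q g) + rank2 f ((qcnj c * (qi * c)) *\<^sub>Q f)"
      unfolding v_def diff_conv_add_uminus scaleQ_add_right rank2_add_left rank2_add_right
      by (simp add: scaleQ_scaleQ rank2_scaleQ_left)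
    also have "\<dots> \<in> I"
      by (intro subspace_add[OF subspace_I] subspace_diff[OF subspace_I] I
          rank2_mixed_in_I[OF fg I] rank2_mixed_in_I[OF gf I(2,1)] rank2_self_in_I[OF gf I(2,1)])
    finally have vI: "rank2 v (qi *\<^sub>Q v) \<in> I" .
    have s: "rank2 (r *\<^sub>R v) (qi *\<^sub>Q (r *\<^sub>R v)) = (r * r) *\<^sub>R rank2 v (qi *\<^sub>Q v)" for r
    proof -
      have "rank2 (r *\<^sub>R v) w = r *\<^sub>R rank2 v w" for w
        by (metis rank2_minus_commute rank2_scaleR_right scaleR_minus_right)
      then show ?thesis by (simp add: scaleQ_scaleR rank2_scaleR_right)
    qed
    show ?thesis
    proof (rule that[of "(1 / norm v) *\<^sub>R v"])
      show "qinner ((1 / norm v) *\<^sub>R v) ((1 / norm v) *\<^sub>R v) = 1"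
        using v0 by (simp add: qinner_self dot_square_norm power2_eq_square)
      show "qinner ((1 / norm v) *\<^sub>R v) h = 0" using vh by (simp add: qinner_scaleR)
      show "rank2 ((1 / norm v) *\<^sub>R v) (qi *\<^sub>Q ((1 / norm v) *\<^sub>R v)) \<in> I"
        unfolding s by (intro subspace_scale[OF subspace_I] vI)
    qed
  qed
  have "quat_orthonormal u h" using u h qinner_eq_zero_sym by (auto simp: quat_orthonormal_def)
  then show ?thesis by (rule rank2_self_in_I[OF _ u(3) h(2)])
qed

text \<open>The approximants are compressions P z P with P = \<open>qproj F\<close> for a finite
  orthonormal set of eigenvectors. Their matrix entries lie in \<open>I\<close>, their norms are
  bounded by that of \<open>z\<close>, and on the given finite set of test vectors they agree with
  \<open>z\<close> exactly.\<close>

lemma supported_in_I: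
  assumes rank: "|{..<2::nat}| \<le>o triple_rank I"
    and eI: "e \<in> I" and eee: "\<And>u. e (e (blinfun_apply e u)) = - e u"
    and z: "z \<in> cartan" and ze: "\<And>u. z (e (e u)) = - blinfun_apply z u"
  shows "z \<in> I"
proof (rule I_weak_limit[OF z])
  fix A :: "('a \<times> 'a) set" and \<epsilon> :: real assume A: "finite A" and \<epsilon>: "\<epsilon> > 0"
  have e: "e \<in> cartan" using eI I_cartan by blast
  \<comment> \<open>By \<open>eigen_part_decomp\<close> these are the eigenvectors that P must fix
    in order to act on each test vector as the projection \<open>- e (e u)\<close>.\<close>
  define B where "B = (\<Union>(u, v)\<in>A. {eigen_part e u, eigen_part e (qj *\<^sub>Q u), eigen_part e v, eigen_part e (qj *\<^sub>Q v)})"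
  have "finite B" using A by (auto simp: B_def)
  moreover have "eigenvector e b" if "b \<in> B" for b
    using that eigenvector_eigen_part[OF e eee] by (auto simp: B_def)
  ultimately have "\<exists>F. finite F \<and> (\<forall>f\<in>F. eigenvector e f) \<and> quat_orthonormal_set F \<and> (\<forall>b\<in>B. qproj F b = b)"
    by (rule eigenvector_orthonormalize[OF e])
  then obtain F where F: "finite F" "\<And>f. f \<in> F \<Longrightarrow> eigenvector e f" "quat_orthonormal_set F"
    "\<And>b. b \<in> B \<Longrightarrow> qproj F b = b"
    by auto
  \<comment> \<open>The factor 1/2 compensates for summing over ordered pairs: skewness of
    \<open>z\<close> makes \<open>rank2\<close> contribute the terms of (f, g) and of (g,
    f).\<close>
  define w where "w = (1/2) *\<^sub>R (\<Sum>f\<in>F. \<Sum>g\<in>F. rank2 f (qinner (z f) g *\<^sub>Q g))"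
  have FI: "rank2 f (qi *\<^sub>Q f) \<in> I" if "f \<in> F" for f
    by (rule eigenvector_rank2_in_I[OF eI eee F(2)[OF that]])
  obtain f1 f2 where f12: "quat_orthonormal f1 f2" "rank2 f1 (qi *\<^sub>Q f1) \<in> I" "rank2 f2 (qi *\<^sub>Q f2) \<in> I"
    by (rule orthonormal_pair_exists[OF rank])
  have "rank2 f (q *\<^sub>Q g) \<in> I" if "f \<in> F" "g \<in> F" for f g q
  proof (cases "f = g")
    case True
    have "qinner f f = 1" using F(3) that by (simp add: quat_orthonormal_set_def)
    then show ?thesis using rank2_line_in_I[OF f12] FI that True by blast
  next
    case False
    then have "quat_orthonormal f g"
      using F(3) that by (auto simp: quat_orthonormal_set_def quat_orthonormal_def)
    then show ?thesis by (rule rank2_mixed_in_I) (use FI that in auto)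
  qed
  then have wI: "w \<in> I" unfolding w_def
    by (intro subspace_scale[OF subspace_I] subspace_sum[OF subspace_I]) auto
  have w: "w u = qproj F (z (qproj F u))" for u
  proof -
    let ?t = "\<lambda>f g. (qinner u f * qinner (z f) g) *\<^sub>Q g"
    have "rank2 f (qinner (z f) g *\<^sub>Q g) u = ?t f g + ?t g f" for f g
    proof -
      have "qcnj (qinner (z f) g) = - qinner (z g) f"
        using cartan_qskew[OF z, of g f] qinner_commute[of g "z f"] by simp
      then show ?thesis by (simp add: rank2_apply scaleQ_scaleQ qinner_scaleQ_right)
    qed
    then have "w u = (1/2) *\<^sub>R ((\<Sum>f\<in>F. \<Sum>g\<in>F. ?t f g) + (\<Sum>f\<in>F. \<Sum>g\<in>F. ?t g f))"
      by (simp add: w_def scaleR_blinfun.rep_eq blinfun.sum_left sum.distrib)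
    also have "(\<Sum>f\<in>F. \<Sum>g\<in>F. ?t g f) = (\<Sum>f\<in>F. \<Sum>g\<in>F. ?t f g)" by (rule sum.swap)
    finally have "w u = (\<Sum>f\<in>F. \<Sum>g\<in>F. ?t f g)" by (simp flip: scaleR_2)
    also have "\<dots> = (\<Sum>g\<in>F. \<Sum>f\<in>F. ?t f g)" by (rule sum.swap)
    also have "\<dots> = qproj F (z (qproj F u))"
      by (simp add: qproj_def blinfun.sum_right cartan_scaleQ[OF z] qinner_sum_left qinner_scaleQ_left
          scaleQ_sum_left)
    finally show ?thesis .
  qed
  have "norm w \<le> norm z"
  proof (rule norm_blinfun_bound)
    fix u
    have "norm (w u) \<le> norm (z (qproj F u))" unfolding w by (rule norm_qproj_le[OF F(1,3)])
    also have "\<dots> \<le> norm z * norm (qproj F u)" by (rule norm_blinfun)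
    also have "\<dots> \<le> norm z * norm u" by (intro mult_left_mono norm_qproj_le[OF F(1,3)]) simp
    finally show "norm (w u) \<le> norm z * norm u" .
  qed simp
  moreover have "inner (w u) v = inner (z u) v" if uv: "(u, v) \<in> A" for u v
  proof -
    have proj: "qproj F a = - e (e a)" if a: "eigen_part e a \<in> B" "eigen_part e (qj *\<^sub>Q a) \<in> B" for a
    proof -
      have lin: "qproj F (q *\<^sub>Q x) = q *\<^sub>Q qproj F x" "qproj F (x - y) = qproj F x - qproj F y"
        "qproj F (- x) = - qproj F x" for q x y
        by (simp_all add: qproj_def qinner_scaleQ_left scaleQ_sum_right scaleQ_scaleQ
            qinner_diff_left scaleQ_diff_left sum_subtractf sum_negf)
      have "qinner a f = qinner (- e (e a)) f" if f: "f \<in> F" for f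
      proof -
        have "e (e f) = - f" using F(2)[OF f] by (simp add: eigenvector_def cartan_scaleQ[OF e] scaleQ_scaleQ)
        then show ?thesis by (simp add: cartan_qskew[OF e])
      qed
      then have "qproj F a = qproj F (- e (e a))" by (simp add: qproj_def)
      also have "\<dots> = - e (e a)"
        unfolding eigen_part_decomp[OF e eee, of a] by (simp add: lin F(4) a)
      finally show ?thesis .
    qed
    have "qproj F u = - e (e u)" "qproj F v = - e (e v)" using uv by (intro proj; force simp: B_def)+
    then have "inner (w u) v = - inner (z u) (e (e v))"
      by (simp add: w inner_qproj blinfun.minus_right ze)
    also have "\<dots> = inner (z u) v" by (simp add: cartan_skew[OF z] ze)
    finally show ?thesis .
  qed
  ultimately show "\<exists>w\<in>I. norm w \<le> norm z \<and>
      (\<forall>(u, v)\<in>A. \<bar>inner (blinfun_apply w u) v - inner (blinfun_apply z u) v\<bar> < \<epsilon>)"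
    using wI \<epsilon> by (intro bexI[of _ w]) auto
qed

lemma inner_ideal:
  assumes rank: "|{..<2::nat}| \<le>o triple_rank I"
  shows "inner_ideal_of cartan I"
  unfolding inner_ideal_of_def
proof (intro conjI ballI)
  show "closed I"
    unfolding closed_sequential_limits
  proof (intro allI impI, elim conjE)
    fix s l assume s: "\<forall>n. s n \<in> I" "s \<longlonglongrightarrow> l"
    obtain K where K: "\<And>n. norm (s n) \<le> K"
      using convergent_imp_Bseq[of s] s(2) by (auto simp: convergent_def Bseq_def)
    have lim: "(\<lambda>n. s n u) \<longlonglongrightarrow> l u" for u by (intro tendsto_intros s)
    have sI: "s n \<in> I" for n using s(1) by blast
    have "l \<in> cartan" by (rule cartan_strong_limit[OF _ lim]) (use sI I_cartan in blast)
    then show "l \<in> I" by (rule I_strong_limit[OF _ sI K lim])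
  qed
  \<comment> \<open>The triple product is symmetric in its outer arguments, so polarization reduces
    the claim to squares. Such a square is - x c x and vanishes where \<open>x\<close> does, that
    is, on the kernel of the tripotent of \<open>x\<close>.\<close>
  have square: "triple_product x c x \<in> I" if x: "x \<in> I" and c: "c \<in> cartan" for x c
  proof -
    obtain e where e: "e \<in> I" "\<And>u. e (e (blinfun_apply e u)) = - e u" "\<And>u. blinfun_apply e u = 0 \<longleftrightarrow> x u = 0"
      using tripotent_in_I[OF x] by blast
    have xC: "x \<in> cartan" using x I_cartan by blast
    have "x (e (e u)) = - x u" for u
      using e(3)[of "e (e u) + u"] e(2)[of u] by (simp add: blinfun.add_right eq_neg_iff_add_eq_0)
    then show ?thesis
      by (intro supported_in_I[OF rank e(1,2)] triple_product_in_cartan xC c)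
        (simp add: triple_product_square[OF c] blinfun.minus_right)
  qed
  fix a c b :: "'a \<Rightarrow>\<^sub>L 'a" assume abc: "a \<in> I" "c \<in> cartan" "b \<in> I"
  have "triple_product a c b = (1/2) *\<^sub>R (triple_product (a + b) c (a + b) - triple_product a c a - triple_product b c b)"
    by (rule blinfun_eqI) (simp add: triple_product_cartan[OF abc(2), of a b]
        triple_product_square[OF abc(2)] scaleR_blinfun.rep_eq minus_blinfun.rep_eq plus_blinfun.rep_eq
        blinfun.add_right algebra_simps)
  also have "\<dots> \<in> I"
    by (intro subspace_scale[OF subspace_I] subspace_diff[OF subspace_I] square subspace_add[OF subspace_I] abc)
  finally show "triple_product a c b \<in> I" .
qed (use I_cartan subtriple in auto)

end

theorem proposition4p2:
  fixes p :: "'k rel"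
    and C I :: "('p::quat_hilbert \<Rightarrow>\<^sub>L 'p) set"
    and J :: "('p \<Rightarrow>\<^sub>L 'p) \<Rightarrow> ('y::banach \<Rightarrow>\<^sub>L real)"
  assumes "has_quat_hilbert_dim TYPE('p) p"
    and "|{..<2::nat}| \<le>o p"
    and "C = cartan_factor_III_H"
    and "isometric_predual C J"
    and "I \<subseteq> C"
    and "subtriple I"
    and "closedin (weak_star_topology C J) I"
    and "weak_star_hahn_banach_smooth C J I"
    and "|{..<2::nat}| \<le>o triple_rank I"
  shows "inner_ideal_of C I"
proof -
  interpret smooth_subtriple J I
    using assms(3-8) by unfold_locales auto
  show ?thesis using inner_ideal assms(3,9) by simp
qed

end
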